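(* The multicast capacity of a linear finite-field symmetric network with interference on $\mathcal G=(V,E)$ with source $s=1$ and destination set $D$ equals $$\min_{S\in\Gamma}\sum_{v\in\bar S^c}C_v,$$ where $C_v$ is the capacity of the symmetric discrete memoryless channel $(\mathbb F_{q_v},p(y_v|x_v),\mathcal Y_v)$ at node $v$.
   Context: $\mathcal G=(V,E)$ is a directed graph, $V=\{1,\dots,|V|\}$; node $1$ is the source $s$ (no incoming edges); $D\subseteq V\setminus\{1\}$ are destinations (no outgoing edges); $\Delta(v)=\{u:(u,v)\in E\}$. The network: each node $v\neq1$ has a finite field $\mathbb F_{q_v}$ (field sizes may differ across nodes); for each edge $(u,v)$ node $u$ sends a separate symbol $X_{u,v}^{(t)}\in\mathbb F_{q_v}$ at time $t$ (outgoing channels are orthogonal); node $v$ receives $Y_v^{(t)}$, the output of a memoryless symmetric DMC $(\mathbb F_{q_v},p(y_v|x_v),\mathcal Y_v)$ with input $X_v^{(t)}=\sum_{u\in\Delta(v)}\beta_{u,v}X_{u,v}^{(t)}$, where $\beta_{u,v}\in\mathbb F_{q_v}\setminus\{0\}$ are fixed coefficients; the channels at different nodes act independently. A DMC is symmetric (in Gallager's sense) if its output alphabet can be partitioned into subsets such that, for each subset, in the submatrix of transition probabilities (rows indexed by inputs, columns by outputs in the subset) every row is a permutation of every other row and every column is a permutation of every other column. A code of length $N$: message $W$ uniform on $\{1,\dots,M\}$; $X_{s,w}^{(t)}=f^{(t)}_{s,w}(W)$; relays $X_{v,w}^{(t)}=f^{(t)}_{v,w}(Y_v^{(1)},\dots,Y_v^{(t-1)})$;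 decoders $g_d(Y_d^{(1)},\dots,Y_d^{(N)})$, $d\in D$; $P_e=\Pr\{\bigcup_{d\in D}\{g_d\neq W\}\}$. Rate $R$ is achievable if for every $\epsilon>0$ and all large $N$ there are codes with $M\ge2^{NR}$ and $P_e\le\epsilon$; the multicast capacity is the supremum of achievable rates (capacities in bits). A cut is $S\subset V$ with $s\in S$ and $S^c\cap D\neq\emptyset$; $\Gamma$ is the set of cuts; $\bar S^c=\{v\in S^c:\exists u\in S,(u,v)\in E\}$. *)

theory Defs
  imports Complex_Main "HOL-Algebra.Ring" "HOL-Library.FuncSet" "HOL-Library.Disjoint_Sets"
begin

definition dmc :: "'a set \<Rightarrow> 'b set \<Rightarrow> ('a \<Rightarrow> 'b \<Rightarrow> real) \<Rightarrow> bool" where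
  "dmc A Y W \<longleftrightarrow> finite A \<and> A \<noteq> {} \<and> finite Y \<and>
     (\<forall>x\<in>A. \<forall>y\<in>Y. W x y \<ge> 0) \<and> (\<forall>x\<in>A. (\<Sum>y\<in>Y. W x y) = 1)"

text \<open>Symmetric DMC in Gallager's sense: the output alphabet can be partitioned into
  subsets such that, in each submatrix, every row is a permutation of every other row and
  every column is a permutation of every other column.\<close>

definition symmetric_dmc :: "'a set \<Rightarrow> 'b set \<Rightarrow> ('a \<Rightarrow> 'b \<Rightarrow> real) \<Rightarrow> bool" where
  "symmetric_dmc A Y W \<longleftrightarrow> dmc A Y W \<and>
     (\<exists>P. partition_on Y P \<and>
        (\<forall>B\<in>P.
           (\<forall>x\<in>A. \<forall>x'\<in>A. \<exists>\<sigma>. bij_betw \<sigma> B B \<and> (\<forall>y\<in>B. W x y = W x' (\<sigma> y))) \<and>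
           (\<forall>y\<in>B. \<forall>y'\<in>B. \<exists>\<pi>. bij_betw \<pi> A A \<and> (\<forall>x\<in>A. W x y = W (\<pi> x) y'))))"

definition mutual_info :: "'a set \<Rightarrow> 'b set \<Rightarrow> ('a \<Rightarrow> real) \<Rightarrow> ('a \<Rightarrow> 'b \<Rightarrow> real) \<Rightarrow> real" where
  "mutual_info A Y P W =
     (\<Sum>x\<in>A. \<Sum>y\<in>Y. if P x * W x y = 0 then 0
        else P x * W x y * log 2 (W x y / (\<Sum>x'\<in>A. P x' * W x' y)))"

definition input_distr :: "'a set \<Rightarrow> ('a \<Rightarrow> real) \<Rightarrow> bool" where
  "input_distr A P \<longleftrightarrow> (\<forall>x\<in>A. P x \<ge> 0) \<and> (\<Sum>x\<in>A. P x) = 1"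

definition dmc_capacity :: "'a set \<Rightarrow> 'b set \<Rightarrow> ('a \<Rightarrow> 'b \<Rightarrow> real) \<Rightarrow> real" where
  "dmc_capacity A Y W = Sup {mutual_info A Y P W | P. input_distr A P}"

text \<open>Graph: V = {1..n}, edge set E, source node 1, destinations D.
  Node v \<noteq> 1 has finite field K v (HOL-Algebra record over a common element type),
  output alphabet Y v and transition probabilities W v.
  beta u v is the coefficient of edge (u,v).\<close>

definition in_nbrs :: "(nat \<times> nat) set \<Rightarrow> nat \<Rightarrow> nat set" where
  "in_nbrs E v = {u. (u, v) \<in> E}"

text \<open>A code of length N with M messages consists of
  source encoders fs w t m (symbol sent from the source on edge (1,w) at time t for message m),
  relay encoders fr u w t ys (symbol sent on edge (u,w) at time t, as a function of the
  sequence ys of outputs received by u; only ys 1, ..., ys (t-1) are passed, the other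
  entries are masked), and decoders g d ys (ys = the outputs at d at times 1..N).\<close>

definition past :: "nat \<Rightarrow> (nat \<Rightarrow> 'b) \<Rightarrow> (nat \<Rightarrow> 'b)" where
  "past t ys = (\<lambda>i. if 1 \<le> i \<and> i < t then ys i else undefined)"

definition valid_code ::
  "(nat \<Rightarrow> 'a ring) \<Rightarrow> (nat \<times> nat) set
   \<Rightarrow> (nat \<Rightarrow> nat \<Rightarrow> nat \<Rightarrow> 'a) \<Rightarrow> (nat \<Rightarrow> nat \<Rightarrow> nat \<Rightarrow> (nat \<Rightarrow> 'b) \<Rightarrow> 'a) \<Rightarrow> bool" where
  "valid_code K E fs fr \<longleftrightarrow>
     (\<forall>w t m. (1, w) \<in> E \<longrightarrow> fs w t m \<in> carrier (K w)) \<and>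
     (\<forall>u w t ys. (u, w) \<in> E \<and> u \<noteq> 1 \<longrightarrow> fr u w t ys \<in> carrier (K w))"

text \<open>Channel input at node v at time t, given message m and the array y of all
  channel outputs (y u i = output at node u at time i).\<close>

definition node_input ::
  "(nat \<Rightarrow> 'a ring) \<Rightarrow> (nat \<times> nat) set \<Rightarrow> (nat \<Rightarrow> nat \<Rightarrow> 'a)
   \<Rightarrow> (nat \<Rightarrow> nat \<Rightarrow> nat \<Rightarrow> 'a) \<Rightarrow> (nat \<Rightarrow> nat \<Rightarrow> nat \<Rightarrow> (nat \<Rightarrow> 'b) \<Rightarrow> 'a)
   \<Rightarrow> nat \<Rightarrow> (nat \<Rightarrow> nat \<Rightarrow> 'b) \<Rightarrow> nat \<Rightarrow> nat \<Rightarrow> 'a" where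
  "node_input K E beta fs fr m y v t =
     finsum (K v)
       (\<lambda>u. beta u v \<otimes>\<^bsub>K v\<^esub> (if u = 1 then fs v t m else fr u v t (past t (y u))))
       (in_nbrs E v)"

text \<open>Error probability P_e = Pr(some destination decodes wrongly), the message being
  uniform on {1..M} and the channels at the nodes acting independently and memorylessly.\<close>

definition error_prob ::
  "nat set \<Rightarrow> (nat \<times> nat) set \<Rightarrow> nat set \<Rightarrow> (nat \<Rightarrow> 'a ring) \<Rightarrow> (nat \<Rightarrow> 'b set)
   \<Rightarrow> (nat \<Rightarrow> 'a \<Rightarrow> 'b \<Rightarrow> real) \<Rightarrow> (nat \<Rightarrow> nat \<Rightarrow> 'a) \<Rightarrow> nat \<Rightarrow> nat
   \<Rightarrow> (nat \<Rightarrow> nat \<Rightarrow> nat \<Rightarrow> 'a) \<Rightarrow> (nat \<Rightarrow> nat \<Rightarrow> nat \<Rightarrow> (nat \<Rightarrow> 'b) \<Rightarrow> 'a)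
   \<Rightarrow> (nat \<Rightarrow> (nat \<Rightarrow> 'b) \<Rightarrow> nat) \<Rightarrow> real" where
  "error_prob V E D K Y W beta N M fs fr g =
     (1 / real M) * (\<Sum>m\<in>{1..M}.
        \<Sum>y\<in>(PiE (V - {1}) (\<lambda>v. PiE {1..N} (\<lambda>t. Y v))).
          (\<Prod>v\<in>V - {1}. \<Prod>t\<in>{1..N}. W v (node_input K E beta fs fr m y v t) (y v t)) *
          (if (\<exists>d\<in>D. g d (y d) \<noteq> m) then 1 else 0))"

definition achievable ::
  "nat set \<Rightarrow> (nat \<times> nat) set \<Rightarrow> nat set \<Rightarrow> (nat \<Rightarrow> 'a ring) \<Rightarrow> (nat \<Rightarrow> 'b set)
   \<Rightarrow> (nat \<Rightarrow> 'a \<Rightarrow> 'b \<Rightarrow> real) \<Rightarrow> (nat \<Rightarrow> nat \<Rightarrow> 'a) \<Rightarrow> real \<Rightarrow> bool" where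
  "achievable V E D K Y W beta R \<longleftrightarrow>
     (\<forall>\<epsilon>>0. \<exists>N0. \<forall>N\<ge>N0. \<exists>M fs fr g.
        real M \<ge> 2 powr (real N * R) \<and> valid_code K E fs fr \<and>
        error_prob V E D K Y W beta N M fs fr g \<le> \<epsilon>)"

definition multicast_capacity ::
  "nat set \<Rightarrow> (nat \<times> nat) set \<Rightarrow> nat set \<Rightarrow> (nat \<Rightarrow> 'a ring) \<Rightarrow> (nat \<Rightarrow> 'b set)
   \<Rightarrow> (nat \<Rightarrow> 'a \<Rightarrow> 'b \<Rightarrow> real) \<Rightarrow> (nat \<Rightarrow> nat \<Rightarrow> 'a) \<Rightarrow> real" where
  "multicast_capacity V E D K Y W beta = Sup {R. achievable V E D K Y W beta R}"

definition cuts :: "nat set \<Rightarrow> nat set \<Rightarrow> nat set set" where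
  "cuts V D = {S. S \<subseteq> V \<and> 1 \<in> S \<and> (V - S) \<inter> D \<noteq> {}}"

definition cut_boundary :: "nat set \<Rightarrow> (nat \<times> nat) set \<Rightarrow> nat set \<Rightarrow> nat set" where
  "cut_boundary V E S = {v \<in> V - S. \<exists>u\<in>S. (u, v) \<in> E}"

end

theory Submission
  imports Defs
begin

text \<open>
  Write $Q_v$ for the output distribution of the channel at $v$ under uniform input. Symmetry
  makes $\sum_y \varphi(W_v(y|x), Q_v(y))$ independent of $x$; in particular
  $D(W_v(\cdot|x) \| Q_v) = C_v$ for every $x$.

  Converse: replace the channels at the boundary of a cut by $Q_v$. What is received beyond the
  cut then no longer depends on the message, so a decoder there succeeds with probability at most
  $1/M$, and a Chernoff bound on the likelihood ratio, whose exponential moments factorise because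
  the row sums are constant, shows that above the cut value the success probability of the true
  network vanishes.

  Achievability: time is divided into $B$ blocks. Each node $v$ uses one random affine code over
  its field, of rate close to $C_v$; since the codewords sent by its in-neighbours are superimposed
  linearly, $v$ decodes the sum of their information vectors, an element of a group $G_v$. This
  leaves a noise-free network in which each relay applies, in every block, a random function to
  everything it has received. For two messages let $S$ be the growing set of nodes that can tell
  them apart. In each block either $S$ grows, which happens at most $|V|$ times, or all boundary
  nodes of $S$ see a collision, which has probability $\prod_v 1/|G_v|$ over the boundary; in the
  exponent this is the cut value.
\<close>

section \<open>Sums over product sets\<close>

text \<open>The code at $v$ must be closed under addition, since $v$ only sees a superposition. A
  linear code would be, but proportional information vectors then have proportional codewords, so
  not even pairs of codewords are independent. A random shift restores pairwise independence, which
  is all that the random coding bound uses; it must enter the superposition exactly once, so a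
  single in-neighbour sends it.

  The order of the choices matters: the dimensions of the codes fix the groups $G_v$, then the relay
  functions are fixed in the noise-free network, and only then the codes, which are judged by their
  average error over the finitely many block sums that actually occur.

  The graph may contain cycles, so nothing can be arranged along a topological order. Dependence is
  resolved in time instead: sums over outputs are evaluated from the last time step backwards, and a
  relay uses completed blocks only. The noisy run is never conditioned on correct decoding. It is
  compared with a product law whose inputs depend on the message alone, and the two laws agree
  wherever all estimates are right. $B$ must be large compared with $|V|$ so that the blocks lost to
  the growth of $S$ cost little rate.\<close>

lemma sum_PiE_Un:
  fixes F :: "('i \<Rightarrow> 'b) \<Rightarrow> real"
  assumes "A \<inter> B = {}"
  shows "(\<Sum>y\<in>PiE (A \<union> B) Z. F y) =
    (\<Sum>a\<in>PiE A Z. \<Sum>b\<in>PiE B Z. F (\<lambda>i. if i \<in> A then a i else b i))"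
proof -
  have "(\<Sum>(a, b)\<in>PiE A Z \<times> PiE B Z. F (\<lambda>i. if i \<in> A then a i else b i)) =
      (\<Sum>y\<in>PiE (A \<union> B) Z. F y)"
  proof (rule sum.reindex_bij_witness[where j = "\<lambda>(a, b) i. if i \<in> A then a i else b i"
        and i = "\<lambda>y. (restrict y A, restrict y B)"])
    fix p assume "p \<in> PiE A Z \<times> PiE B Z"
    then obtain a b where p: "p = (a, b)" and a: "a \<in> PiE A Z" and b: "b \<in> PiE B Z" by auto
    have out: "\<And>i. i \<notin> A \<Longrightarrow> a i = undefined" "\<And>i. i \<notin> B \<Longrightarrow> b i = undefined"
      using PiE_arb[OF a] PiE_arb[OF b] by auto
    show "(restrict (case p of (a, b) \<Rightarrow> \<lambda>i. if i \<in> A then a i else b i) A,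
        restrict (case p of (a, b) \<Rightarrow> \<lambda>i. if i \<in> A then a i else b i) B) = p"
      using out assms unfolding p by (auto simp: fun_eq_iff)
    show "(case p of (a, b) \<Rightarrow> \<lambda>i. if i \<in> A then a i else b i) \<in> PiE (A \<union> B) Z"
      using a b unfolding p by (auto simp: PiE_iff extensional_def)
  next
    fix y assume y: "y \<in> PiE (A \<union> B) Z"
    show "(restrict y A, restrict y B) \<in> PiE A Z \<times> PiE B Z"
      using y by auto
    show "(case (restrict y A, restrict y B) of (a, b) \<Rightarrow> \<lambda>i. if i \<in> A then a i else b i) = y"
      using PiE_arb[OF y] by (auto simp: fun_eq_iff)
  qed (auto simp: fun_eq_iff)
  then show ?thesis by (simp add: sum.cartesian_product)
qed

lemma sum_PiE_PiE_Suc: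
  fixes G :: "('v \<Rightarrow> nat \<Rightarrow> 'b) \<Rightarrow> real"
  shows "(\<Sum>y\<in>PiE I (\<lambda>v. PiE {1..Suc N} (\<lambda>t. Y v)). G y) =
    (\<Sum>y\<in>PiE I (\<lambda>v. PiE {1..N} (\<lambda>t. Y v)). \<Sum>z\<in>PiE I Y.
      G (\<lambda>v\<in>I. (y v)(Suc N := z v)))"
proof -
  have "(\<Sum>(y, z)\<in>PiE I (\<lambda>v. PiE {1..N} (\<lambda>t. Y v)) \<times> PiE I Y.
          G (\<lambda>v\<in>I. (y v)(Suc N := z v))) =
        (\<Sum>y\<in>PiE I (\<lambda>v. PiE {1..Suc N} (\<lambda>t. Y v)). G y)"
  proof (rule sum.reindex_bij_witness[where
        j = "\<lambda>(y, z). \<lambda>v\<in>I. (y v)(Suc N := z v)" and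
        i = "\<lambda>y. (\<lambda>v\<in>I. restrict (y v) {1..N}, \<lambda>v\<in>I. y v (Suc N))"])
    fix p assume "p \<in> PiE I (\<lambda>v. PiE {1..N} (\<lambda>t. Y v)) \<times> PiE I Y"
    then obtain y z where p: "p = (y, z)" and y: "y \<in> PiE I (\<lambda>v. PiE {1..N} (\<lambda>t. Y v))"
      and z: "z \<in> PiE I Y" by auto
    have y1: "v \<in> I \<Longrightarrow> y v \<in> PiE {1..N} (\<lambda>t. Y v)" "v \<notin> I \<Longrightarrow> y v = undefined" for v
      using y PiE_arb[OF y] by auto
    have z1: "v \<in> I \<Longrightarrow> z v \<in> Y v" "v \<notin> I \<Longrightarrow> z v = undefined" for v
      using z PiE_arb[OF z] by auto
    have r: "restrict ((y v)(Suc N := z v)) {1..N} = y v" if "v \<in> I" for v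
      using PiE_arb[OF y1(1)[OF that]] by (auto simp: fun_eq_iff)
    show "(\<lambda>v\<in>I. restrict ((case p of (y, z) \<Rightarrow> \<lambda>v\<in>I. (y v)(Suc N := z v)) v) {1..N},
        \<lambda>v\<in>I. (case p of (y, z) \<Rightarrow> \<lambda>v\<in>I. (y v)(Suc N := z v)) v (Suc N)) = p"
      using r y1(2) z1(2) unfolding p by (auto simp: fun_eq_iff)
    have "(y v)(Suc N := z v) \<in> PiE {1..Suc N} (\<lambda>t. Y v)" if "v \<in> I" for v
      using y1(1)[OF that] z1(1)[OF that] by (auto simp: PiE_iff extensional_def)
    then show "(case p of (y, z) \<Rightarrow> \<lambda>v\<in>I. (y v)(Suc N := z v)) \<in>
        PiE I (\<lambda>v. PiE {1..Suc N} (\<lambda>t. Y v))"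
      unfolding p by simp
  next
    fix y assume y: "y \<in> PiE I (\<lambda>v. PiE {1..Suc N} (\<lambda>t. Y v))"
    have y1: "v \<in> I \<Longrightarrow> y v \<in> PiE {1..Suc N} (\<lambda>t. Y v)" "v \<notin> I \<Longrightarrow> y v = undefined" for v
      using y PiE_arb[OF y] by auto
    have "restrict (y v) {1..N} \<in> PiE {1..N} (\<lambda>t. Y v)" "y v (Suc N) \<in> Y v" if "v \<in> I" for v
      using y1(1)[OF that] by auto
    then show "(\<lambda>v\<in>I. restrict (y v) {1..N}, \<lambda>v\<in>I. y v (Suc N)) \<in>
        PiE I (\<lambda>v. PiE {1..N} (\<lambda>t. Y v)) \<times> PiE I Y"
      by auto
    have "(restrict (y v) {1..N})(Suc N := y v (Suc N)) = y v" if "v \<in> I" for v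
      using PiE_arb[OF y1(1)[OF that]] by (auto simp: fun_eq_iff le_Suc_eq)
    then show "(case (\<lambda>v\<in>I. restrict (y v) {1..N}, \<lambda>v\<in>I. y v (Suc N)) of
        (y, z) \<Rightarrow> \<lambda>v\<in>I. (y v)(Suc N := z v)) = y"
      using y1(2) by (auto simp: fun_eq_iff restrict_def)
  qed auto
  then show ?thesis by (simp add: sum.cartesian_product)
qed

text \<open>Induction on the horizon: the outputs of the last time step occur in no other factor, so
  for a fixed past their sum factorises over the nodes. With \<open>c v = 1\<close> this is total
  probability; with an exponential moment for \<open>c v\<close> it is the factorisation behind the
  Chernoff bound. \<open>F\<close> receives the whole array, so that causality becomes a hypothesis
  about agreement on the past.\<close>

lemma causal_sum:
  fixes F :: "'v \<Rightarrow> nat \<Rightarrow> ('v \<Rightarrow> nat \<Rightarrow> 'b) \<Rightarrow> 'b \<Rightarrow> real"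
  assumes I: "finite I" "\<And>v. v \<in> I \<Longrightarrow> finite (Y v)"
    and causal: "\<And>v t y y'. v \<in> I \<Longrightarrow> (\<forall>u\<in>I. \<forall>i\<in>{1..<t}. y u i = y' u i) \<Longrightarrow> F v t y = F v t y'"
    and tot: "\<And>v t y. v \<in> I \<Longrightarrow> (\<Sum>z\<in>Y v. F v t y z) = c v"
  shows "(\<Sum>y\<in>PiE I (\<lambda>v. PiE {1..N} (\<lambda>t. Y v)). \<Prod>v\<in>I. \<Prod>t\<in>{1..N}. F v t y (y v t)) =
    (\<Prod>v\<in>I. c v ^ N)"
proof (induction N)
  case 0
  have "PiE I (\<lambda>v. PiE {1..0::nat} (\<lambda>t. Y v)) = {\<lambda>v\<in>I. (\<lambda>t. undefined)}"
    by (auto simp: PiE_iff fun_eq_iff extensional_def)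
  then show ?case by simp
next
  case (Suc N)
  let ?S = "PiE I (\<lambda>v. PiE {1..N} (\<lambda>t. Y v))"
  let ?u = "\<lambda>y z. \<lambda>v\<in>I. (y v)(Suc N := z v)"
  have 1: "(\<Prod>v\<in>I. \<Prod>t\<in>{1..Suc N}. F v t (?u y z) (?u y z v t)) =
      (\<Prod>v\<in>I. \<Prod>t\<in>{1..N}. F v t y (y v t)) * (\<Prod>v\<in>I. F v (Suc N) y (z v))" for y z
  proof -
    have "F v t (?u y z) = F v t y" if "v \<in> I" "t \<le> Suc N" for v t
      using that by (intro causal) auto
    then have "(\<Prod>t\<in>{1..Suc N}. F v t (?u y z) (?u y z v t)) =
        (\<Prod>t\<in>{1..N}. F v t y (y v t)) * F v (Suc N) y (z v)" if "v \<in> I" for v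
      using that by (simp add: prod.nat_ivl_Suc' mult.commute)
    then show ?thesis by (simp add: prod.distrib)
  qed
  have 2: "(\<Sum>z\<in>PiE I Y. \<Prod>v\<in>I. F v (Suc N) y (z v)) = (\<Prod>v\<in>I. c v)" for y
    using I prod_sum_PiE[of I Y "\<lambda>v. F v (Suc N) y"] tot by simp
  show ?case
    unfolding sum_PiE_PiE_Suc 1
    by (simp add: sum_distrib_left[symmetric] 2 sum_distrib_right[symmetric] Suc[simplified] prod.distrib
        mult.commute)
qed

lemma sum_PiE_insert:
  fixes F :: "('i \<Rightarrow> 'b) \<Rightarrow> real"
  assumes "x \<notin> S"
  shows "(\<Sum>y\<in>PiE (insert x S) T. F y) = (\<Sum>a\<in>T x. \<Sum>h\<in>PiE S T. F (h(x := a)))"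
  unfolding PiE_insert_eq using inj_combinator[OF assms]
  by (subst sum.reindex) (auto simp: sum.cartesian_product case_prod_unfold)

text \<open>All factors except that of \<open>v\<close> sum out to 1. This requires the law at a
  node not to depend on the outputs of other nodes, which is why it is applied to the noise-free
  inputs and not to the real ones.\<close>

lemma sum_PiE_component:
  fixes p :: "'i \<Rightarrow> 'b \<Rightarrow> real"
  assumes "finite I" "v \<in> I" "\<And>u. u \<in> I \<Longrightarrow> finite (Z u)"
    and "\<And>u. u \<in> I \<Longrightarrow> u \<noteq> v \<Longrightarrow> (\<Sum>z\<in>Z u. p u z) = 1"
  shows "(\<Sum>y\<in>PiE I Z. (\<Prod>u\<in>I. p u (y u)) * f (y v)) = (\<Sum>z\<in>Z v. p v z * f z)"
proof -
  have "(\<Prod>u\<in>I. p u (y u)) * f (y v) = (\<Prod>u\<in>I. p u (y u) * (if u = v then f (y u) else 1))" for y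
    using assms(1,2) by (simp add: prod.distrib prod.delta)
  then have "(\<Sum>y\<in>PiE I Z. (\<Prod>u\<in>I. p u (y u)) * f (y v)) =
      (\<Prod>u\<in>I. \<Sum>z\<in>Z u. p u z * (if u = v then f z else 1))"
    using assms(1,3) by (simp add: prod_sum_PiE)
  also have "\<dots> = (\<Sum>z\<in>Z v. p v z * f z) * (\<Prod>u\<in>I - {v}. 1)"
    using assms(1,2,4) by (simp add: prod.remove[OF assms(1,2)])
  finally show ?thesis by simp
qed

text \<open>Times outside the window sum out to 1; the window is then shifted to
  \<open>{1..L}\<close>, the range on which the block decoders work.\<close>

lemma sum_PiE_block:
  fixes p :: "nat \<Rightarrow> 'b \<Rightarrow> real"
  assumes Y: "finite Y" and a: "a + L \<le> N" and p: "\<And>t. t \<in> {1..N} \<Longrightarrow> (\<Sum>y\<in>Y. p t y) = 1"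
  shows "(\<Sum>z\<in>PiE {1..N} (\<lambda>_. Y). (\<Prod>t\<in>{1..N}. p t (z t)) * f (\<lambda>\<tau>\<in>{1..L}. z (a + \<tau>))) =
    (\<Sum>z\<in>PiE {1..L} (\<lambda>_. Y). (\<Prod>\<tau>\<in>{1..L}. p (a + \<tau>) (z \<tau>)) * f z)"
proof -
  let ?J = "{a + 1..a + L}" and ?R = "{1..N} - {a + 1..a + L}"
  have I: "{1..N} = ?J \<union> ?R" "?J \<inter> ?R = {}" using a by auto
  have J: "(\<Prod>t\<in>?J. g t) = (\<Prod>\<tau>\<in>{1..L}. g (a + \<tau>))" for g :: "nat \<Rightarrow> real"
    by (rule prod.reindex_bij_witness[where i = "\<lambda>\<tau>. a + \<tau>" and j = "\<lambda>t. t - a"]) auto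
  have split: "(\<Prod>t\<in>{1..N}. p t (if t \<in> ?J then y t else x t)) =
      (\<Prod>\<tau>\<in>{1..L}. p (a + \<tau>) (y (a + \<tau>))) * (\<Prod>t\<in>?R. p t (x t))" for x y
  proof -
    have "(\<Prod>t\<in>?J \<union> ?R. p t (if t \<in> ?J then y t else x t)) =
       (\<Prod>t\<in>?J. p t (if t \<in> ?J then y t else x t)) * (\<Prod>t\<in>?R. p t (if t \<in> ?J then y t else x t))"
      using I(2) by (intro prod.union_disjoint) auto
    also have "(\<Prod>t\<in>?R. p t (if t \<in> ?J then y t else x t)) = (\<Prod>t\<in>?R. p t (x t))"
      by (intro prod.cong) auto
    finally show ?thesis unfolding I(1)[symmetric] J by simp
  qed
  have R: "(\<Sum>x\<in>PiE ?R (\<lambda>_. Y). \<Prod>t\<in>?R. p t (x t)) = 1"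
    using Y p by (subst prod_sum_PiE[symmetric]) auto
  have "(\<Sum>z\<in>PiE {1..N} (\<lambda>_. Y). (\<Prod>t\<in>{1..N}. p t (z t)) * f (\<lambda>\<tau>\<in>{1..L}. z (a + \<tau>))) =
      (\<Sum>y\<in>PiE ?J (\<lambda>_. Y). \<Sum>x\<in>PiE ?R (\<lambda>_. Y).
        (\<Prod>t\<in>{1..N}. p t (if t \<in> ?J then y t else x t)) *
        f (\<lambda>\<tau>\<in>{1..L}. if a + \<tau> \<in> ?J then y (a + \<tau>) else x (a + \<tau>)))"
    by (subst (1) I(1)) (rule sum_PiE_Un[OF I(2)])
  also have "\<dots> = (\<Sum>y\<in>PiE ?J (\<lambda>_. Y). \<Sum>x\<in>PiE ?R (\<lambda>_. Y).
      ((\<Prod>\<tau>\<in>{1..L}. p (a + \<tau>) (y (a + \<tau>))) * f (\<lambda>\<tau>\<in>{1..L}. y (a + \<tau>))) * (\<Prod>t\<in>?R. p t (x t)))"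
  proof (intro sum.cong refl)
    fix x y :: "nat \<Rightarrow> 'b"
    have "(\<lambda>\<tau>\<in>{1..L}. if a + \<tau> \<in> ?J then y (a + \<tau>) else x (a + \<tau>)) = (\<lambda>\<tau>\<in>{1..L}. y (a + \<tau>))"
      by (auto simp: restrict_def fun_eq_iff)
    then show "(\<Prod>t\<in>{1..N}. p t (if t \<in> ?J then y t else x t)) *
        f (\<lambda>\<tau>\<in>{1..L}. if a + \<tau> \<in> ?J then y (a + \<tau>) else x (a + \<tau>)) =
        ((\<Prod>\<tau>\<in>{1..L}. p (a + \<tau>) (y (a + \<tau>))) * f (\<lambda>\<tau>\<in>{1..L}. y (a + \<tau>))) * (\<Prod>t\<in>?R. p t (x t))"
      unfolding split by (simp only: ac_simps)
  qed
  also have "\<dots> = (\<Sum>y\<in>PiE ?J (\<lambda>_. Y).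
      (\<Prod>\<tau>\<in>{1..L}. p (a + \<tau>) (y (a + \<tau>))) * f (\<lambda>\<tau>\<in>{1..L}. y (a + \<tau>)))"
    unfolding sum_distrib_left[symmetric] R by simp
  also have "\<dots> = (\<Sum>z\<in>PiE {1..L} (\<lambda>_. Y). (\<Prod>\<tau>\<in>{1..L}. p (a + \<tau>) (z \<tau>)) * f z)"
  proof (rule sum.reindex_bij_witness[where i = "\<lambda>z. \<lambda>t\<in>?J. z (t - a)" and j = "\<lambda>y. \<lambda>\<tau>\<in>{1..L}. y (a + \<tau>)"])
    fix y assume y: "y \<in> PiE ?J (\<lambda>_. Y)"
    show "(\<lambda>t\<in>?J. (\<lambda>\<tau>\<in>{1..L}. y (a + \<tau>)) (t - a)) = y"
    proof
      fix t
      show "(\<lambda>t\<in>?J. (\<lambda>\<tau>\<in>{1..L}. y (a + \<tau>)) (t - a)) t = y t"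
        using PiE_arb[OF y, of t] by auto
    qed
    show "(\<lambda>\<tau>\<in>{1..L}. y (a + \<tau>)) \<in> PiE {1..L} (\<lambda>_. Y)" using y by auto
    have "(\<Prod>\<tau>\<in>{1..L}. p (a + \<tau>) ((\<lambda>\<tau>\<in>{1..L}. y (a + \<tau>)) \<tau>)) = (\<Prod>\<tau>\<in>{1..L}. p (a + \<tau>) (y (a + \<tau>)))"
      by (rule prod.cong) auto
    then show "(\<Prod>\<tau>\<in>{1..L}. p (a + \<tau>) ((\<lambda>\<tau>\<in>{1..L}. y (a + \<tau>)) \<tau>)) * f (\<lambda>\<tau>\<in>{1..L}. y (a + \<tau>)) =
       (\<Prod>\<tau>\<in>{1..L}. p (a + \<tau>) (y (a + \<tau>))) * f (\<lambda>\<tau>\<in>{1..L}. y (a + \<tau>))" by simp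
  next
    fix z assume z: "z \<in> PiE {1..L} (\<lambda>_. Y)"
    show "(\<lambda>\<tau>\<in>{1..L}. (\<lambda>t\<in>?J. z (t - a)) (a + \<tau>)) = z"
    proof
      fix t
      show "(\<lambda>\<tau>\<in>{1..L}. (\<lambda>t\<in>?J. z (t - a)) (a + \<tau>)) t = z t"
        using PiE_arb[OF z, of t] by auto
    qed
    show "(\<lambda>t\<in>?J. z (t - a)) \<in> PiE ?J (\<lambda>_. Y)"
      by (subst restrict_PiE_iff) (auto intro!: PiE_mem[OF z])
  qed
  finally show ?thesis .
qed

lemma PiE_subset_components:
  assumes "B \<subseteq> I" "\<And>v. v \<in> B \<Longrightarrow> C v \<subseteq> X v"
  shows "{h \<in> PiE I X. \<forall>v\<in>B. h v \<in> C v} = PiE I (\<lambda>v. if v \<in> B then C v else X v)"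
  using assms by (fastforce simp: PiE_iff split: if_splits)

section \<open>Symmetric channels\<close>

text \<open>At \<open>l = 0\<close> the moment is 1 and its derivative is the mean, which is
  negative. The form with \<open>at_right 0\<close> lets finitely many channels and inputs share one
  exponent.\<close>

lemma exp_moment_less_one:
  fixes p a :: "'y \<Rightarrow> real"
  assumes "finite Y" "(\<Sum>y\<in>Y. p y) = 1" "(\<Sum>y\<in>Y. p y * a y) < 0"
  shows "\<forall>\<^sub>F l in at_right 0. (\<Sum>y\<in>Y. p y * exp (l * a y)) < 1"
proof -
  have "((\<lambda>l. \<Sum>y\<in>Y. p y * exp (l * a y)) has_real_derivative (\<Sum>y\<in>Y. p y * a y)) (at 0)"
    by (auto intro!: derivative_eq_intros simp: mult.commute)
  from DERIV_neg_dec_right[OF this assms(3)] assms(2)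
  obtain d where "d > 0" "\<And>h. 0 < h \<Longrightarrow> h < d \<Longrightarrow> (\<Sum>y\<in>Y. p y * exp (h * a y)) < 1"
    by auto
  then show ?thesis unfolding eventually_at_right_field by blast
qed

definition out_distr :: "'a set \<Rightarrow> ('a \<Rightarrow> 'b \<Rightarrow> real) \<Rightarrow> 'b \<Rightarrow> real" where
  "out_distr A W y = (\<Sum>x\<in>A. W x y) / real (card A)"

lemma out_distr_nonneg: "dmc A Y W \<Longrightarrow> y \<in> Y \<Longrightarrow> 0 \<le> out_distr A W y"
  unfolding dmc_def out_distr_def by (auto intro!: sum_nonneg divide_nonneg_nonneg)

lemma out_distr_pos:
  assumes "dmc A Y W" "x \<in> A" "y \<in> Y" "W x y > 0"
  shows "out_distr A W y > 0"
proof -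
  have "(\<Sum>x\<in>A. W x y) > 0"
    using assms unfolding dmc_def by (intro sum_pos2[of _ x]) auto
  then show ?thesis
    using assms unfolding out_distr_def dmc_def by (auto intro!: divide_pos_pos simp: card_gt_0_iff)
qed

lemma sum_out_distr:
  assumes "dmc A Y W"
  shows "(\<Sum>y\<in>Y. out_distr A W y) = 1"
proof -
  have "(\<Sum>y\<in>Y. \<Sum>x\<in>A. W x y) = (\<Sum>x\<in>A. \<Sum>y\<in>Y. W x y)" by (rule sum.swap)
  also have "\<dots> = real (card A)" using assms unfolding dmc_def by simp
  finally show ?thesis
    using assms unfolding out_distr_def dmc_def by (simp add: sum_divide_distrib[symmetric])
qed

text \<open>On a block of the partition the column permutations make \<open>out_distr\<close>
  constant, so the row permutation of the block carries row \<open>x\<close> to row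
  \<open>x'\<close> without disturbing the second argument of \<open>\<phi>\<close>. Since
  \<open>\<phi>\<close> is arbitrary, the same fact yields the constancy of divergences and of
  exponential moments.\<close>

lemma symmetric_row_sum:
  fixes \<phi> :: "real \<Rightarrow> real \<Rightarrow> real"
  assumes "symmetric_dmc A Y W" "x \<in> A" "x' \<in> A"
  shows "(\<Sum>y\<in>Y. \<phi> (W x y) (out_distr A W y)) = (\<Sum>y\<in>Y. \<phi> (W x' y) (out_distr A W y))"
proof -
  obtain P where P: "partition_on Y P" and *: "\<forall>B\<in>P.
      (\<forall>x\<in>A. \<forall>x'\<in>A. \<exists>\<sigma>. bij_betw \<sigma> B B \<and> (\<forall>y\<in>B. W x y = W x' (\<sigma> y))) \<and>
      (\<forall>y\<in>B. \<forall>y'\<in>B. \<exists>\<pi>. bij_betw \<pi> A A \<and> (\<forall>x\<in>A. W x y = W (\<pi> x) y'))"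
    using assms(1) unfolding symmetric_dmc_def by (elim conjE exE)
  have rows: "\<exists>\<sigma>. bij_betw \<sigma> B B \<and> (\<forall>y\<in>B. W x y = W x' (\<sigma> y))" if "B \<in> P" for B
    using bspec[OF *[THEN bspec, OF that, THEN conjunct1] assms(2)] assms(3) by (rule bspec)
  have cols: "\<exists>\<pi>. bij_betw \<pi> A A \<and> (\<forall>x\<in>A. W x y = W (\<pi> x) y')"
    if "B \<in> P" "y \<in> B" "y' \<in> B" for B y y'
    using bspec[OF *[THEN bspec, OF that(1), THEN conjunct2] that(2)] that(3) by (rule bspec)
  have fin: "finite Y" using assms unfolding symmetric_dmc_def dmc_def by auto
  have Y: "Y = \<Union>P" using P by (auto simp: partition_on_def)
  have split: "(\<Sum>y\<in>Y. f y) = (\<Sum>B\<in>P. \<Sum>y\<in>B. f y)" for f :: "_ \<Rightarrow> real"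
    unfolding Y using P fin Y
    by (intro sum.Union_disjoint[unfolded comp_def])
       (auto simp: partition_on_def disjoint_def intro: finite_subset)
  have "(\<Sum>y\<in>B. \<phi> (W x y) (out_distr A W y)) = (\<Sum>y\<in>B. \<phi> (W x' y) (out_distr A W y))"
    if B: "B \<in> P" for B
  proof -
    obtain \<sigma> where \<sigma>: "bij_betw \<sigma> B B" "\<forall>y\<in>B. W x y = W x' (\<sigma> y)" using rows[OF B] by auto
    have q: "out_distr A W y = out_distr A W y'" if "y \<in> B" "y' \<in> B" for y y'
    proof -
      from cols[OF B that]
      obtain \<pi> where \<pi>: "bij_betw \<pi> A A" "\<forall>x\<in>A. W x y = W (\<pi> x) y'" by auto
      have "(\<Sum>x\<in>A. W x y) = (\<Sum>x\<in>A. W (\<pi> x) y')" using \<pi> by simp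
      also have "\<dots> = (\<Sum>x\<in>A. W x y')" by (rule sum.reindex_bij_betw[OF \<pi>(1)])
      finally show ?thesis unfolding out_distr_def by simp
    qed
    have "(\<Sum>y\<in>B. \<phi> (W x y) (out_distr A W y)) =
        (\<Sum>y\<in>B. \<phi> (W x' (\<sigma> y)) (out_distr A W (\<sigma> y)))"
      using \<sigma> q by (intro sum.cong refl) (metis bij_betwE)
    also have "\<dots> = (\<Sum>y\<in>B. \<phi> (W x' y) (out_distr A W y))"
      by (rule sum.reindex_bij_betw[OF \<sigma>(1)])
    finally show ?thesis .
  qed
  then show ?thesis unfolding split by (rule sum.cong[OF refl])
qed

text \<open>All rows have the same divergence \<open>J\<close> from the output distribution of the
  uniform input. The mutual information of any input distribution is \<open>J\<close> minus the
  divergence between its own output distribution and the uniform one, hence at most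
  \<open>J\<close>, with equality for the uniform input.\<close>

lemma symmetric_capacity:
  assumes sym: "symmetric_dmc A Y W" and x0: "x0 \<in> A"
  shows "(\<Sum>y\<in>Y. W x0 y * log 2 (W x0 y / out_distr A W y)) = dmc_capacity A Y W"
proof -
  let ?q = "out_distr A W"
  define J where "J = (\<Sum>y\<in>Y. W x0 y * log 2 (W x0 y / ?q y))"
  have dmc: "dmc A Y W" using sym unfolding symmetric_dmc_def by auto
  then have fin: "finite A" "A \<noteq> {}" "finite Y" and W0: "\<And>x y. x \<in> A \<Longrightarrow> y \<in> Y \<Longrightarrow> W x y \<ge> 0"
    and W1: "\<And>x. x \<in> A \<Longrightarrow> (\<Sum>y\<in>Y. W x y) = 1"
    unfolding dmc_def by auto
  have J: "(\<Sum>y\<in>Y. W x y * log 2 (W x y / ?q y)) = J" if "x \<in> A" for x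
    unfolding J_def by (rule symmetric_row_sum[OF sym that x0])
  have le: "mutual_info A Y P W \<le> J" if P: "input_distr A P" for P
  proof -
    let ?r = "\<lambda>y. \<Sum>x'\<in>A. P x' * W x' y"
    have P0: "\<And>x. x \<in> A \<Longrightarrow> P x \<ge> 0" and P1: "(\<Sum>x\<in>A. P x) = 1"
      using P unfolding input_distr_def by auto
    \<comment> \<open>Gibbs' inequality term by term, from \<open>ln z \<le> z - 1\<close> at
      \<open>z = ?q y / ?r y\<close>. Pairs of probability zero are split off here; the correction
      terms sum to at most \<open>(1 - 1) / ln 2\<close>.\<close>
    have termle: "(if P x * W x y = 0 then 0 else P x * W x y * log 2 (W x y / ?r y)) \<le>
        P x * (W x y * log 2 (W x y / ?q y)) + (P x * W x y * ?q y / ?r y - P x * W x y) / ln 2"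
      if x: "x \<in> A" and y: "y \<in> Y" for x y
    proof (cases "P x * W x y = 0")
      case False
      then have pos: "P x > 0" "W x y > 0" using P0[OF x] W0[OF x y] by auto
      have q: "?q y > 0" using out_distr_pos[OF dmc x y] pos by auto
      have r: "?r y > 0" using pos x y P0 W0 fin by (intro sum_pos2[of _ x]) auto
      have "ln (?q y / ?r y) \<le> ?q y / ?r y - 1" using q r by (intro ln_le_minus_one) auto
      then have "(P x * W x y) * ln (?q y / ?r y) \<le> (P x * W x y) * (?q y / ?r y - 1)"
        using pos by (intro mult_left_mono) auto
      moreover have "ln (W x y / ?r y) = ln (W x y / ?q y) + ln (?q y / ?r y)"
        using pos q r by (simp add: ln_div)
      ultimately have "(P x * W x y) * ln (W x y / ?r y) \<le>
          (P x * W x y) * ln (W x y / ?q y) + (P x * W x y) * (?q y / ?r y - 1)"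
        by (simp add: algebra_simps)
      then have "(P x * W x y) * ln (W x y / ?r y) / ln 2 \<le>
          ((P x * W x y) * ln (W x y / ?q y) + (P x * W x y) * (?q y / ?r y - 1)) / ln 2"
        by (intro divide_right_mono) auto
      then show ?thesis
        using False by (simp add: log_def add_divide_distrib diff_divide_distrib algebra_simps)
    qed auto
    have "mutual_info A Y P W \<le> (\<Sum>x\<in>A. \<Sum>y\<in>Y. P x * (W x y * log 2 (W x y / ?q y)) +
        (P x * W x y * ?q y / ?r y - P x * W x y) / ln 2)"
      unfolding mutual_info_def by (intro sum_mono termle)
    also have "\<dots> = (\<Sum>x\<in>A. P x * J) +
        ((\<Sum>y\<in>Y. \<Sum>x\<in>A. P x * W x y * ?q y / ?r y) - (\<Sum>x\<in>A. P x * (\<Sum>y\<in>Y. W x y))) / ln 2"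
      by (subst (2) sum.swap)
        (simp add: sum.distrib sum_distrib_left[symmetric] J sum_divide_distrib[symmetric]
          sum_subtractf mult.assoc)
    also have "\<dots> \<le> J + (1 - 1) / ln 2"
    proof -
      have "(\<Sum>x\<in>A. P x * W x y * ?q y / ?r y) \<le> ?q y" if y: "y \<in> Y" for y
      proof -
        have "(\<Sum>x\<in>A. P x * W x y * ?q y / ?r y) = ?r y * ?q y / ?r y"
          by (simp add: sum_divide_distrib[symmetric] sum_distrib_right[symmetric])
        then show ?thesis using out_distr_nonneg[OF dmc y] by (cases "?r y = 0") auto
      qed
      then have "(\<Sum>y\<in>Y. \<Sum>x\<in>A. P x * W x y * ?q y / ?r y) \<le> (\<Sum>y\<in>Y. ?q y)"
        by (rule sum_mono)
      then have "(\<Sum>y\<in>Y. \<Sum>x\<in>A. P x * W x y * ?q y / ?r y) \<le> 1"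
        using sum_out_distr[OF dmc] by simp
      moreover have "(\<Sum>x\<in>A. P x * J) = J" using P1 by (simp add: sum_distrib_right[symmetric])
      moreover have "(\<Sum>x\<in>A. P x * (\<Sum>y\<in>Y. W x y)) = 1" using P1 W1 by simp
      ultimately show ?thesis by (auto simp: divide_le_0_iff)
    qed
    finally show ?thesis by simp
  qed
  let ?u = "\<lambda>x::'a. 1 / real (card A)"
  have cA: "real (card A) > 0" using fin by (simp add: card_gt_0_iff)
  have u: "input_distr A ?u" using cA fin unfolding input_distr_def by auto
  have "mutual_info A Y ?u W = (\<Sum>x\<in>A. \<Sum>y\<in>Y. ?u x * (W x y * log 2 (W x y / ?q y)))"
    unfolding mutual_info_def using cA
    by (intro sum.cong refl) (auto simp: out_distr_def sum_divide_distrib)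
  also have "\<dots> = J" using cA fin by (simp add: sum_divide_distrib[symmetric] J)
  finally have "mutual_info A Y ?u W = J" .
  then have "Sup {mutual_info A Y P W | P. input_distr A P} = J"
    using u le by (intro cSup_eq_maximum) auto
  then show ?thesis unfolding dmc_capacity_def J_def by simp
qed

lemma symmetric_capacity_ln:
  assumes "symmetric_dmc A Y W" and "x \<in> A"
  shows "(\<Sum>y\<in>Y. W x y * ln (W x y / out_distr A W y)) = ln 2 * dmc_capacity A Y W"
  unfolding symmetric_capacity[OF assms, symmetric]
  by (simp add: log_def sum_distrib_left)

section \<open>The cut-set bound\<close>

locale ff_network =
  fixes V :: "nat set" and E :: "(nat \<times> nat) set" and D :: "nat set"
    and K :: "nat \<Rightarrow> 'a ring" and Y :: "nat \<Rightarrow> 'b set" and W :: "nat \<Rightarrow> 'a \<Rightarrow> 'b \<Rightarrow> real"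
    and beta :: "nat \<Rightarrow> nat \<Rightarrow> 'a"
  assumes fin_V: "finite V" and one_V: "1 \<in> V"
    and E_sub: "E \<subseteq> V \<times> V"
    and src_no_in: "(u, 1) \<notin> E"
    and D_sub: "D \<subseteq> V - {1}"
    and D_ne: "D \<noteq> {}"
    and field_K: "v \<in> V - {1} \<Longrightarrow> field (K v)"
    and finite_K: "v \<in> V - {1} \<Longrightarrow> finite (carrier (K v))"
    and sym: "v \<in> V - {1} \<Longrightarrow> symmetric_dmc (carrier (K v)) (Y v) (W v)"
    and coeff: "(u, v) \<in> E \<Longrightarrow> beta u v \<in> carrier (K v) - {\<zero>\<^bsub>K v\<^esub>}"
begin

abbreviation "Q v \<equiv> out_distr (carrier (K v)) (W v)"
abbreviation "C v \<equiv> dmc_capacity (carrier (K v)) (Y v) (W v)"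
abbreviation "outputs I N \<equiv> PiE I (\<lambda>v. PiE {1..N::nat} (\<lambda>t. Y v))"
abbreviation "inp \<equiv> node_input K E beta"

lemma dmc: "v \<in> V - {1} \<Longrightarrow> dmc (carrier (K v)) (Y v) (W v)"
  using sym unfolding symmetric_dmc_def by blast

lemma finite_Y: "v \<in> V - {1} \<Longrightarrow> finite (Y v)"
  using dmc unfolding dmc_def by blast

lemma W_nonneg: "v \<in> V - {1} \<Longrightarrow> x \<in> carrier (K v) \<Longrightarrow> y \<in> Y v \<Longrightarrow> 0 \<le> W v x y"
  using dmc unfolding dmc_def by blast

lemma W_sum: "v \<in> V - {1} \<Longrightarrow> x \<in> carrier (K v) \<Longrightarrow> (\<Sum>y\<in>Y v. W v x y) = 1"
  using dmc unfolding dmc_def by blast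

lemma in_nbrs_sub: "in_nbrs E v \<subseteq> V"
  using E_sub by (auto simp: in_nbrs_def)

lemma edge_head: "(u, v) \<in> E \<Longrightarrow> v \<in> V - {1}"
  using E_sub src_no_in by auto

lemma node_input_summand:
  assumes "valid_code K E fs fr" "u \<in> in_nbrs E v"
  shows "beta u v \<otimes>\<^bsub>K v\<^esub> (if u = 1 then fs v t m else fr u v t ys) \<in> carrier (K v)"
proof -
  have e: "(u, v) \<in> E" using assms(2) by (simp add: in_nbrs_def)
  interpret field "K v" using field_K[OF edge_head[OF e]] .
  show ?thesis using assms(1) e coeff[OF e] unfolding valid_code_def by auto
qed

lemma node_input_closed:
  assumes "valid_code K E fs fr" "v \<in> V - {1}"
  shows "inp fs fr m y v t \<in> carrier (K v)"
proof -
  interpret field "K v" using field_K[OF assms(2)] .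
  show ?thesis unfolding node_input_def
    by (rule finsum_closed) (use node_input_summand[OF assms(1)] in auto)
qed

text \<open>The message may change as long as the source is not an in-neighbour. One lemma thus
  covers causality in time as well as the independence of the message for nodes that hear only nodes
  beyond a cut.\<close>

lemma node_input_cong:
  assumes "valid_code K E fs fr" "v \<in> V - {1}"
    and "1 \<in> in_nbrs E v \<Longrightarrow> m = m'"
    and "\<And>u i. u \<in> in_nbrs E v \<Longrightarrow> u \<noteq> 1 \<Longrightarrow> 1 \<le> i \<Longrightarrow> i < t \<Longrightarrow> y u i = y' u i"
  shows "inp fs fr m y v t = inp fs fr m' y' v t"
proof -
  interpret field "K v" using field_K[OF assms(2)] .
  have "past t (y u) = past t (y' u)" if "u \<in> in_nbrs E v" "u \<noteq> 1" for u
    unfolding past_def using assms(4)[OF that] by auto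
  then have "fr u v t (past t (y u)) = fr u v t (past t (y' u))" if "u \<in> in_nbrs E v" "u \<noteq> 1" for u
    using that by metis
  then show ?thesis unfolding node_input_def
    using node_input_summand[OF assms(1)] assms(3)
    by (intro finsum_cong') auto
qed

lemma causal_node_input:
  assumes "valid_code K E fs fr" "v \<in> V - {1}"
    and "\<forall>u\<in>V - {1}. \<forall>i\<in>{1..<t}. y u i = y' u i"
  shows "inp fs fr m y v t = inp fs fr m y' v t"
proof (rule node_input_cong[OF assms(1,2)])
  fix u i assume "u \<in> in_nbrs E v" "u \<noteq> 1" "1 \<le> i" "i < t"
  then show "y u i = y' u i" using assms(3) in_nbrs_sub[of v] by auto
qed simp

lemma total_prob:
  assumes "valid_code K E fs fr"
  shows "(\<Sum>y\<in>outputs (V - {1}) N. \<Prod>v\<in>V - {1}. \<Prod>t\<in>{1..N}. W v (inp fs fr m y v t) (y v t)) = 1"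
proof -
  have c: "W v (inp fs fr m y v t) = W v (inp fs fr m y' v t)"
    if "v \<in> V - {1}" "\<forall>u\<in>V - {1}. \<forall>i\<in>{1..<t}. y u i = y' u i" for v t y y'
    using causal_node_input[OF assms that] by simp
  have "finite (V - {1})" using fin_V by simp
  from causal_sum[OF this finite_Y c W_sum[OF _ node_input_closed[OF assms]]]
  show ?thesis by simp
qed

lemma outputs_in: "y \<in> outputs I N \<Longrightarrow> v \<in> I \<Longrightarrow> t \<in> {1..N} \<Longrightarrow> y v t \<in> Y v"
  by (auto simp: PiE_iff)

text \<open>Replacing the channels at the boundary of the cut by their output distributions makes
  everything received beyond the cut independent of the message.\<close>

lemma decoding_beyond_cut:
  assumes code: "valid_code K E fs fr" and S: "S \<in> cuts V D" and d: "d \<in> V - S"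
  shows "(\<Sum>m\<in>{1..M}. \<Sum>y\<in>outputs (V - {1}) N.
      (\<Prod>v\<in>V - {1}. \<Prod>t\<in>{1..N}. (if v \<in> cut_boundary V E S then Q v (y v t)
         else W v (inp fs fr m y v t) (y v t))) * (if g (y d) = m then 1 else 0)) \<le> 1"
proof -
  let ?B = "cut_boundary V E S" and ?T = "V - S" and ?U = "S - {1}"
  have 1: "1 \<in> S" "S \<subseteq> V" using S by (auto simp: cuts_def)
  have I: "V - {1} = ?T \<union> ?U" "?T \<inter> ?U = {}" using 1 by auto
  have finT: "finite ?T" "finite ?U" using fin_V finite_subset[OF 1(2)] by auto
  define mer where "mer b a = (\<lambda>i. if i \<in> ?T then b i else a i)" for b a :: "nat \<Rightarrow> nat \<Rightarrow> 'b"
  \<comment> \<open>The message \<open>1\<close> is a placeholder: off the boundary, a node beyond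
    the cut hears only nodes beyond the cut, so its input is the same for every message.\<close>
  define z where "z v t b y = (if v \<in> ?B then Q v y else W v (inp fs fr 1 b v t) y)"
    for v t and b :: "nat \<Rightarrow> nat \<Rightarrow> 'b" and y
  define ZT where "ZT b = (\<Prod>v\<in>?T. \<Prod>t\<in>{1..N}. z v t b (b v t))" for b
  have inT: "u \<in> ?T" if "v \<in> ?T - ?B" "u \<in> in_nbrs E v" for u v
    using that E_sub by (auto simp: cut_boundary_def in_nbrs_def)
  have zsum: "(\<Sum>y\<in>Y v. z v t b y) = 1" if "v \<in> ?T" for v t b
    using that 1 W_sum[OF _ node_input_closed[OF code], of v] sum_out_distr[OF dmc[of v]]
    by (cases "v \<in> ?B") (auto simp: z_def)
  have zcausal: "z v t b = z v t b'" if "v \<in> ?T" "\<forall>u\<in>?T. \<forall>i\<in>{1..<t}. b u i = b' u i" for v t b b'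
  proof (cases "v \<in> ?B")
    case False
    then have "inp fs fr 1 b v t = inp fs fr 1 b' v t"
      using that 1 inT[of v] by (intro node_input_cong[OF code]) auto
    then show ?thesis by (simp add: z_def fun_eq_iff)
  qed (simp add: z_def fun_eq_iff)
  have Tsum: "(\<Sum>b\<in>outputs ?T N. ZT b) = 1"
  proof -
    have T: "v \<in> V - {1}" if "v \<in> ?T" for v using that 1 by auto
    show ?thesis
      unfolding ZT_def by (subst causal_sum[OF finT(1) finite_Y[OF T] zcausal zsum]) simp_all
  qed
  have Znn: "ZT b \<ge> 0" if b: "b \<in> outputs ?T N" for b
  proof -
    have "z v t b (b v t) \<ge> 0" if "v \<in> ?T" "t \<in> {1..N}" for v t
    proof -
      have v: "v \<in> V - {1}" using that 1 by auto
      show ?thesis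
        using outputs_in[OF b that] out_distr_nonneg[OF dmc[OF v]]
          W_nonneg[OF v node_input_closed[OF code v]] by (simp add: z_def)
    qed
    then show ?thesis unfolding ZT_def by (intro prod_nonneg) auto
  qed
  have split: "(\<Prod>v\<in>V - {1}. \<Prod>t\<in>{1..N}. (if v \<in> ?B then Q v (mer b a v t)
         else W v (inp fs fr m (mer b a) v t) (mer b a v t))) =
      ZT b * (\<Prod>v\<in>?U. \<Prod>t\<in>{1..N}. W v (inp fs fr m (mer b a) v t) (a v t))" for a b m
  proof -
    have "inp fs fr m (mer b a) v t = inp fs fr 1 b v t" if "v \<in> ?T" "v \<notin> ?B" for v t
      using that 1 inT[of v] by (intro node_input_cong[OF code]) (auto simp: mer_def)
    then have 2: "(if v \<in> ?B then Q v (mer b a v t)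
         else W v (inp fs fr m (mer b a) v t) (mer b a v t)) = z v t b (b v t)" if "v \<in> ?T" for v t
      using that by (auto simp: z_def mer_def)
    have 3: "(if v \<in> ?B then Q v (mer b a v t)
         else W v (inp fs fr m (mer b a) v t) (mer b a v t)) =
         W v (inp fs fr m (mer b a) v t) (a v t)" if "v \<in> ?U" for v t
      using that by (auto simp: mer_def cut_boundary_def)
    show ?thesis
      unfolding I(1) ZT_def using finT I(2) by (subst prod.union_disjoint) (auto simp: 2 3)
  qed
  \<comment> \<open>Feedback across the cut is harmless: for fixed \<open>b\<close> the inputs on
    the source side are causal in \<open>a\<close> alone, and these channels sum out to 1.\<close>
  have Usum: "(\<Sum>a\<in>outputs ?U N. \<Prod>v\<in>?U. \<Prod>t\<in>{1..N}.
      W v (inp fs fr m (mer b a) v t) (a v t)) = 1" for m b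
  proof -
    have c: "W v (inp fs fr m (mer b a) v t) = W v (inp fs fr m (mer b a') v t)"
      if "v \<in> ?U" "\<forall>u\<in>?U. \<forall>i\<in>{1..<t}. a u i = a' u i" for v t a a'
      using that 1 in_nbrs_sub[of v]
      by (intro arg_cong[where f = "W v"] node_input_cong[OF code]) (auto simp: mer_def)
    have U: "v \<in> V - {1}" if "v \<in> ?U" for v using that 1 by auto
    have "(\<Sum>a\<in>outputs ?U N. \<Prod>v\<in>?U. \<Prod>t\<in>{1..N}.
      W v (inp fs fr m (mer b a) v t) (a v t)) = (\<Prod>v\<in>?U. 1 ^ N)"
      by (rule causal_sum[OF finT(2) finite_Y[OF U] c W_sum[OF U node_input_closed[OF code U]]])
    then show ?thesis by simp
  qed
  have "(\<Sum>y\<in>outputs (V - {1}) N.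
      (\<Prod>v\<in>V - {1}. \<Prod>t\<in>{1..N}. (if v \<in> ?B then Q v (y v t)
         else W v (inp fs fr m y v t) (y v t))) * (if g (y d) = m then 1 else 0)) =
      (\<Sum>b\<in>outputs ?T N. ZT b * (if g (b d) = m then 1 else 0))" (is "?L = _") for m
  proof -
    have "?L = (\<Sum>b\<in>outputs ?T N. \<Sum>a\<in>outputs ?U N.
        (\<Prod>v\<in>V - {1}. \<Prod>t\<in>{1..N}. (if v \<in> ?B then Q v (mer b a v t)
         else W v (inp fs fr m (mer b a) v t) (mer b a v t))) * (if g (mer b a d) = m then 1 else 0))"
      unfolding mer_def I(1) by (rule sum_PiE_Un[OF I(2)])
    also have "\<dots> = (\<Sum>b\<in>outputs ?T N. \<Sum>a\<in>outputs ?U N.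
        (ZT b * (if g (b d) = m then 1 else 0)) *
        (\<Prod>v\<in>?U. \<Prod>t\<in>{1..N}. W v (inp fs fr m (mer b a) v t) (a v t)))"
      unfolding split using d by (intro sum.cong refl) (auto simp: mer_def)
    also have "\<dots> = (\<Sum>b\<in>outputs ?T N. ZT b * (if g (b d) = m then 1 else 0))"
      unfolding sum_distrib_left[symmetric] Usum by simp
    finally show ?thesis .
  qed
  then have "(\<Sum>m\<in>{1..M}. \<Sum>y\<in>outputs (V - {1}) N.
      (\<Prod>v\<in>V - {1}. \<Prod>t\<in>{1..N}. (if v \<in> ?B then Q v (y v t)
         else W v (inp fs fr m y v t) (y v t))) * (if g (y d) = m then 1 else 0)) =
      (\<Sum>m\<in>{1..M}. \<Sum>b\<in>outputs ?T N. ZT b * (if g (b d) = m then 1 else 0))"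
    by simp
  also have "\<dots> = (\<Sum>b\<in>outputs ?T N. ZT b * (\<Sum>m\<in>{1..M}. if g (b d) = m then 1 else 0))"
    unfolding sum_distrib_left by (rule sum.swap)
  \<comment> \<open>For each \<open>b\<close> the decoder names one message, so the inner sum over
    \<open>m\<close> is at most 1.\<close>
  also have "\<dots> \<le> (\<Sum>b\<in>outputs ?T N. ZT b * 1)"
    using Znn by (intro sum_mono mult_left_mono) (auto simp: sum.delta')
  finally show ?thesis using Tsum by simp
qed

text \<open>Let \<open>A\<close> be the log-likelihood ratio between the true and the replaced
  channels at the boundary. Where \<open>A\<close> is at least \<open>N\<close> times the sum of the
  \<open>c v\<close> plus \<open>\<eta>\<close>, the true weight is at most
  \<open>exp (- l * \<eta> * N)\<close> times a tilted weight \<open>X\<close> of total mass at most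
  1. Elsewhere it is at most \<open>exp (N * (sum + \<eta>))\<close> times the replaced weight
  \<open>Z\<close>, under which a decoder beyond the cut succeeds with probability at most
  \<open>1 / M\<close>. The numbers \<open>c v\<close> are rates in nats, constrained only through
  the tilted moments.\<close>

lemma success_bound:
  assumes code: "valid_code K E fs fr" and S: "S \<in> cuts V D" and M: "M \<ge> 1"
    and l: "l > 0" and mgf: "\<And>v x. v \<in> cut_boundary V E S \<Longrightarrow> x \<in> carrier (K v) \<Longrightarrow>
      (\<Sum>y\<in>Y v. W v x y * exp (l * (ln (W v x y / Q v y) - c v))) \<le> 1"
  shows "1 - error_prob V E D K Y W beta N M fs fr g \<le>
    exp (- l * \<eta> * real N) + exp (real N * ((\<Sum>v\<in>cut_boundary V E S. c v) + \<eta>)) / real M"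
proof -
  let ?I = "V - {1}" and ?B = "cut_boundary V E S"
  let ?c = "\<Sum>v\<in>?B. c v"
  obtain d where d: "d \<in> V - S" "d \<in> D" using S by (auto simp: cuts_def)
  have 1: "1 \<in> S" "S \<subseteq> V" using S by (auto simp: cuts_def)
  have BI: "?B \<subseteq> ?I" using 1 by (auto simp: cut_boundary_def)
  have finI: "finite ?I" using fin_V by auto
  define P where "P m y = (\<Prod>v\<in>?I. \<Prod>t\<in>{1..N}. W v (inp fs fr m y v t) (y v t))" for m y
  define Z where "Z m y = (\<Prod>v\<in>?I. \<Prod>t\<in>{1..N}. (if v \<in> ?B then Q v (y v t)
         else W v (inp fs fr m y v t) (y v t)))" for m y
  define r where "r v x y = (if v \<in> ?B then ln (W v x y / Q v y) else 0)" for v x y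
  define c' where "c' v = (if v \<in> ?B then c v else 0)" for v
  define X where "X m y = (\<Prod>v\<in>?I. \<Prod>t\<in>{1..N}. W v (inp fs fr m y v t) (y v t) *
      exp (l * (r v (inp fs fr m y v t) (y v t) - c' v)))" for m y
  note closed = node_input_closed[OF code]
  have nn: "P m y \<ge> 0" "Z m y \<ge> 0" "X m y \<ge> 0" if y: "y \<in> outputs ?I N" for m y
  proof -
    have W0: "W v (inp fs fr m y v t) (y v t) \<ge> 0" if "v \<in> ?I" "t \<in> {1..N}" for v t
      by (rule W_nonneg[OF that(1) closed[OF that(1)] outputs_in[OF y that]])
    have Q0: "Q v (y v t) \<ge> 0" if "v \<in> ?I" "t \<in> {1..N}" for v t
      by (rule out_distr_nonneg[OF dmc[OF that(1)] outputs_in[OF y that]])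
    show "P m y \<ge> 0" "Z m y \<ge> 0" "X m y \<ge> 0"
      unfolding P_def Z_def X_def using W0 Q0
      by (intro prod_nonneg ballI; auto)+
  qed
  have Xsum: "(\<Sum>y\<in>outputs ?I N. X m y) \<le> 1" for m
  proof -
    \<comment> \<open>The zero input is a mere representative: by \<open>symmetric_row_sum\<close>
      the moment is the same for every input, so \<open>causal_sum\<close> applies although the
      actual inputs depend on the past.\<close>
    define k where "k v = (\<Sum>y\<in>Y v. W v \<zero>\<^bsub>K v\<^esub> y * exp (l * (r v \<zero>\<^bsub>K v\<^esub> y - c' v)))" for v
    have zc: "\<zero>\<^bsub>K v\<^esub> \<in> carrier (K v)" if "v \<in> ?I" for v
    proof -
      interpret field "K v" using field_K[OF that] .
      show ?thesis by simp
    qed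
    have k: "(\<Sum>y\<in>Y v. W v x y * exp (l * (r v x y - c' v))) = k v"
      if v: "v \<in> ?I" and x: "x \<in> carrier (K v)" for v x
      unfolding k_def r_def
      by (rule symmetric_row_sum[OF sym[OF v] x zc[OF v],
            where \<phi> = "\<lambda>w q. w * exp (l * ((if v \<in> ?B then ln (w / q) else 0) - c' v))"])
    have k1: "k v \<le> 1" if v: "v \<in> ?I" for v
      using mgf[of v, OF _ zc[OF v]] W_sum[OF v zc[OF v]] unfolding k_def r_def c'_def by auto
    have k0: "k v \<ge> 0" if v: "v \<in> ?I" for v
      unfolding k_def using W_nonneg[OF v zc[OF v]] by (intro sum_nonneg) auto
    have "(\<Sum>y\<in>outputs ?I N. X m y) = (\<Prod>v\<in>?I. k v ^ N)"
      unfolding X_def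
    proof (rule causal_sum[where F = "\<lambda>v t y z. W v (inp fs fr m y v t) z *
         exp (l * (r v (inp fs fr m y v t) z - c' v))"])
      fix v t and y y' :: "nat \<Rightarrow> nat \<Rightarrow> 'b"
      assume "v \<in> ?I" "\<forall>u\<in>?I. \<forall>i\<in>{1..<t}. y u i = y' u i"
      from causal_node_input[OF code this, of m] show "(\<lambda>z. W v (inp fs fr m y v t) z * exp (l * (r v (inp fs fr m y v t) z - c' v))) =
          (\<lambda>z. W v (inp fs fr m y' v t) z * exp (l * (r v (inp fs fr m y' v t) z - c' v)))"
        by simp
    qed (auto simp: finI finite_Y k closed fin_V)
    also have "\<dots> \<le> 1" using k0 k1 by (intro prod_le_1) (auto intro: power_le_one)
    finally show ?thesis .
  qed
  have pt: "P m y \<le> exp (- l * \<eta> * real N) * X m y + exp (real N * (?c + \<eta>)) * Z m y"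
    if y: "y \<in> outputs ?I N" for m y
  proof (cases "P m y = 0")
    case True
    then show ?thesis using nn[OF y, of m] by simp
  next
    case False
    let ?x = "\<lambda>v t. inp fs fr m y v t"
    have Wpos: "W v (?x v t) (y v t) > 0" if "v \<in> ?I" "t \<in> {1..N}" for v t
      using False that W_nonneg[OF that(1) closed[OF that(1)] outputs_in[OF y that]] finI
      unfolding P_def by (auto simp: less_le)
    have Qpos: "Q v (y v t) > 0" if "v \<in> ?I" "t \<in> {1..N}" for v t
      using out_distr_pos[OF dmc[OF that(1)] closed[OF that(1)] outputs_in[OF y that] Wpos[OF that]] .
    define A where "A = (\<Sum>v\<in>?I. \<Sum>t\<in>{1..N}. r v (?x v t) (y v t))"
    have c's: "(\<Sum>v\<in>?I. c' v) = ?c"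
      unfolding c'_def using BI finI by (subst sum.inter_restrict[symmetric]) (auto simp: Int_absorb1)
    have XP: "X m y = P m y * exp (l * (A - real N * ?c))"
    proof -
      have "l * (A - real N * ?c) = (\<Sum>v\<in>?I. \<Sum>t\<in>{1..N}. l * (r v (?x v t) (y v t) - c' v))"
        unfolding A_def c's[symmetric]
        by (simp add: sum_distrib_left sum_subtractf algebra_simps)
      then show ?thesis unfolding X_def P_def by (simp add: prod.distrib exp_sum fin_V)
    qed
    have ZP: "Z m y = P m y * exp (- A)"
    proof -
      have "(if v \<in> ?B then Q v (y v t) else W v (?x v t) (y v t)) =
          W v (?x v t) (y v t) * exp (- r v (?x v t) (y v t))" if "v \<in> ?I" "t \<in> {1..N}" for v t
        using Wpos[OF that] Qpos[OF that] by (simp add: r_def exp_minus)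
      moreover have "- A = (\<Sum>v\<in>?I. \<Sum>t\<in>{1..N}. - r v (?x v t) (y v t))"
        unfolding A_def by (simp add: sum_negf)
      ultimately show ?thesis unfolding Z_def P_def by (simp add: prod.distrib exp_sum fin_V)
    qed
    have "1 \<le> exp (- l * \<eta> * real N) * exp (l * (A - real N * ?c)) +
        exp (real N * (?c + \<eta>)) * exp (- A)"
    proof (cases "A - real N * ?c \<ge> \<eta> * real N")
      case True
      then have "l * (A - real N * ?c) \<ge> l * (\<eta> * real N)" using l by (intro mult_left_mono) auto
      then have "1 \<le> exp (- l * \<eta> * real N + l * (A - real N * ?c))" by (simp add: algebra_simps)
      then show ?thesis by (simp add: exp_add[symmetric] add_increasing2)
    next
      case False
      then have "1 \<le> exp (real N * (?c + \<eta>) + (- A))" by (simp add: algebra_simps)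
      then show ?thesis unfolding exp_add by (simp add: add_increasing)
    qed
    then have "P m y * 1 \<le> P m y * (exp (- l * \<eta> * real N) * exp (l * (A - real N * ?c)) +
        exp (real N * (?c + \<eta>)) * exp (- A))"
      using nn(1)[OF y, of m] by (intro mult_left_mono) auto
    then show ?thesis unfolding XP ZP by (simp add: algebra_simps)
  qed
  let ?ok = "\<lambda>y m. if g d (y d) = m then 1 else 0 :: real"
  have one: "1 - (\<Sum>y\<in>outputs ?I N. P m y * (if \<exists>d\<in>D. g d (y d) \<noteq> m then 1 else 0)) \<le>
      exp (- l * \<eta> * real N) + exp (real N * (?c + \<eta>)) * (\<Sum>y\<in>outputs ?I N. Z m y * ?ok y m)" for m
  proof -
    have "1 - (\<Sum>y\<in>outputs ?I N. P m y * (if \<exists>d\<in>D. g d (y d) \<noteq> m then 1 else 0)) =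
       (\<Sum>y\<in>outputs ?I N. P m y - P m y * (if \<exists>d\<in>D. g d (y d) \<noteq> m then 1 else 0))"
      using total_prob[OF code, of m N] by (simp add: sum_subtractf P_def)
    also have "\<dots> \<le> (\<Sum>y\<in>outputs ?I N. exp (- l * \<eta> * real N) * X m y +
        exp (real N * (?c + \<eta>)) * (Z m y * ?ok y m))"
    proof (rule sum_mono)
      fix y assume y: "y \<in> outputs ?I N"
      show "P m y - P m y * (if \<exists>d\<in>D. g d (y d) \<noteq> m then 1 else 0) \<le>
          exp (- l * \<eta> * real N) * X m y + exp (real N * (?c + \<eta>)) * (Z m y * ?ok y m)"
        using pt[OF y, of m] nn[OF y, of m] d by (auto intro: add_nonneg_nonneg)
    qed
    also have "\<dots> = exp (- l * \<eta> * real N) * (\<Sum>y\<in>outputs ?I N. X m y) +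
        exp (real N * (?c + \<eta>)) * (\<Sum>y\<in>outputs ?I N. Z m y * ?ok y m)"
      by (simp add: sum.distrib sum_distrib_left)
    also have "\<dots> \<le> exp (- l * \<eta> * real N) * 1 +
        exp (real N * (?c + \<eta>)) * (\<Sum>y\<in>outputs ?I N. Z m y * ?ok y m)"
      using Xsum[of m] by (intro add_mono mult_left_mono) auto
    finally show ?thesis by simp
  qed
  have "real M * (1 - error_prob V E D K Y W beta N M fs fr g) =
    (\<Sum>m\<in>{1..M}. 1 - (\<Sum>y\<in>outputs ?I N. P m y * (if \<exists>d\<in>D. g d (y d) \<noteq> m then 1 else 0)))"
    using M by (simp add: error_prob_def P_def sum_subtractf right_diff_distrib)
  also have "\<dots> \<le> (\<Sum>m\<in>{1..M}. exp (- l * \<eta> * real N) +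
      exp (real N * (?c + \<eta>)) * (\<Sum>y\<in>outputs ?I N. Z m y * ?ok y m))"
    by (intro sum_mono one)
  also have "\<dots> = real M * exp (- l * \<eta> * real N) +
      exp (real N * (?c + \<eta>)) * (\<Sum>m\<in>{1..M}. \<Sum>y\<in>outputs ?I N. Z m y * ?ok y m)"
    by (simp add: sum.distrib sum_distrib_left)
  also have "\<dots> \<le> real M * exp (- l * \<eta> * real N) + exp (real N * (?c + \<eta>)) * 1"
    using decoding_beyond_cut[OF code S d(1), of N "g d" M] unfolding Z_def
    by (intro add_mono mult_left_mono) auto
  finally show ?thesis using M by (simp add: field_simps)
qed

lemma achievable_le_cut:
  assumes ach: "achievable V E D K Y W beta R" and S: "S \<in> cuts V D"
  shows "R \<le> (\<Sum>v\<in>cut_boundary V E S. C v)"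
proof (rule ccontr)
  let ?B = "cut_boundary V E S"
  assume "\<not> ?thesis"
  then have gap: "R - (\<Sum>v\<in>?B. C v) > 0" (is "?g > 0") by simp
  have finB: "finite ?B" using fin_V by (auto simp: cut_boundary_def)
  have BI: "?B \<subseteq> V - {1}" using S by (auto simp: cut_boundary_def cuts_def)
  \<comment> \<open>Half of the gap is divided into equal shares, one for each boundary channel and
    one for \<open>\<eta>\<close>; the other half, converted from bits to nats, is the exponent
    \<open>h\<close> below.\<close>
  define \<delta> where "\<delta> = ?g / (2 * (real (card ?B) + 1))"
  have \<delta>: "\<delta> > 0" using gap by (simp add: \<delta>_def)
  define c where "c v = ln 2 * (C v + \<delta>)" for v
  define \<eta> where "\<eta> = ln 2 * \<delta>"
  have \<eta>: "\<eta> > 0" using \<delta> by (simp add: \<eta>_def)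
  have "\<forall>\<^sub>F l in at_right 0. (\<Sum>y\<in>Y v. W v x y * exp (l * (ln (W v x y / Q v y) - c v))) < 1"
    if v: "v \<in> V - {1}" and x: "x \<in> carrier (K v)" for v x
  proof (rule exp_moment_less_one[OF finite_Y[OF v] W_sum[OF v x]])
    have "(\<Sum>y\<in>Y v. W v x y * (ln (W v x y / Q v y) - c v)) =
        (\<Sum>y\<in>Y v. W v x y * ln (W v x y / Q v y)) - (\<Sum>y\<in>Y v. W v x y) * c v"
      by (simp add: right_diff_distrib sum_subtractf sum_distrib_right)
    also have "\<dots> = - \<eta>"
      by (simp add: symmetric_capacity_ln[OF sym[OF v] x] W_sum[OF v x] c_def \<eta>_def algebra_simps)
    finally show "(\<Sum>y\<in>Y v. W v x y * (ln (W v x y / Q v y) - c v)) < 0" using \<eta> by simp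
  qed
  then have "\<forall>\<^sub>F l in at_right 0. \<forall>v\<in>?B. \<forall>x\<in>carrier (K v).
      (\<Sum>y\<in>Y v. W v x y * exp (l * (ln (W v x y / Q v y) - c v))) < 1"
    using BI finB finite_K by (intro eventually_ball_finite ballI) auto
  then have "\<exists>l>0. \<forall>v\<in>?B. \<forall>x\<in>carrier (K v).
      (\<Sum>y\<in>Y v. W v x y * exp (l * (ln (W v x y / Q v y) - c v))) < 1"
    unfolding eventually_at_right_field by (elim exE conjE) (meson dense)
  then obtain l :: real where l: "l > 0" and mgf: "\<forall>v\<in>?B. \<forall>x\<in>carrier (K v).
      (\<Sum>y\<in>Y v. W v x y * exp (l * (ln (W v x y / Q v y) - c v))) < 1"
    by (elim exE conjE)
  obtain N0 where N0: "\<And>N. N \<ge> N0 \<Longrightarrow> \<exists>M fs fr g. real M \<ge> 2 powr (real N * R) \<and>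
      valid_code K E fs fr \<and> error_prob V E D K Y W beta N M fs fr g \<le> 1 / 2"
    using ach unfolding achievable_def by (meson half_gt_zero zero_less_one)
  have lim: "(\<lambda>N. exp (- (k * real N))) \<longlonglongrightarrow> 0" if "k > 0" for k :: real
  proof -
    have "(\<lambda>N. exp (- k) ^ N) \<longlonglongrightarrow> 0" using that by (intro LIMSEQ_power_zero) auto
    then show ?thesis by (simp add: exp_of_nat_mult[symmetric] mult.commute)
  qed
  define h where "h = ln 2 * R - ((\<Sum>v\<in>?B. c v) + \<eta>)"
  have h: "h > 0"
  proof -
    have "(\<Sum>v\<in>?B. c v) + \<eta> = ln 2 * ((\<Sum>v\<in>?B. C v) + \<delta> * (real (card ?B) + 1))"
      by (simp add: c_def \<eta>_def sum_distrib_left[symmetric] sum.distrib algebra_simps)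
    also have "\<delta> * (real (card ?B) + 1) = ?g / 2"
      unfolding \<delta>_def by (simp add: divide_simps)
    finally have "h * 2 = ln 2 * ?g" unfolding h_def by (simp add: field_simps)
    moreover have "ln 2 * ?g > 0" using gap by (intro mult_pos_pos) auto
    ultimately show ?thesis by linarith
  qed
  have "\<forall>\<^sub>F N in sequentially. exp (- ((l * \<eta>) * real N)) < 1 / 4"
       "\<forall>\<^sub>F N in sequentially. exp (- (h * real N)) < 1 / 4"
    using order_tendstoD(2)[OF lim[of "l * \<eta>"], of "1 / 4"] order_tendstoD(2)[OF lim[OF h], of "1 / 4"]
      l \<eta> by (auto simp del: less_divide_eq_numeral1)
  then have "\<forall>\<^sub>F N in sequentially. exp (- ((l * \<eta>) * real N)) < 1 / 4 \<and>
      exp (- (h * real N)) < 1 / 4 \<and> N \<ge> N0"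
    using eventually_ge_at_top[of N0] by eventually_elim auto
  \<comment> \<open>With error at most 1/2 the success probability is at least 1/2, so two terms
    below 1/4 give the contradiction.\<close>
  then obtain N where N: "exp (- ((l * \<eta>) * real N)) < 1 / 4" "exp (- (h * real N)) < 1 / 4"
    "N \<ge> N0" by (auto simp: eventually_sequentially)
  obtain M fs fr g where M: "real M \<ge> 2 powr (real N * R)" and code: "valid_code K E fs fr"
    and err: "error_prob V E D K Y W beta N M fs fr g \<le> 1 / 2"
    using N0[OF N(3)] by blast
  have M1: "M \<ge> 1" using M powr_gt_zero[of 2 "real N * R"] by (cases M) auto
  have "1 - error_prob V E D K Y W beta N M fs fr g \<le>
    exp (- l * \<eta> * real N) + exp (real N * ((\<Sum>v\<in>?B. c v) + \<eta>)) / real M"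
    using mgf by (intro success_bound[OF code S M1 l]) (auto intro: less_imp_le)
  moreover have "exp (real N * ((\<Sum>v\<in>?B. c v) + \<eta>)) / real M \<le>
      exp (real N * ((\<Sum>v\<in>?B. c v) + \<eta>)) / 2 powr (real N * R)"
    using M M1 by (intro divide_left_mono) auto
  moreover have "exp (real N * ((\<Sum>v\<in>?B. c v) + \<eta>)) / 2 powr (real N * R) = exp (- (h * real N))"
    by (simp add: powr_def exp_diff[symmetric] h_def algebra_simps)
  ultimately show False using err N by (simp add: mult.assoc)
qed

end

section \<open>Affine codes\<close>

lemma exists_le_average:
  fixes f :: "'i \<Rightarrow> real"
  assumes "finite A" "A \<noteq> {}" "(\<Sum>a\<in>A. f a) \<le> real (card A) * c"
  shows "\<exists>a\<in>A. f a \<le> c"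
proof (rule ccontr)
  assume "\<not> ?thesis"
  then have "(\<Sum>a\<in>A. c) < (\<Sum>a\<in>A. f a)" using assms by (intro sum_strict_mono) auto
  then show False using assms(3) by simp
qed

lemma (in abelian_group) sum_translate:
  fixes f :: "'a \<Rightarrow> real"
  assumes "a \<in> carrier G"
  shows "(\<Sum>c\<in>carrier G. f (a \<oplus> c)) = (\<Sum>c\<in>carrier G. f c)"
  by (rule sum.reindex_bij_witness[where i = "\<lambda>c. \<ominus> a \<oplus> c" and j = "\<lambda>c. a \<oplus> c"])
    (use assms in \<open>auto simp: a_assoc[symmetric] r_neg l_neg\<close>)

lemma (in field) sum_affine:
  fixes f :: "'a \<Rightarrow> real"
  assumes "a \<in> carrier R" "d \<in> carrier R" "d \<noteq> \<zero>"
  shows "(\<Sum>x\<in>carrier R. f (x \<otimes> d \<oplus> a)) = (\<Sum>x\<in>carrier R. f x)"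
proof -
  have i: "inv d \<in> carrier R" "inv d \<otimes> d = \<one>" "d \<otimes> inv d = \<one>"
    using assms field_Units by auto
  show ?thesis
  proof (rule sum.reindex_bij_witness[where i = "\<lambda>y. (y \<ominus> a) \<otimes> inv d" and j = "\<lambda>x. x \<otimes> d \<oplus> a"])
    fix x assume x: "x \<in> carrier R"
    have "(x \<otimes> d \<oplus> a) \<ominus> a = x \<otimes> d"
      using x assms by (simp add: a_minus_def a_assoc r_neg)
    then show "((x \<otimes> d \<oplus> a) \<ominus> a) \<otimes> inv d = x"
      using x assms i by (simp add: m_assoc)
    have "(x \<ominus> a) \<otimes> inv d \<otimes> d = x \<ominus> a" using x assms i by (simp add: m_assoc)
    then show "(x \<ominus> a) \<otimes> inv d \<otimes> d \<oplus> a = x"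
      using x assms by (simp add: a_minus_def a_assoc l_neg)
  qed (use assms i in auto)
qed

text \<open>One coordinate of an affine codeword: \<open>g\<close> is a row of the generator matrix
  and \<open>c\<close> the entry of the shift. Keeping one row per time step makes the random
  ensemble a product over time, so that its averages factorise.\<close>

definition aff :: "('a, 'm) ring_scheme \<Rightarrow> nat \<Rightarrow> (nat \<Rightarrow> 'a) \<Rightarrow> 'a \<Rightarrow> (nat \<Rightarrow> 'a) \<Rightarrow> 'a" where
  "aff R k g c s = finsum R (\<lambda>j. g j \<otimes>\<^bsub>R\<^esub> s j) {..<k} \<oplus>\<^bsub>R\<^esub> c"

abbreviation vecs :: "('a, 'm) ring_scheme \<Rightarrow> nat \<Rightarrow> (nat \<Rightarrow> 'a) set" where
  "vecs R k \<equiv> PiE {..<k} (\<lambda>_. carrier R)"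

lemma (in field) aff_closed:
  assumes "g \<in> vecs R k" "c \<in> carrier R" "s \<in> vecs R k"
  shows "aff R k g c s \<in> carrier R"
proof -
  have "finsum R (\<lambda>j. g j \<otimes> s j) {..<k} \<in> carrier R"
    using assms by (intro finsum_closed) auto
  then show ?thesis using assms unfolding aff_def by auto
qed

text \<open>The shift makes the first value uniform. The difference of the two values contains
  \<open>g j\<close> times the nonzero number \<open>d\<close> for a coordinate \<open>j\<close> in
  which the vectors differ, so it is uniform for every fixed first value. The denominators are
  cleared to keep the statement a count.\<close>

lemma (in field) aff_pairwise_independent:
  fixes \<phi> :: "'a \<Rightarrow> 'a \<Rightarrow> real"
  assumes fin: "finite (carrier R)" and s: "s \<in> vecs R k" "s' \<in> vecs R k" "s \<noteq> s'"
  shows "(real (card (carrier R)))\<^sup>2 *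
      (\<Sum>p\<in>vecs R k \<times> carrier R. \<phi> (aff R k (fst p) (snd p) s) (aff R k (fst p) (snd p) s')) =
    real (card (vecs R k \<times> carrier R)) * (\<Sum>a\<in>carrier R. \<Sum>b\<in>carrier R. \<phi> a b)"
proof -
  let ?q = "card (carrier R)"
  obtain j where j: "j < k" "s j \<noteq> s' j" using PiE_ext[OF s(1,2)] s(3) by auto
  let ?J = "{..<k} - {j}"
  have J: "{..<k} = insert j ?J" "j \<notin> ?J" using j by auto
  define L where "L g s = finsum R (\<lambda>i. g i \<otimes> s i) {..<k}" for g s
  define L' where "L' g s = finsum R (\<lambda>i. g i \<otimes> s i) ?J" for g s
  have Lc: "L g s \<in> carrier R" if "g \<in> vecs R k" "s \<in> vecs R k" for g s
    unfolding L_def using that by (intro finsum_closed) auto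
  have L'c: "L' g s \<in> carrier R" if "g \<in> PiE ?J (\<lambda>_. carrier R)" "s \<in> vecs R k" for g s
    unfolding L'_def using that by (intro finsum_closed) auto
  have Lj: "L (h(j := x)) s = x \<otimes> s j \<oplus> L' h s"
    if "h \<in> PiE ?J (\<lambda>_. carrier R)" "x \<in> carrier R" "s \<in> vecs R k" for h x s
  proof -
    have "L (h(j := x)) s = finsum R (\<lambda>i. (h(j := x)) i \<otimes> s i) (insert j ?J)"
      unfolding L_def using J(1) by simp
    also have "\<dots> = (h(j := x)) j \<otimes> s j \<oplus> finsum R (\<lambda>i. (h(j := x)) i \<otimes> s i) ?J"
      using that j by (subst finsum_insert) (auto simp: PiE_iff)
    also have "finsum R (\<lambda>i. (h(j := x)) i \<otimes> s i) ?J = L' h s"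
      unfolding L'_def using that by (intro finsum_cong') auto
    finally show ?thesis by (simp only: fun_upd_same)
  qed
  define d where "d = s' j \<ominus> s j"
  have sj: "s j \<in> carrier R" "s' j \<in> carrier R" using s j by auto
  have d: "d \<in> carrier R" "d \<noteq> \<zero>"
    using sj j minus_equality[of "s' j" "\<ominus> s j"] by (auto simp: d_def a_minus_def)
  \<comment> \<open>Substituting the first value for the shift leaves only the difference of the
    linear parts in the second argument.\<close>
  have 1: "(\<Sum>c\<in>carrier R. \<phi> (L g s \<oplus> c) (L g s' \<oplus> c)) =
      (\<Sum>a\<in>carrier R. \<phi> a ((L g s' \<ominus> L g s) \<oplus> a))" if g: "g \<in> vecs R k" for g
  proof -
    have "(L g s' \<ominus> L g s) \<oplus> (L g s \<oplus> c) = L g s' \<oplus> c" if "c \<in> carrier R" for c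
    proof -
      have "(L g s' \<ominus> L g s) \<oplus> (L g s \<oplus> c) = L g s' \<oplus> (\<ominus> L g s \<oplus> L g s) \<oplus> c"
        using Lc[OF g s(1)] Lc[OF g s(2)] that by (simp add: a_minus_def a_assoc)
      then show ?thesis using Lc[OF g s(1)] Lc[OF g s(2)] that by (simp add: l_neg)
    qed
    then show ?thesis
      using sum_translate[OF Lc[OF g s(1)], of "\<lambda>a. \<phi> a ((L g s' \<ominus> L g s) \<oplus> a)"]
      by simp
  qed
  have 2: "(\<Sum>x\<in>carrier R. \<phi> a ((L (h(j := x)) s' \<ominus> L (h(j := x)) s) \<oplus> a)) =
      (\<Sum>b\<in>carrier R. \<phi> a b)"
    if h: "h \<in> PiE ?J (\<lambda>_. carrier R)" and a: "a \<in> carrier R" for h a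
  proof -
    let ?e = "(L' h s' \<ominus> L' h s) \<oplus> a"
    have e: "?e \<in> carrier R" using L'c[OF h s(1)] L'c[OF h s(2)] a by simp
    have "(L (h(j := x)) s' \<ominus> L (h(j := x)) s) \<oplus> a = x \<otimes> d \<oplus> ?e" if x: "x \<in> carrier R" for x
      unfolding Lj[OF h x s(1)] Lj[OF h x s(2)] d_def
      using x L'c[OF h s(1)] L'c[OF h s(2)] a sj by algebra
    then show ?thesis using sum_affine[OF e d, of "\<phi> a"] by simp
  qed
  have "(\<Sum>p\<in>vecs R k \<times> carrier R. \<phi> (aff R k (fst p) (snd p) s) (aff R k (fst p) (snd p) s')) =
      (\<Sum>g\<in>vecs R k. \<Sum>c\<in>carrier R. \<phi> (L g s \<oplus> c) (L g s' \<oplus> c))"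
    by (simp add: sum.cartesian_product case_prod_unfold aff_def L_def)
  also have "\<dots> = (\<Sum>g\<in>vecs R k. \<Sum>a\<in>carrier R. \<phi> a ((L g s' \<ominus> L g s) \<oplus> a))"
    using 1 by simp
  also have "\<dots> = (\<Sum>a\<in>carrier R. \<Sum>g\<in>PiE (insert j ?J) (\<lambda>_. carrier R). \<phi> a ((L g s' \<ominus> L g s) \<oplus> a))"
    using J(1) by (simp add: sum.swap[of _ "vecs R k"])
  also have "\<dots> = (\<Sum>a\<in>carrier R. \<Sum>h\<in>PiE ?J (\<lambda>_. carrier R). \<Sum>x\<in>carrier R.
      \<phi> a ((L (h(j := x)) s' \<ominus> L (h(j := x)) s) \<oplus> a))"
    unfolding sum_PiE_insert[OF J(2)] by (intro sum.cong refl sum.swap)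
  also have "\<dots> = real (?q ^ (k - 1)) * (\<Sum>a\<in>carrier R. \<Sum>b\<in>carrier R. \<phi> a b)"
    using 2 j by (simp add: card_PiE sum_distrib_left)
  finally show ?thesis
    using j by (simp add: card_PiE card_cartesian_product power2_eq_square power_eq_if[of _ k])
qed

lemma (in field) finsum_mult_swap:
  assumes U: "finite U" and g: "\<And>j. j < (k::nat) \<Longrightarrow> g j \<in> carrier R"
    and x: "\<And>u j. u \<in> U \<Longrightarrow> j < k \<Longrightarrow> x u j \<in> carrier R"
  shows "finsum R (\<lambda>u. finsum R (\<lambda>j. g j \<otimes> x u j) {..<k}) U =
    finsum R (\<lambda>j. g j \<otimes> finsum R (\<lambda>u. x u j) U) {..<k}"
  using U x
proof (induction U rule: finite_induct)
  case empty
  have "finsum R (\<lambda>j. g j \<otimes> \<zero>) {..<k} = finsum R (\<lambda>j. \<zero>) {..<k}"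
    using g by (intro finsum_cong') auto
  then show ?case by simp
next
  case (insert u U)
  let ?s = "\<lambda>j. finsum R (\<lambda>u. x u j) U"
  have s: "?s j \<in> carrier R" if "j < k" for j
    using insert.prems that by (intro finsum_closed) auto
  have "finsum R (\<lambda>u. finsum R (\<lambda>j. g j \<otimes> x u j) {..<k}) (insert u U) =
      finsum R (\<lambda>j. g j \<otimes> x u j) {..<k} \<oplus> finsum R (\<lambda>u. finsum R (\<lambda>j. g j \<otimes> x u j) {..<k}) U"
    using insert g by (subst finsum_insert) (auto intro!: finsum_closed)
  also have "finsum R (\<lambda>u. finsum R (\<lambda>j. g j \<otimes> x u j) {..<k}) U = finsum R (\<lambda>j. g j \<otimes> ?s j) {..<k}"
    using insert by simp
  also have "finsum R (\<lambda>j. g j \<otimes> x u j) {..<k} \<oplus> finsum R (\<lambda>j. g j \<otimes> ?s j) {..<k} =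
      finsum R (\<lambda>j. g j \<otimes> x u j \<oplus> g j \<otimes> ?s j) {..<k}"
    using insert.prems g s by (intro finsum_addf[symmetric]) auto
  also have "\<dots> = finsum R (\<lambda>j. g j \<otimes> finsum R (\<lambda>u. x u j) (insert u U)) {..<k}"
  proof (rule finsum_cong')
    fix j assume j: "j \<in> {..<k}"
    have "finsum R (\<lambda>u. x u j) (insert u U) = x u j \<oplus> ?s j"
      using insert j by (subst finsum_insert) auto
    then show "g j \<otimes> x u j \<oplus> g j \<otimes> ?s j = g j \<otimes> finsum R (\<lambda>u. x u j) (insert u U)"
      using j g insert.prems s by (simp add: r_distr)
  next
    have "finsum R (\<lambda>u. x u j) (insert u U) \<in> carrier R" if "j < k" for j
      using insert.prems that by (intro finsum_closed) auto
    then show "(\<lambda>j. g j \<otimes> finsum R (\<lambda>u. x u j) (insert u U)) \<in> {..<k} \<rightarrow> carrier R"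
      using g by auto
  qed simp
  finally show ?case .
qed

text \<open>The linear parts add up by distributivity. Only the summand of \<open>u0\<close> carries
  the shift, so the total is again a codeword of the same code, not of one shifted by a multiple of
  \<open>c\<close>.\<close>

lemma (in field) finsum_aff:
  assumes U: "finite U" "u0 \<in> U" and g: "g \<in> vecs R k" and c: "c \<in> carrier R"
    and x: "\<And>u. u \<in> U \<Longrightarrow> x u \<in> vecs R k"
  shows "finsum R (\<lambda>u. aff R k g (if u0 = u then c else \<zero>) (x u)) U =
    aff R k g c (\<lambda>j\<in>{..<k}. finsum R (\<lambda>u. x u j) U)"
proof -
  have gc: "g j \<in> carrier R" if "j < k" for j using g that by auto
  have xc: "x u j \<in> carrier R" if "u \<in> U" "j < k" for u j using x[OF that(1)] that(2) by auto
  have "finsum R (\<lambda>u. aff R k g (if u0 = u then c else \<zero>) (x u)) U =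
      finsum R (\<lambda>u. finsum R (\<lambda>j. g j \<otimes> x u j) {..<k}) U \<oplus> finsum R (\<lambda>u. if u0 = u then c else \<zero>) U"
    unfolding aff_def using gc xc c by (intro finsum_addf) (auto intro!: finsum_closed)
  also have "finsum R (\<lambda>u. if u0 = u then c else \<zero>) U = c"
    using add.finprod_singleton[OF U(2,1), of "\<lambda>_. c"] c by simp
  also have "finsum R (\<lambda>u. finsum R (\<lambda>j. g j \<otimes> x u j) {..<k}) U =
      finsum R (\<lambda>j. g j \<otimes> finsum R (\<lambda>u. x u j) U) {..<k}"
    by (rule finsum_mult_swap[OF U(1) gc xc])
  also have "\<dots> = finsum R (\<lambda>j. g j \<otimes> (\<lambda>j\<in>{..<k}. finsum R (\<lambda>u. x u j) U) j) {..<k}"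
  proof (rule finsum_cong')
    show "(\<lambda>j. g j \<otimes> (\<lambda>j\<in>{..<k}. finsum R (\<lambda>u. x u j) U) j) \<in> {..<k} \<rightarrow> carrier R"
      using gc xc by (auto intro!: finsum_closed)
  qed auto
  finally show ?thesis unfolding aff_def .
qed

section \<open>Random affine codes with threshold decoding on a symmetric channel\<close>

context
  fixes K :: "'a ring" and Y :: "'b set" and W :: "'a \<Rightarrow> 'b \<Rightarrow> real"
  assumes field: "field K" and fin: "finite (carrier K)"
    and sym: "symmetric_dmc (carrier K) Y W"
begin

interpretation field K by (rule field)

private abbreviation "Q \<equiv> out_distr (carrier K) W"
private abbreviation "hash k p s \<equiv> aff K k (fst p) (snd p) s"
private abbreviation "seeds k \<equiv> vecs K k \<times> carrier K"
private abbreviation "ens L k \<equiv> PiE {1..L::nat} (\<lambda>_. seeds k)"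

private lemma dmcK: "dmc (carrier K) Y W" using sym unfolding symmetric_dmc_def by blast

private lemma chan: "finite Y" "x \<in> carrier K \<Longrightarrow> y \<in> Y \<Longrightarrow> 0 \<le> W x y"
    "x \<in> carrier K \<Longrightarrow> (\<Sum>y\<in>Y. W x y) = 1"
  using dmcK unfolding dmc_def by blast+

private lemma seeds: "finite (seeds k)" "seeds k \<noteq> {}"
proof -
  show "finite (seeds k)" using fin by (auto intro: finite_PiE)
  have "(\<lambda>i\<in>{..<k}. \<zero>\<^bsub>K\<^esub>, \<zero>\<^bsub>K\<^esub>) \<in> seeds k" by auto
  then show "seeds k \<noteq> {}" by blast
qed

private lemma hash_closed: "p \<in> seeds k \<Longrightarrow> s \<in> vecs K k \<Longrightarrow> hash k p s \<in> carrier K"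
  using aff_closed by auto

text \<open>Positivity of the transitions is demanded separately because the logarithm at 0 is only
  a default value, so the sum alone would not exclude impossible outputs.\<close>

private definition pass :: "nat \<Rightarrow> real \<Rightarrow> (nat \<Rightarrow> 'a) \<Rightarrow> (nat \<Rightarrow> 'b) \<Rightarrow> bool" where
  "pass L \<tau> x y \<longleftrightarrow> (\<forall>t\<in>{1..L}. W (x t) (y t) > 0) \<and>
     real L * \<tau> < (\<Sum>t\<in>{1..L}. ln (W (x t) (y t) / Q (y t)))"

private definition threshold_dec ::
    "nat \<Rightarrow> real \<Rightarrow> nat \<Rightarrow> (nat \<Rightarrow> (nat \<Rightarrow> 'a) \<times> 'a) \<Rightarrow> (nat \<Rightarrow> 'b) \<Rightarrow> (nat \<Rightarrow> 'a)" where
  "threshold_dec L \<tau> k \<theta> y = (THE s. s \<in> vecs K k \<and> pass L \<tau> (\<lambda>t. hash k (\<theta> t) s) y)"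

private definition err :: "nat \<Rightarrow> real \<Rightarrow> nat \<Rightarrow> (nat \<Rightarrow> (nat \<Rightarrow> 'a) \<times> 'a) \<Rightarrow> (nat \<Rightarrow> 'a) \<Rightarrow> real" where
  "err L \<tau> k \<theta> s = (\<Sum>y\<in>PiE {1..L} (\<lambda>_. Y).
     if threshold_dec L \<tau> k \<theta> y = s then 0 else \<Prod>t\<in>{1..L}. W (hash k (\<theta> t) s) (y t))"

text \<open>If the true codeword alone passes the test, decoding is correct. That it fails is
  bounded by an exponential moment, which gives \<open>\<rho> ^ L\<close>. If a competitor
  \<open>s'\<close> passes, its likelihood ratio against \<open>Q\<close> is at least
  \<open>exp (L * \<tau>)\<close>, so the indicator of this event is at most that ratio times
  \<open>exp (- (L * \<tau>))\<close>. When several vectors pass, \<open>THE\<close> returns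
  something unspecified, and the output is charged as an error.\<close>

private lemma err_bound:
  assumes \<theta>: "\<theta> \<in> ens L k" and s: "s \<in> vecs K k" and l: "l > 0"
    and \<rho>: "\<And>x. x \<in> carrier K \<Longrightarrow> (\<Sum>y\<in>Y. W x y * exp (l * (\<tau> - ln (W x y / Q y)))) \<le> \<rho>"
  shows "err L \<tau> k \<theta> s \<le> \<rho> ^ L + (\<Sum>s'\<in>vecs K k - {s}. exp (- (real L * \<tau>)) *
     (\<Sum>y\<in>PiE {1..L} (\<lambda>_. Y). \<Prod>t\<in>{1..L}. W (hash k (\<theta> t) s) (y t) * W (hash k (\<theta> t) s') (y t) / Q (y t)))"
proof -
  let ?A = "{1..L}" and ?Ys = "PiE {1..L} (\<lambda>_. Y)"
  let ?x = "\<lambda>s t. hash k (\<theta> t) s"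
  let ?P = "\<lambda>y. \<Prod>t\<in>?A. W (?x s t) (y t)"
  let ?F = "\<lambda>y. \<Prod>t\<in>?A. W (?x s t) (y t) * exp (l * (\<tau> - ln (W (?x s t) (y t) / Q (y t))))"
  let ?R = "\<lambda>s' y. \<Prod>t\<in>?A. W (?x s t) (y t) * W (?x s' t) (y t) / Q (y t)"
  have finG: "finite (vecs K k)" using fin by (auto intro: finite_PiE)
  have xc: "?x s t \<in> carrier K" if "s \<in> vecs K k" "t \<in> ?A" for s t
    using hash_closed[OF PiE_mem[OF \<theta> that(2)] that(1)] .
  have yc: "y t \<in> Y" if "y \<in> ?Ys" "t \<in> ?A" for y t using that by auto
  have Wn: "W (?x s t) (y t) \<ge> 0" if "s \<in> vecs K k" "y \<in> ?Ys" "t \<in> ?A" for s y t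
    using chan(2)[OF xc[OF that(1,3)] yc[OF that(2,3)]] .
  have Qn: "Q (y t) \<ge> 0" if "y \<in> ?Ys" "t \<in> ?A" for y t
    using out_distr_nonneg[OF dmcK yc[OF that]] .
  have Fn: "?F y \<ge> 0" if "y \<in> ?Ys" for y
    using Wn[OF s that] by (intro prod_nonneg) auto
  have Rn: "?R s' y \<ge> 0" if "s' \<in> vecs K k" "y \<in> ?Ys" for s' y
    using Wn[OF s that(2)] Wn[OF that] Qn[OF that(2)] by (intro prod_nonneg) auto
  have pt: "(if threshold_dec L \<tau> k \<theta> y = s then 0 else ?P y) \<le>
      ?F y + (\<Sum>s'\<in>vecs K k - {s}. exp (- (real L * \<tau>)) * ?R s' y)" if y: "y \<in> ?Ys" for y
  proof -
    have Rsn: "(\<Sum>s'\<in>vecs K k - {s}. exp (- (real L * \<tau>)) * ?R s' y) \<ge> 0"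
      using Rn[OF _ y] by (intro sum_nonneg) auto
    have "(\<Sum>s'\<in>vecs K k - {s}. exp (- (real L * \<tau>)) * ?R s' y) \<ge> ?P y"
      if s': "s' \<in> vecs K k" "s' \<noteq> s" and p: "pass L \<tau> (?x s') y" for s'
    proof -
      have pos: "W (?x s' t) (y t) / Q (y t) > 0" if "t \<in> ?A" for t
        using p out_distr_pos[OF dmcK xc[OF s'(1) that] yc[OF y that]] that
        unfolding pass_def by auto
      have "exp (\<Sum>t\<in>?A. ln (W (?x s' t) (y t) / Q (y t))) = (\<Prod>t\<in>?A. W (?x s' t) (y t) / Q (y t))"
        unfolding exp_sum[OF finite_atLeastAtMost] by (rule prod.cong) (auto simp: pos)
      moreover have "exp (real L * \<tau>) \<le> exp (\<Sum>t\<in>?A. ln (W (?x s' t) (y t) / Q (y t)))"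
        using p unfolding pass_def by simp
      ultimately have "1 \<le> exp (- (real L * \<tau>)) * (\<Prod>t\<in>?A. W (?x s' t) (y t) / Q (y t))"
        by (simp add: exp_minus field_simps)
      then have "?P y * 1 \<le> ?P y * (exp (- (real L * \<tau>)) * (\<Prod>t\<in>?A. W (?x s' t) (y t) / Q (y t)))"
        using Wn[OF s y] by (intro mult_left_mono prod_nonneg) auto
      also have "\<dots> = exp (- (real L * \<tau>)) * ?R s' y"
        by (simp add: prod.distrib[symmetric] mult.left_commute)
      also have "\<dots> \<le> (\<Sum>s'\<in>vecs K k - {s}. exp (- (real L * \<tau>)) * ?R s' y)"
        using s' finG Rn[OF _ y] by (intro member_le_sum) auto
      finally show ?thesis by simp
    qed
    moreover have "?P y \<le> ?F y" if np: "\<not> pass L \<tau> (?x s) y"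
    proof (cases "\<forall>t\<in>?A. W (?x s t) (y t) > 0")
      case True
      then have "(\<Sum>t\<in>?A. ln (W (?x s t) (y t) / Q (y t))) \<le> real L * \<tau>"
        using np unfolding pass_def by auto
      then have "0 \<le> l * (\<Sum>t\<in>?A. \<tau> - ln (W (?x s t) (y t) / Q (y t)))"
        using l by (simp add: sum_subtractf)
      then have "1 \<le> exp (\<Sum>t\<in>?A. l * (\<tau> - ln (W (?x s t) (y t) / Q (y t))))"
        by (simp add: sum_distrib_left)
      then have "?P y * 1 \<le> ?P y * exp (\<Sum>t\<in>?A. l * (\<tau> - ln (W (?x s t) (y t) / Q (y t))))"
        using Wn[OF s y] by (intro mult_left_mono prod_nonneg) auto
      then show ?thesis by (simp add: exp_sum prod.distrib)
    next
      case False
      then obtain t where "t \<in> ?A" "W (?x s t) (y t) = 0" using Wn[OF s y] by force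
      then have "?P y = 0" by auto
      then show ?thesis using Fn[OF y] by (simp only:)
    qed
    moreover have "threshold_dec L \<tau> k \<theta> y = s"
      if "pass L \<tau> (?x s) y" "\<And>s'. s' \<in> vecs K k \<Longrightarrow> s' \<noteq> s \<Longrightarrow> \<not> pass L \<tau> (?x s') y"
      unfolding threshold_dec_def using that s by (intro the_equality) auto
    ultimately show ?thesis using Fn[OF y] Rsn by (smt (verit))
  qed
  have "(\<Sum>y\<in>?Ys. ?F y) = (\<Prod>t\<in>?A. \<Sum>y\<in>Y. W (?x s t) y * exp (l * (\<tau> - ln (W (?x s t) y / Q y))))"
    using prod_sum_PiE[of ?A "\<lambda>_. Y" "\<lambda>t y. W (?x s t) y * exp (l * (\<tau> - ln (W (?x s t) y / Q y)))"]
      chan(1) by simp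
  also have "\<dots> \<le> (\<Prod>t\<in>?A. \<rho>)"
    using \<rho>[OF xc[OF s]] chan(2)[OF xc[OF s]] by (intro prod_mono) (auto intro!: sum_nonneg)
  finally have Fsum: "(\<Sum>y\<in>?Ys. ?F y) \<le> \<rho> ^ L" by simp
  have "err L \<tau> k \<theta> s \<le> (\<Sum>y\<in>?Ys. ?F y + (\<Sum>s'\<in>vecs K k - {s}. exp (- (real L * \<tau>)) * ?R s' y))"
    unfolding err_def by (intro sum_mono pt)
  also have "\<dots> = (\<Sum>y\<in>?Ys. ?F y) + (\<Sum>s'\<in>vecs K k - {s}. exp (- (real L * \<tau>)) * (\<Sum>y\<in>?Ys. ?R s' y))"
    unfolding sum.distrib sum_distrib_left by (intro arg_cong2[where f = "(+)"] refl sum.swap)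
  finally show ?thesis using Fsum by linarith
qed

text \<open>At each time the two codeword symbols are independent and uniform, so the average of
  \<open>W a y * W b y / Q y\<close> is \<open>Q y\<close>, whose sum over \<open>y\<close> is 1.
  The identity also survives \<open>Q y = 0\<close>, where both sides vanish. Each competitor
  therefore costs exactly \<open>exp (- (L * \<tau>))\<close> on average.\<close>

private lemma ensemble_second_moment:
  assumes s: "s \<in> vecs K k" "s' \<in> vecs K k" "s \<noteq> s'"
  shows "(\<Sum>\<theta>\<in>ens L k. \<Sum>y\<in>PiE {1..L} (\<lambda>_. Y). \<Prod>t\<in>{1..L}.
      W (hash k (\<theta> t) s) (y t) * W (hash k (\<theta> t) s') (y t) / Q (y t)) = real (card (ens L k))"
proof -
  let ?q = "real (card (carrier K))"
  have q: "?q > 0" using fin by (auto simp: card_gt_0_iff)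
  define f where "f p y = W (hash k p s) y * W (hash k p s') y / Q y" for p y
  have "(\<Sum>p\<in>seeds k. f p y) = real (card (seeds k)) * Q y" for y
  proof -
    have "?q\<^sup>2 * (\<Sum>p\<in>seeds k. f p y) =
        real (card (seeds k)) * (\<Sum>a\<in>carrier K. \<Sum>b\<in>carrier K. W a y * W b y / Q y)"
      unfolding f_def by (rule aff_pairwise_independent[OF fin s])
    also have "(\<Sum>a\<in>carrier K. \<Sum>b\<in>carrier K. W a y * W b y / Q y) =
        (\<Sum>a\<in>carrier K. W a y) * (\<Sum>b\<in>carrier K. W b y) / Q y"
      by (simp add: sum_product sum_divide_distrib)
    also have "(\<Sum>a\<in>carrier K. W a y) = ?q * Q y" using q by (simp add: out_distr_def)
    also have "?q * Q y * (?q * Q y) / Q y = ?q\<^sup>2 * Q y" by (simp add: power2_eq_square)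
    finally show ?thesis using q by simp
  qed
  then have 1: "(\<Sum>y\<in>Y. \<Sum>p\<in>seeds k. f p y) = real (card (seeds k))"
    using sum_out_distr[OF dmcK] by (simp add: sum_distrib_left[symmetric])
  have "(\<Sum>\<theta>\<in>ens L k. \<Sum>y\<in>PiE {1..L} (\<lambda>_. Y). \<Prod>t\<in>{1..L}. f (\<theta> t) (y t)) =
      (\<Sum>y\<in>PiE {1..L} (\<lambda>_. Y). \<Sum>\<theta>\<in>ens L k. \<Prod>t\<in>{1..L}. f (\<theta> t) (y t))"
    by (rule sum.swap)
  also have "\<dots> = (\<Sum>y\<in>PiE {1..L} (\<lambda>_. Y). \<Prod>t\<in>{1..L}. \<Sum>p\<in>seeds k. f p (y t))"
    using seeds(1) by (intro sum.cong refl) (subst prod_sum_PiE, auto)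
  also have "\<dots> = (\<Prod>t\<in>{1..L}. \<Sum>y\<in>Y. \<Sum>p\<in>seeds k. f p y)"
    using chan(1) by (subst prod_sum_PiE) auto
  also have "\<dots> = real (card (seeds k)) ^ L" unfolding 1 by simp
  also have "\<dots> = real (card (ens L k))" by (simp add: card_PiE)
  finally show ?thesis unfolding f_def .
qed

private lemma ensemble_average:
  assumes l: "l > 0"
    and \<rho>: "\<And>x. x \<in> carrier K \<Longrightarrow> (\<Sum>y\<in>Y. W x y * exp (l * (\<tau> - ln (W x y / Q y)))) \<le> \<rho>"
    and s: "s \<in> vecs K k"
  shows "(\<Sum>\<theta>\<in>ens L k. err L \<tau> k \<theta> s) \<le> real (card (ens L k)) *
     (\<rho> ^ L + (real (card (carrier K)) ^ k - 1) * exp (- (real L * \<tau>)))"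
proof -
  have finG: "finite (vecs K k)" using fin by (auto intro: finite_PiE)
  have cG: "real (card (vecs K k - {s})) = real (card (carrier K)) ^ k - 1"
  proof -
    have "card (vecs K k) = Suc (card (vecs K k - {s}))" by (rule card.remove[OF finG s])
    moreover have "card (vecs K k) = card (carrier K) ^ k" by (simp add: card_PiE)
    ultimately have "real (card (carrier K)) ^ k = 1 + real (card (vecs K k - {s}))"
      by (metis of_nat_Suc of_nat_power)
    then show ?thesis by linarith
  qed
  have "(\<Sum>\<theta>\<in>ens L k. err L \<tau> k \<theta> s) \<le> (\<Sum>\<theta>\<in>ens L k. \<rho> ^ L +
     (\<Sum>s'\<in>vecs K k - {s}. exp (- (real L * \<tau>)) * (\<Sum>y\<in>PiE {1..L} (\<lambda>_. Y). \<Prod>t\<in>{1..L}.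
       W (hash k (\<theta> t) s) (y t) * W (hash k (\<theta> t) s') (y t) / Q (y t))))"
    by (intro sum_mono err_bound[OF _ s l \<rho>])
  also have "\<dots> = real (card (ens L k)) * \<rho> ^ L +
     (\<Sum>s'\<in>vecs K k - {s}. exp (- (real L * \<tau>)) * (\<Sum>\<theta>\<in>ens L k. \<Sum>y\<in>PiE {1..L} (\<lambda>_. Y). \<Prod>t\<in>{1..L}.
       W (hash k (\<theta> t) s) (y t) * W (hash k (\<theta> t) s') (y t) / Q (y t)))"
    unfolding sum.distrib sum_distrib_left by (rule arg_cong2[where f = "(+)"], simp, rule sum.swap)
  also have "\<dots> = real (card (ens L k)) * \<rho> ^ L +
     (\<Sum>s'\<in>vecs K k - {s}. exp (- (real L * \<tau>)) * real (card (ens L k)))"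
    using ensemble_second_moment[OF s] by (intro arg_cong2[where f = "(+)"] sum.cong refl) auto
  finally show ?thesis by (simp add: cG algebra_simps)
qed

text \<open>The dimension \<open>k\<close> is chosen before the list of messages and the code after
  it: the messages will be block sums of relay functions, whose alphabet already depends on
  \<open>k\<close>. Since the ensemble is good on average for each single vector, some code is good
  on average over any given list, repetitions included.\<close>

lemma good_affine_code:
  assumes \<delta>: "\<delta> > 0" and \<epsilon>: "\<epsilon> > 0"
  shows "\<exists>L0. \<forall>L\<ge>L0. \<exists>k. 2 powr (real L * (dmc_capacity (carrier K) Y W - \<delta>)) \<le> real (card (carrier K)) ^ k \<and>
    (\<forall>(I :: 'i set) msg. finite I \<longrightarrow> msg \<in> I \<rightarrow> vecs K k \<longrightarrow>
      (\<exists>g c dec. (\<forall>t\<in>{1..L}. g t \<in> vecs K k \<and> c t \<in> carrier K) \<and>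
        (\<Sum>i\<in>I. \<Sum>y\<in>PiE {1..L} (\<lambda>_. Y). if dec y = msg i then 0 else
            \<Prod>t\<in>{1..L}. W (aff K k (g t) (c t) (msg i)) (y t)) \<le> \<epsilon> * real (card I)))"
proof -
  let ?C = "dmc_capacity (carrier K) Y W" and ?q = "real (card (carrier K))"
  have q: "?q > 1"
    using fin card_mono[OF fin, of "{\<zero>\<^bsub>K\<^esub>, \<one>\<^bsub>K\<^esub>}"] by (auto simp: eval_nat_numeral)
  \<comment> \<open>The threshold lies halfway between the rate and the capacity: the margin to the
    capacity controls failure of the true codeword, the margin to the rate controls the
    competitors.\<close>
  define \<tau> where "\<tau> = ln 2 * (?C - \<delta> / 2)"
  have z: "\<zero>\<^bsub>K\<^esub> \<in> carrier K" by simp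
  have "\<forall>\<^sub>F l in at_right 0. (\<Sum>y\<in>Y. W \<zero>\<^bsub>K\<^esub> y * exp (l * (\<tau> - ln (W \<zero>\<^bsub>K\<^esub> y / Q y)))) < 1"
  proof (rule exp_moment_less_one[OF chan(1) chan(3)[OF z]])
    have "(\<Sum>y\<in>Y. W \<zero>\<^bsub>K\<^esub> y * (\<tau> - ln (W \<zero>\<^bsub>K\<^esub> y / Q y))) =
       (\<Sum>y\<in>Y. W \<zero>\<^bsub>K\<^esub> y) * \<tau> - (\<Sum>y\<in>Y. W \<zero>\<^bsub>K\<^esub> y * ln (W \<zero>\<^bsub>K\<^esub> y / Q y))"
      by (simp add: right_diff_distrib sum_subtractf sum_distrib_right)
    also have "\<dots> = - (ln 2 * \<delta> / 2)"
      by (simp add: chan(3)[OF z] symmetric_capacity_ln[OF sym z] \<tau>_def algebra_simps)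
    finally show "(\<Sum>y\<in>Y. W \<zero>\<^bsub>K\<^esub> y * (\<tau> - ln (W \<zero>\<^bsub>K\<^esub> y / Q y))) < 0" using \<delta> by simp
  qed
  then have "\<exists>l>0. (\<Sum>y\<in>Y. W \<zero>\<^bsub>K\<^esub> y * exp (l * (\<tau> - ln (W \<zero>\<^bsub>K\<^esub> y / Q y)))) < 1"
    unfolding eventually_at_right_field by (elim exE conjE) (meson dense)
  then obtain l where l: "l > 0"
    and l1: "(\<Sum>y\<in>Y. W \<zero>\<^bsub>K\<^esub> y * exp (l * (\<tau> - ln (W \<zero>\<^bsub>K\<^esub> y / Q y)))) < 1" (is "?\<rho> < 1")
    by auto
  define \<rho> where "\<rho> = ?\<rho>"
  have \<rho>1: "\<rho> < 1" using l1 \<rho>_def by simp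
  have \<rho>0: "\<rho> \<ge> 0" unfolding \<rho>_def using chan(2)[OF z] by (intro sum_nonneg) auto
  have row: "(\<Sum>y\<in>Y. W x y * exp (l * (\<tau> - ln (W x y / Q y)))) \<le> \<rho>" if "x \<in> carrier K" for x
    unfolding \<rho>_def
    using symmetric_row_sum[OF sym that z, of "\<lambda>w q. w * exp (l * (\<tau> - ln (w / q)))"] by simp
  have "(\<lambda>L. \<rho> ^ L + ?q * (exp (- (ln 2 * \<delta> / 2))) ^ L) \<longlonglongrightarrow> 0 + ?q * 0"
    using \<rho>0 \<rho>1 \<delta> by (intro tendsto_add tendsto_mult tendsto_const LIMSEQ_power_zero) auto
  then have "\<forall>\<^sub>F L in sequentially. \<rho> ^ L + ?q * (exp (- (ln 2 * \<delta> / 2))) ^ L < \<epsilon>"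
    using \<epsilon> by (intro order_tendstoD(2)) auto
  then obtain L0 where L0: "\<And>L. L \<ge> L0 \<Longrightarrow> \<rho> ^ L + ?q * (exp (- (ln 2 * \<delta> / 2))) ^ L < \<epsilon>"
    by (auto simp: eventually_sequentially)
  show ?thesis
  proof (rule exI[of _ L0], intro allI impI)
    fix L assume L: "L \<ge> L0"
    let ?r = "2 powr (real L * (?C - \<delta>))"
    \<comment> \<open>By minimality \<open>?q ^ k\<close> overshoots the target by at most the
      factor \<open>?q\<close>, a constant in \<open>L\<close>. For \<open>k = 0\<close> there is a
      single vector and hence no competitor.\<close>
    define k where "k = (LEAST k. ?r \<le> ?q ^ k)"
    have "\<exists>k. ?r \<le> ?q ^ k" using real_arch_pow[OF q, of ?r] by (auto intro: less_imp_le)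
    then have k: "?r \<le> ?q ^ k" unfolding k_def by (rule LeastI_ex)
    have "(?q ^ k - 1) \<le> ?q * ?r"
    proof (cases k)
      case (Suc k')
      then have "\<not> ?r \<le> ?q ^ k'" unfolding k_def by (metis lessI not_less_Least)
      then have "?q * ?q ^ k' \<le> ?q * ?r" using q by (intro mult_left_mono) auto
      then show ?thesis unfolding Suc by simp
    qed (use q in simp)
    then have "(?q ^ k - 1) * exp (- (real L * \<tau>)) \<le> ?q * ?r * exp (- (real L * \<tau>))"
      by (intro mult_right_mono) auto
    also have "\<dots> = ?q * (exp (- (ln 2 * \<delta> / 2))) ^ L"
      unfolding exp_of_nat_mult[symmetric]
      by (simp add: powr_def exp_add[symmetric] \<tau>_def algebra_simps)
    finally have small: "\<rho> ^ L + (?q ^ k - 1) * exp (- (real L * \<tau>)) \<le> \<epsilon>"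
      using L0[OF L] by simp
    have code: "\<exists>g c dec. (\<forall>t\<in>{1..L}. g t \<in> vecs K k \<and> c t \<in> carrier K) \<and>
        (\<Sum>i\<in>I. \<Sum>y\<in>PiE {1..L} (\<lambda>_. Y). if dec y = msg i then 0 else
            \<Prod>t\<in>{1..L}. W (aff K k (g t) (c t) (msg i)) (y t)) \<le> \<epsilon> * real (card I)"
      if I: "finite I" and msg: "msg \<in> I \<rightarrow> vecs K k" for I :: "'i set" and msg
    proof -
      have "(\<Sum>\<theta>\<in>ens L k. \<Sum>i\<in>I. err L \<tau> k \<theta> (msg i)) = (\<Sum>i\<in>I. \<Sum>\<theta>\<in>ens L k. err L \<tau> k \<theta> (msg i))"
        by (rule sum.swap)
      also have "\<dots> \<le> (\<Sum>i\<in>I. real (card (ens L k)) * \<epsilon>)"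
      proof (rule sum_mono)
        fix i assume "i \<in> I"
        then have "msg i \<in> vecs K k" using msg by auto
        from ensemble_average[OF l row this]
        have "(\<Sum>\<theta>\<in>ens L k. err L \<tau> k \<theta> (msg i)) \<le> real (card (ens L k)) *
          (\<rho> ^ L + (?q ^ k - 1) * exp (- (real L * \<tau>)))" .
        also have "\<dots> \<le> real (card (ens L k)) * \<epsilon>" using small by (intro mult_left_mono) auto
        finally show "(\<Sum>\<theta>\<in>ens L k. err L \<tau> k \<theta> (msg i)) \<le> real (card (ens L k)) * \<epsilon>" .
      qed
      also have "\<dots> = real (card (ens L k)) * (\<epsilon> * real (card I))" by simp
      finally have "\<exists>\<theta>\<in>ens L k. (\<Sum>i\<in>I. err L \<tau> k \<theta> (msg i)) \<le> \<epsilon> * real (card I)"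
        using seeds[of k] by (intro exists_le_average) (auto intro: finite_PiE simp: PiE_eq_empty_iff)
      then obtain \<theta> where \<theta>: "\<theta> \<in> ens L k" "(\<Sum>i\<in>I. err L \<tau> k \<theta> (msg i)) \<le> \<epsilon> * real (card I)" ..
      show ?thesis
        using \<theta> unfolding err_def
        by (intro exI[of _ "\<lambda>t. fst (\<theta> t)"] exI[of _ "\<lambda>t. snd (\<theta> t)"]
              exI[of _ "threshold_dec L \<tau> k \<theta>"]) (auto simp: PiE_iff mem_Times_iff)
    qed
    show "\<exists>k. ?r \<le> ?q ^ k \<and>
    (\<forall>(I :: 'i set) msg. finite I \<longrightarrow> msg \<in> I \<rightarrow> vecs K k \<longrightarrow>
      (\<exists>g c dec. (\<forall>t\<in>{1..L}. g t \<in> vecs K k \<and> c t \<in> carrier K) \<and>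
        (\<Sum>i\<in>I. \<Sum>y\<in>PiE {1..L} (\<lambda>_. Y). if dec y = msg i then 0 else
            \<Prod>t\<in>{1..L}. W (aff K k (g t) (c t) (msg i)) (y t)) \<le> \<epsilon> * real (card I)))"
      using k code by blast
  qed
qed

end

section \<open>Random relay functions in the noise-free network\<close>

context ff_network
begin

definition vsum :: "(nat \<Rightarrow> nat) \<Rightarrow> nat \<Rightarrow> (nat \<Rightarrow> nat \<Rightarrow> 'a) \<Rightarrow> nat \<Rightarrow> 'a" where
  "vsum k v x = (\<lambda>j\<in>{..<k v}. finsum (K v) (\<lambda>u. x u j) (in_nbrs E v))"

abbreviation "G k v \<equiv> vecs (K v) (k v)"

lemma finite_G: "v \<in> V - {1} \<Longrightarrow> finite (G k v)"
  using finite_K by (auto intro: finite_PiE)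

lemma finite_in_nbrs: "finite (in_nbrs E v)"
  using in_nbrs_sub fin_V finite_subset by blast

lemma vsum_closed:
  assumes v: "v \<in> V - {1}" and "\<And>u. u \<in> in_nbrs E v \<Longrightarrow> x u \<in> G k v"
  shows "vsum k v x \<in> G k v"
proof -
  interpret field "K v" using field_K[OF v] .
  show ?thesis unfolding vsum_def using assms(2)
    by (auto intro!: finsum_closed simp: PiE_iff)
qed

text \<open>All relay functions on the edges into \<open>v\<close> at once, as one table indexed by
  in-neighbour and state of knowledge. With \<open>\<Lambda>\<close> finite, a uniformly random
  choice, independent over edges and states, is plain counting.\<close>

abbreviation maps :: "(nat \<Rightarrow> nat) \<Rightarrow> 'l set \<Rightarrow> nat \<Rightarrow> (nat \<times> 'l \<Rightarrow> nat \<Rightarrow> 'a) set" where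
  "maps k \<Lambda> v \<equiv> PiE (in_nbrs E v \<times> \<Lambda>) (\<lambda>_. G k v)"

text \<open>The entry at \<open>(u0, lab u0)\<close> occurs in the first sum only, because
  \<open>lab' u0\<close> is a different label. In a collision it is thus determined by all other
  entries, and forgetting it is injective on colliding tables.\<close>

lemma collision_count:
  fixes \<Lambda> :: "'l set" and lab lab' :: "nat \<Rightarrow> 'l"
  assumes v: "v \<in> V - {1}" and fin: "finite \<Lambda>"
    and lab: "\<And>u. u \<in> in_nbrs E v \<Longrightarrow> lab u \<in> \<Lambda>" "\<And>u. u \<in> in_nbrs E v \<Longrightarrow> lab' u \<in> \<Lambda>"
    and u0: "u0 \<in> in_nbrs E v" "lab u0 \<noteq> lab' u0"
  shows "card {h \<in> maps k \<Lambda> v. vsum k v (\<lambda>u. h (u, lab u)) = vsum k v (\<lambda>u. h (u, lab' u))} * card (G k v)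
    \<le> card (maps k \<Lambda> v)"
proof -
  interpret field "K v" using field_K[OF v] .
  let ?X = "in_nbrs E v \<times> \<Lambda>" and ?p = "(u0, lab u0)"
  let ?Coll = "{h \<in> maps k \<Lambda> v. vsum k v (\<lambda>u. h (u, lab u)) = vsum k v (\<lambda>u. h (u, lab' u))}"
  have finX: "finite ?X" using fin finite_in_nbrs by auto
  have p: "?p \<in> ?X" using u0 lab by auto
  have inj: "inj_on (\<lambda>h. restrict h (?X - {?p})) ?Coll"
  proof (rule inj_onI)
    fix h h' assume h: "h \<in> ?Coll" and h': "h' \<in> ?Coll"
      and eq: "restrict h (?X - {?p}) = restrict h' (?X - {?p})"
    have off: "h z = h' z" if "z \<in> ?X" "z \<noteq> ?p" for z
      using fun_cong[OF eq, of z] that by simp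
    have hm: "h z \<in> G k v" "h' z \<in> G k v" if "z \<in> ?X" for z using h h' that by auto
    have c: "h (u, lab u) j \<in> carrier (K v)" "h' (u, lab u) j \<in> carrier (K v)"
      "h (u, lab' u) j \<in> carrier (K v)" "h' (u, lab' u) j \<in> carrier (K v)"
      if "u \<in> in_nbrs E v" "j < k v" for u j
      using hm[of "(u, lab u)"] hm[of "(u, lab' u)"] lab that by (auto simp: PiE_iff)
    have "h ?p j = h' ?p j" if j: "j < k v" for j
    proof -
      let ?U = "in_nbrs E v - {u0}"
      have U: "in_nbrs E v = insert u0 ?U" using u0 by auto
      have sum: "finsum (K v) (\<lambda>u. h (u, lab u) j) (in_nbrs E v) =
          finsum (K v) (\<lambda>u. h (u, lab' u) j) (in_nbrs E v)"
          "finsum (K v) (\<lambda>u. h' (u, lab u) j) (in_nbrs E v) =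
          finsum (K v) (\<lambda>u. h' (u, lab' u) j) (in_nbrs E v)"
        using h h' j by (auto simp: vsum_def dest!: fun_cong[where x = j])
      have "finsum (K v) (\<lambda>u. h (u, lab' u) j) (in_nbrs E v) =
          finsum (K v) (\<lambda>u. h' (u, lab' u) j) (in_nbrs E v)"
        using off lab u0 c j by (intro finsum_cong') auto
      then have "finsum (K v) (\<lambda>u. h (u, lab u) j) (insert u0 ?U) =
          finsum (K v) (\<lambda>u. h' (u, lab u) j) (insert u0 ?U)" using sum U by simp
      moreover have "finsum (K v) (\<lambda>u. h (u, lab u) j) (insert u0 ?U) =
          h ?p j \<oplus>\<^bsub>K v\<^esub> finsum (K v) (\<lambda>u. h (u, lab u) j) ?U"
        using c j finite_in_nbrs u0 by (subst finsum_insert) auto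
      moreover have "finsum (K v) (\<lambda>u. h' (u, lab u) j) (insert u0 ?U) =
          h' ?p j \<oplus>\<^bsub>K v\<^esub> finsum (K v) (\<lambda>u. h' (u, lab u) j) ?U"
        using c j finite_in_nbrs u0 by (subst finsum_insert) auto
      moreover have "finsum (K v) (\<lambda>u. h (u, lab u) j) ?U = finsum (K v) (\<lambda>u. h' (u, lab u) j) ?U"
        using off lab c j by (intro finsum_cong') auto
      moreover have "finsum (K v) (\<lambda>u. h' (u, lab u) j) ?U \<in> carrier (K v)"
        using c j by (intro finsum_closed) auto
      ultimately show ?thesis using c[OF u0(1) j] by simp
    qed
    then have "h ?p = h' ?p" using hm[OF p] by (intro PiE_ext[where k = "{..<k v}"]) auto
    then have "h z = h' z" if "z \<in> ?X" for z using off that by metis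
    moreover have "h \<in> maps k \<Lambda> v" "h' \<in> maps k \<Lambda> v" using h h' by auto
    ultimately show "h = h'" by (meson PiE_ext)
  qed
  have "(\<lambda>h. restrict h (?X - {?p})) ` ?Coll \<subseteq> PiE (?X - {?p}) (\<lambda>_. G k v)"
  proof (rule image_subsetI)
    fix h assume "h \<in> ?Coll"
    then have "h \<in> maps k \<Lambda> v" by simp
    then show "restrict h (?X - {?p}) \<in> PiE (?X - {?p}) (\<lambda>_. G k v)"
      by (simp only: restrict_PiE_iff) (blast dest: PiE_mem)
  qed
  moreover have "finite (PiE (?X - {?p}) (\<lambda>_. G k v))"
    using finX by (intro finite_PiE[OF _ finite_G[OF v]]) simp
  ultimately have "card ?Coll \<le> card (PiE (?X - {?p}) (\<lambda>_. G k v))"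
    by (intro card_inj_on_le[OF inj])
  also have "\<dots> = card (G k v) ^ (card ?X - 1)"
    using finX p by (subst card_PiE) (auto simp: card_Diff_singleton)
  finally have "card ?Coll * card (G k v) \<le> card (G k v) ^ (card ?X - 1) * card (G k v)"
    by (rule mult_le_mono1)
  also have "\<dots> = card (G k v) ^ card ?X"
    using finX p by (subst power_Suc2[symmetric]) (metis Suc_pred' card_gt_0_iff empty_iff)
  also have "\<dots> = card (maps k \<Lambda> v)" using finX by (subst card_PiE) auto
  finally show ?thesis .
qed

text \<open>Bounds the probability that some destination still confuses two messages after \<open>r\<close> further
  blocks, given the set \<open>S\<close> of nodes that already distinguish them: each block gains a factor
  \<open>2 / q\<close>, except for the at most \<open>card V - card S\<close> blocks in which \<open>S\<close> grows.\<close>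

definition pot :: "real \<Rightarrow> nat \<Rightarrow> nat set \<Rightarrow> real" where
  "pot q r S = (if D \<subseteq> S then 0 else 2 ^ r * q ^ (card V - card S) / q ^ r)"

text \<open>If some destination is not in \<open>S\<close>, then \<open>S\<close> is a cut. Let
  \<open>A\<close> be the potential for an unchanged set. Either no node is added, which needs a
  collision at every boundary node and has probability at most \<open>1 / q\<close>, or a node is
  added and the power of \<open>q\<close> drops, leaving at most \<open>A / q\<close>. The two
  contributions of \<open>A / q\<close> account for the factor 2 in \<open>pot\<close>.\<close>

lemma one_round_pair:
  fixes \<Lambda> :: "'l set" and lab lab' :: "nat \<Rightarrow> 'l"
  assumes q: "q \<ge> 1" and cut: "\<And>S. S \<in> cuts V D \<Longrightarrow> q \<le> real (\<Prod>v\<in>cut_boundary V E S. card (G k v))"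
    and fin: "finite \<Lambda>" and lab: "\<And>u. u \<in> V \<Longrightarrow> lab u \<in> \<Lambda>" "\<And>u. u \<in> V \<Longrightarrow> lab' u \<in> \<Lambda>"
    and one: "lab 1 \<noteq> lab' 1"
  defines "S \<equiv> {u \<in> V. lab u \<noteq> lab' u}"
  shows "(\<Sum>h\<in>PiE (V - {1}) (maps k \<Lambda>). pot q r (S \<union> {v \<in> V - {1}.
      vsum k v (\<lambda>u. h v (u, lab u)) \<noteq> vsum k v (\<lambda>u. h v (u, lab' u))}))
    \<le> real (card (PiE (V - {1}) (maps k \<Lambda>))) * pot q (Suc r) S"
proof (cases "D \<subseteq> S")
  case True
  then have "D \<subseteq> S \<union> X" for X by auto
  then show ?thesis using True by (simp add: pot_def)
next
  case False
  let ?I = "V - {1}" and ?B = "cut_boundary V E S"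
  let ?H = "PiE ?I (maps k \<Lambda>)"
  let ?N = "\<lambda>h. {v \<in> ?I. vsum k v (\<lambda>u. h v (u, lab u)) \<noteq> vsum k v (\<lambda>u. h v (u, lab' u))}"
  let ?Coll = "\<lambda>v. {h \<in> maps k \<Lambda> v. vsum k v (\<lambda>u. h (u, lab u)) = vsum k v (\<lambda>u. h (u, lab' u))}"
  have S: "S \<in> cuts V D" using False one one_V D_sub by (auto simp: cuts_def S_def)
  have SV: "S \<subseteq> V" by (auto simp: S_def)
  then have finS: "finite S" using fin_V finite_subset by blast
  have BI: "?B \<subseteq> ?I" using S by (auto simp: cut_boundary_def cuts_def)
  have finI: "finite ?I" using fin_V by simp
  have fm: "finite (maps k \<Lambda> v)" if "v \<in> ?I" for v
    using fin finite_in_nbrs by (intro finite_PiE[OF _ finite_G[OF that]]) simp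
  have finH: "finite ?H" by (rule finite_PiE[OF finI fm])
  define A where "A = 2 ^ r * q ^ (card V - card S) / q ^ r"
  have A0: "A \<ge> 0" using q by (simp add: A_def)
  define Z where "Z = {h \<in> ?H. \<forall>v\<in>?B. h v \<in> ?Coll v}"
  have bound: "pot q r (S \<union> ?N h) \<le> (if h \<in> Z then A else 0) + A / q" if h: "h \<in> ?H" for h
  proof (cases "?N h \<subseteq> S")
    case True
    then have "S \<union> ?N h = S" by auto
    moreover have "h v \<in> ?Coll v" if v: "v \<in> ?B" for v
    proof -
      have "v \<notin> S" "v \<in> ?I" using v BI by (auto simp: cut_boundary_def)
      then show ?thesis using PiE_mem[OF h] True by blast
    qed
    then have "h \<in> Z" using h unfolding Z_def by blast
    ultimately show ?thesis using False A0 q by (simp add: pot_def A_def)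
  next
    case False2: False
    have "card S < card (S \<union> ?N h)"
      using False2 finS finI by (intro psubset_card_mono) auto
    moreover have "card (S \<union> ?N h) \<le> card V" using SV by (intro card_mono fin_V) auto
    ultimately have "Suc (card V - card (S \<union> ?N h)) \<le> card V - card S" by simp
    then have "q ^ Suc (card V - card (S \<union> ?N h)) \<le> q ^ (card V - card S)"
      using q by (rule power_increasing)
    then have "2 ^ r * q ^ (card V - card (S \<union> ?N h)) / q ^ r \<le> A / q"
      using q by (simp add: A_def field_simps)
    then have "pot q r (S \<union> ?N h) \<le> A / q" using A0 q by (simp add: pot_def)
    then show ?thesis using A0 by auto
  qed
  \<comment> \<open>Tables of different nodes are independent, so \<open>Z\<close> is a product set.
    A boundary node has an in-neighbour in \<open>S\<close>, which supplies the differing label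
    needed to count collisions.\<close>
  have cardZ: "real (card Z) * q \<le> real (card ?H)"
  proof -
    have "Z = PiE ?I (\<lambda>v. if v \<in> ?B then ?Coll v else maps k \<Lambda> v)"
      unfolding Z_def by (rule PiE_subset_components[OF BI]) blast
    then have "card Z = (\<Prod>v\<in>?I. card (if v \<in> ?B then ?Coll v else maps k \<Lambda> v))"
      using finI by (simp add: card_PiE)
    moreover have "(\<Prod>v\<in>?B. card (G k v)) = (\<Prod>v\<in>?I. if v \<in> ?B then card (G k v) else 1)"
      using BI finI by (subst prod.inter_restrict[symmetric]) (auto simp: Int_absorb1)
    ultimately have "card Z * (\<Prod>v\<in>?B. card (G k v)) =
       (\<Prod>v\<in>?I. card (if v \<in> ?B then ?Coll v else maps k \<Lambda> v) * (if v \<in> ?B then card (G k v) else 1))"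
      by (simp only: prod.distrib)
    also have "\<dots> \<le> (\<Prod>v\<in>?I. card (maps k \<Lambda> v))"
    proof (rule prod_mono, intro conjI)
      fix v assume v: "v \<in> ?I"
      show "card (if v \<in> ?B then ?Coll v else maps k \<Lambda> v) * (if v \<in> ?B then card (G k v) else 1)
          \<le> card (maps k \<Lambda> v)"
      proof (cases "v \<in> ?B")
        case True
        then obtain u0 where "u0 \<in> S" "(u0, v) \<in> E" by (auto simp: cut_boundary_def)
        then have u0: "u0 \<in> in_nbrs E v" "lab u0 \<noteq> lab' u0" by (auto simp: S_def in_nbrs_def)
        have "lab u \<in> \<Lambda>" "lab' u \<in> \<Lambda>" if "u \<in> in_nbrs E v" for u
          using lab in_nbrs_sub that by auto
        then show ?thesis
          unfolding if_P[OF True] by (rule collision_count[where lab = lab and lab' = lab', OF v fin _ _ u0])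
      qed simp
    qed simp
    also have "\<dots> = card ?H" using finI by (simp add: card_PiE)
    finally have "real (card Z) * real (\<Prod>v\<in>?B. card (G k v)) \<le> real (card ?H)"
      unfolding of_nat_mult[symmetric] of_nat_le_iff .
    moreover have "real (card Z) * q \<le> real (card Z) * real (\<Prod>v\<in>?B. card (G k v))"
      using cut[OF S] by (intro mult_left_mono) auto
    ultimately show ?thesis by linarith
  qed
  have "(\<Sum>h\<in>?H. pot q r (S \<union> ?N h)) \<le> (\<Sum>h\<in>?H. (if h \<in> Z then A else 0) + A / q)"
    by (intro sum_mono bound)
  also have "\<dots> = real (card Z) * A + real (card ?H) * (A / q)"
  proof -
    have "(\<Sum>h\<in>?H. if h \<in> Z then A else 0) = (\<Sum>h\<in>?H \<inter> Z. A)"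
      using finH by (rule sum.inter_restrict[symmetric])
    moreover have "?H \<inter> Z = Z" by (auto simp: Z_def)
    ultimately show ?thesis by (simp add: sum.distrib)
  qed
  also have "\<dots> \<le> real (card ?H) * (2 * A / q)"
  proof -
    have "real (card Z) * A = real (card Z) * q * (A / q)" using q by simp
    also have "\<dots> \<le> real (card ?H) * (A / q)" using cardZ A0 q by (intro mult_right_mono) auto
    finally have "real (card Z) * A + real (card ?H) * (A / q) \<le>
        real (card ?H) * (A / q) + real (card ?H) * (A / q)"
      by (rule add_right_mono)
    also have "\<dots> = real (card ?H) * (2 * A / q)"
      unfolding distrib_left[symmetric] add_divide_distrib[symmetric] mult_2 ..
    finally show ?thesis .
  qed
  also have "2 * A / q = pot q (Suc r) S" using False by (simp add: pot_def A_def ac_simps)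
  finally show ?thesis .
qed

text \<open>Averaging over the tables gives one choice that is good for the sum over all pairs
  simultaneously. \<open>\<Lambda>\<close> collects the finitely many labels that can occur for the
  messages in question.\<close>

lemma one_round:
  fixes lab :: "nat \<Rightarrow> nat \<Rightarrow> 'l" and P :: "(nat \<times> nat) set"
  assumes q: "q \<ge> 1" and cut: "\<And>S. S \<in> cuts V D \<Longrightarrow> q \<le> real (\<Prod>v\<in>cut_boundary V E S. card (G k v))"
    and M: "P \<subseteq> {1..M} \<times> {1..M}" and one: "\<And>w w'. (w, w') \<in> P \<Longrightarrow> lab 1 w \<noteq> lab 1 w'"
  shows "\<exists>h. (\<forall>v\<in>V - {1}. \<forall>u\<in>in_nbrs E v. \<forall>w\<in>{1..M}. h v (u, lab u w) \<in> G k v) \<and>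
    (\<Sum>(w, w')\<in>P. pot q r ({u \<in> V. lab u w \<noteq> lab u w'} \<union> {v \<in> V - {1}.
      vsum k v (\<lambda>u. h v (u, lab u w)) \<noteq> vsum k v (\<lambda>u. h v (u, lab u w'))}))
    \<le> (\<Sum>(w, w')\<in>P. pot q (Suc r) {u \<in> V. lab u w \<noteq> lab u w'})"
proof -
  define \<Lambda> where "\<Lambda> = (\<lambda>(u, w). lab u w) ` (V \<times> {1..M})"
  have fin: "finite \<Lambda>" using fin_V by (simp add: \<Lambda>_def)
  have lab: "lab u w \<in> \<Lambda>" if "u \<in> V" "w \<in> {1..M}" for u w
    unfolding \<Lambda>_def using that by (intro image_eqI[of _ _ "(u, w)"]) auto
  let ?H = "PiE (V - {1}) (maps k \<Lambda>)"
  let ?f = "\<lambda>h w w'. pot q r ({u \<in> V. lab u w \<noteq> lab u w'} \<union> {v \<in> V - {1}.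
      vsum k v (\<lambda>u. h v (u, lab u w)) \<noteq> vsum k v (\<lambda>u. h v (u, lab u w'))})"
  have ne: "maps k \<Lambda> v \<noteq> {}" if "v \<in> V - {1}" for v
  proof -
    interpret field "K v" using field_K[OF that] .
    show ?thesis by (auto simp: PiE_eq_empty_iff)
  qed
  have fm: "finite (maps k \<Lambda> v)" if "v \<in> V - {1}" for v
    using fin finite_in_nbrs by (intro finite_PiE[OF _ finite_G[OF that]]) simp
  have "finite (V - {1})" using fin_V by simp
  then have H1: "finite ?H" by (rule finite_PiE[OF _ fm])
  have H2: "?H \<noteq> {}"
  proof
    assume "?H = {}"
    then obtain v where "v \<in> V - {1}" "maps k \<Lambda> v = {}" by (rule PiE_eq_empty_iff[THEN iffD1, THEN bexE])
    then show False using ne by metis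
  qed
  have "(\<Sum>h\<in>?H. \<Sum>(w, w')\<in>P. ?f h w w') = (\<Sum>(w, w')\<in>P. \<Sum>h\<in>?H. ?f h w w')"
    by (subst sum.swap) (simp add: case_prod_unfold)
  also have "\<dots> \<le> (\<Sum>(w, w')\<in>P. real (card ?H) * pot q (Suc r) {u \<in> V. lab u w \<noteq> lab u w'})"
  proof (rule sum_mono, clarify)
    fix w w' assume p: "(w, w') \<in> P"
    then have "w \<in> {1..M}" "w' \<in> {1..M}" using M by auto
    then show "(\<Sum>h\<in>?H. ?f h w w') \<le> real (card ?H) * pot q (Suc r) {u \<in> V. lab u w \<noteq> lab u w'}"
      using lab by (intro one_round_pair[where lab = "\<lambda>u. lab u w" and lab' = "\<lambda>u. lab u w'",
            OF q cut fin _ _ one[OF p]])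
  qed
  also have "\<dots> = real (card ?H) * (\<Sum>(w, w')\<in>P. pot q (Suc r) {u \<in> V. lab u w \<noteq> lab u w'})"
    by (simp add: sum_distrib_left case_prod_unfold)
  finally obtain h where h: "h \<in> ?H" "(\<Sum>(w, w')\<in>P. ?f h w w') \<le>
      (\<Sum>(w, w')\<in>P. pot q (Suc r) {u \<in> V. lab u w \<noteq> lab u w'})"
    using exists_le_average[OF H1 H2] by blast
  have "h v (u, lab u w) \<in> G k v" if v: "v \<in> V - {1}" and "u \<in> in_nbrs E v" "w \<in> {1..M}" for u v w
    using PiE_mem[OF PiE_mem[OF h(1) v], of "(u, lab u w)"] lab in_nbrs_sub that by auto
  then show ?thesis using h(2) by blast
qed

text \<open>What node \<open>u\<close> knows at the start of block \<open>b\<close>: the message at the source, all previously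
  received block sums elsewhere.\<close>

definition lab :: "(nat \<Rightarrow> nat \<Rightarrow> nat \<Rightarrow> nat \<Rightarrow> 'a) \<Rightarrow> nat \<Rightarrow> nat \<Rightarrow> nat \<Rightarrow> nat \<times> (nat \<Rightarrow> nat \<Rightarrow> 'a)" where
  "lab r b u w = (if u = 1 then (w, undefined) else (0, past b (\<lambda>i. r i u w)))"

lemma lab_cong:
  assumes "\<And>i. 1 \<le> i \<Longrightarrow> i < b \<Longrightarrow> r i = r' i"
  shows "lab r b = lab r' b"
  using assms by (auto simp: lab_def past_def fun_eq_iff)

lemma past_Suc_eq_iff:
  "b \<ge> 1 \<Longrightarrow> past (Suc b) f = past (Suc b) g \<longleftrightarrow> past b f = past b g \<and> f b = g b"
  by (auto simp: past_def fun_eq_iff less_Suc_eq)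

text \<open>The relay functions are fixed block by block, as in the method of conditional
  expectations: the labels of a block depend on the choices made before, and the summed potential
  bounds the expected number of confused ordered pairs if the remaining blocks were random. Each
  choice keeps this number from increasing.\<close>

lemma noise_free_code:
  fixes M :: nat
  assumes q: "q \<ge> 1" and cut: "\<forall>S\<in>cuts V D. q \<le> real (\<Prod>v\<in>cut_boundary V E S. card (G k v))"
  defines "P \<equiv> {(w, w'). w \<in> {1..M::nat} \<and> w' \<in> {1..M} \<and> w \<noteq> w'}"
  shows "b \<le> B \<Longrightarrow> \<exists>h r. (\<forall>i\<in>{1..b}. \<forall>v\<in>V - {1}. \<forall>w\<in>{1..M}.
        r i v w = vsum k v (\<lambda>u. h i v (u, lab r i u w)) \<and>
        (\<forall>u\<in>in_nbrs E v. h i v (u, lab r i u w) \<in> G k v)) \<and>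
      (\<Sum>(w, w')\<in>P. pot q (B - b) {u \<in> V. lab r (Suc b) u w \<noteq> lab r (Suc b) u w'})
        \<le> real (M * (M - 1)) * pot q B {1}"
proof (induction b)
  case 0
  \<comment> \<open>Before the first block only the source can tell two messages apart.\<close>
  have "{u \<in> V. lab r (Suc 0) u w \<noteq> lab r (Suc 0) u w'} = {1}" if "(w, w') \<in> P" for r w w'
    using that one_V by (auto simp: P_def lab_def past_def fun_eq_iff)
  then have "(\<Sum>(w, w')\<in>P. pot q (B - 0) {u \<in> V. lab r (Suc 0) u w \<noteq> lab r (Suc 0) u w'}) =
      (\<Sum>p\<in>P. pot q B {1})" for r
    by (intro sum.cong) auto
  moreover have "card P = M * (M - 1)"
  proof -
    have "P = Sigma {1..M} (\<lambda>w. {1..M} - {w})" by (auto simp: P_def)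
    then show ?thesis by simp
  qed
  ultimately have "(\<Sum>(w, w')\<in>P. pot q (B - 0) {u \<in> V. lab r (Suc 0) u w \<noteq> lab r (Suc 0) u w'}) \<le>
      real (M * (M - 1)) * pot q B {1}" for r by simp
  then show ?case by (intro exI conjI) (simp, assumption?)
next
  case (Suc b)
  from Suc.IH[OF Suc_leD[OF Suc.prems]]
  obtain h r where IH: "\<forall>i\<in>{1..b}. \<forall>v\<in>V - {1}. \<forall>w\<in>{1..M}.
        r i v w = vsum k v (\<lambda>u. h i v (u, lab r i u w)) \<and>
        (\<forall>u\<in>in_nbrs E v. h i v (u, lab r i u w) \<in> G k v)"
    and le: "(\<Sum>(w, w')\<in>P. pot q (B - b) {u \<in> V. lab r (Suc b) u w \<noteq> lab r (Suc b) u w'})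
        \<le> real (M * (M - 1)) * pot q B {1}"
    by (elim exE conjE)
  have PM: "P \<subseteq> {1..M} \<times> {1..M}" by (auto simp: P_def)
  have one: "lab r (Suc b) 1 w \<noteq> lab r (Suc b) 1 w'" if "(w, w') \<in> P" for w w'
    using that by (auto simp: lab_def P_def)
  obtain g where g: "\<And>v u w. v \<in> V - {1} \<Longrightarrow> u \<in> in_nbrs E v \<Longrightarrow> w \<in> {1..M} \<Longrightarrow>
      g v (u, lab r (Suc b) u w) \<in> G k v"
    and gle: "(\<Sum>(w, w')\<in>P. pot q (B - Suc b) ({u \<in> V. lab r (Suc b) u w \<noteq> lab r (Suc b) u w'} \<union> {v \<in> V - {1}.
      vsum k v (\<lambda>u. g v (u, lab r (Suc b) u w)) \<noteq> vsum k v (\<lambda>u. g v (u, lab r (Suc b) u w'))}))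
    \<le> (\<Sum>(w, w')\<in>P. pot q (Suc (B - Suc b)) {u \<in> V. lab r (Suc b) u w \<noteq> lab r (Suc b) u w'})"
    using one_round[where lab = "lab r (Suc b)" and r = "B - Suc b", OF q bspec[OF cut] PM one] by blast
  define h' where "h' = h(Suc b := g)"
  define r' where "r' = r(Suc b := \<lambda>v w. vsum k v (\<lambda>u. g v (u, lab r (Suc b) u w)))"
  have new: "r' (Suc b) v w = vsum k v (\<lambda>u. g v (u, lab r (Suc b) u w))" "h' (Suc b) = g" for v w
    by (simp_all add: r'_def h'_def)
  have old: "r' i = r i" "h' i = h i" if "i \<noteq> Suc b" for i
    using that by (simp_all add: r'_def h'_def)
  \<comment> \<open>A label at the start of a block reads earlier sums only, so defining the sum of
    block \<open>Suc b\<close> does not alter the labels from which it is computed.\<close>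
  have lr: "lab r' i = lab r i" if "i \<le> Suc b" for i
    using that by (intro lab_cong) (auto simp: r'_def)
  have 1: "r' i v w = vsum k v (\<lambda>u. h' i v (u, lab r' i u w)) \<and>
        (\<forall>u\<in>in_nbrs E v. h' i v (u, lab r' i u w) \<in> G k v)"
    if "i \<in> {1..Suc b}" "v \<in> V - {1}" "w \<in> {1..M}" for i v w
  proof (cases "i = Suc b")
    case True
    have "\<forall>u\<in>in_nbrs E v. g v (u, lab r (Suc b) u w) \<in> G k v" using g[OF that(2) _ that(3)] by blast
    then show ?thesis unfolding True new lr[OF order_refl] by blast
  next
    case False
    then have "i \<in> {1..b}" using that by auto
    then show ?thesis
      unfolding old[OF False] lr[OF atLeastAtMost_iff[THEN iffD1, THEN conjunct2, OF that(1)]]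
      using bspec[OF bspec[OF bspec[OF IH] that(2)] that(3)] by blast
  qed
  have 2: "{u \<in> V. lab r' (Suc (Suc b)) u w \<noteq> lab r' (Suc (Suc b)) u w'} =
     {u \<in> V. lab r (Suc b) u w \<noteq> lab r (Suc b) u w'} \<union> {v \<in> V - {1}.
      vsum k v (\<lambda>u. g v (u, lab r (Suc b) u w)) \<noteq> vsum k v (\<lambda>u. g v (u, lab r (Suc b) u w'))}"
    if "(w, w') \<in> P" for w w'
  proof -
    have "lab r' (Suc (Suc b)) u w \<noteq> lab r' (Suc (Suc b)) u w' \<longleftrightarrow>
        lab r (Suc b) u w \<noteq> lab r (Suc b) u w' \<or> u \<noteq> 1 \<and>
        vsum k u (\<lambda>v. g u (v, lab r (Suc b) v w)) \<noteq> vsum k u (\<lambda>v. g u (v, lab r (Suc b) v w'))" for u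
    proof (cases "u = 1")
      case False
      have "r' (Suc b) u w = vsum k u (\<lambda>v. g u (v, lab r (Suc b) v w))" for w by (simp add: r'_def)
      then show ?thesis using False lr[of "Suc b", THEN fun_cong, THEN fun_cong, of u]
        by (simp add: lab_def past_Suc_eq_iff)
    qed (simp add: lab_def)
    then show ?thesis by auto
  qed
  have "(\<Sum>(w, w')\<in>P. pot q (B - Suc b) {u \<in> V. lab r' (Suc (Suc b)) u w \<noteq> lab r' (Suc (Suc b)) u w'}) =
    (\<Sum>(w, w')\<in>P. pot q (B - Suc b) ({u \<in> V. lab r (Suc b) u w \<noteq> lab r (Suc b) u w'} \<union> {v \<in> V - {1}.
      vsum k v (\<lambda>u. g v (u, lab r (Suc b) u w)) \<noteq> vsum k v (\<lambda>u. g v (u, lab r (Suc b) u w'))}))"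
    using 2 by (intro sum.cong refl) auto
  also have "\<dots> \<le> (\<Sum>(w, w')\<in>P. pot q (Suc (B - Suc b)) {u \<in> V. lab r (Suc b) u w \<noteq> lab r (Suc b) u w'})"
    by (rule gle)
  also have "Suc (B - Suc b) = B - b" using Suc.prems by simp
  also note le
  finally show ?case using 1 by (intro exI[of _ h'] exI[of _ r']) blast
qed

text \<open>With no blocks left, the potential of a pair confused at some destination is a power of
  \<open>q\<close> and hence at least 1, so the sum over pairs dominates the number of messages
  involved.\<close>

lemma confused_messages:
  assumes q: "q \<ge> 1" and pot: "(\<Sum>(w, w')\<in>{(w, w'). w \<in> {1..M::nat} \<and> w' \<in> {1..M} \<and> w \<noteq> w'}.
      pot q 0 {u \<in> V. lab r b u w \<noteq> lab r b u w'}) \<le> c"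
  shows "real (card {w \<in> {1..M}. \<exists>d\<in>D. \<exists>w'\<in>{1..M}. w' \<noteq> w \<and> lab r b d w = lab r b d w'}) \<le> c"
proof -
  let ?Bad = "{w \<in> {1..M}. \<exists>d\<in>D. \<exists>w'\<in>{1..M}. w' \<noteq> w \<and> lab r b d w = lab r b d w'}"
  let ?f = "\<lambda>w w'. pot q 0 {u \<in> V. lab r b u w \<noteq> lab r b u w'}"
  have nn: "?f w w' \<ge> 0" for w w' using q by (simp add: pot_def)
  have "real (card ?Bad) = (\<Sum>w\<in>?Bad. 1)" by simp
  also have "\<dots> \<le> (\<Sum>w\<in>?Bad. \<Sum>w'\<in>{1..M} - {w}. ?f w w')"
  proof (rule sum_mono)
    fix w assume "w \<in> ?Bad"
    then obtain d w' where d: "d \<in> D" "w' \<in> {1..M} - {w}" "lab r b d w = lab r b d w'" by auto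
    then have "\<not> D \<subseteq> {u \<in> V. lab r b u w \<noteq> lab r b u w'}" by auto
    then have "1 \<le> ?f w w'" using q by (simp add: pot_def one_le_power)
    also have "\<dots> \<le> (\<Sum>w'\<in>{1..M} - {w}. ?f w w')"
      using d nn by (intro member_le_sum) auto
    finally show "1 \<le> (\<Sum>w'\<in>{1..M} - {w}. ?f w w')" .
  qed
  also have "\<dots> \<le> (\<Sum>w\<in>{1..M}. \<Sum>w'\<in>{1..M} - {w}. ?f w w')"
    using nn by (intro sum_mono2 sum_nonneg) auto
  also have "\<dots> = (\<Sum>(w, w')\<in>Sigma {1..M} (\<lambda>w. {1..M} - {w}). ?f w w')"
    by (subst sum.Sigma) auto
  also have "Sigma {1..M} (\<lambda>w. {1..M} - {w}) = {(w, w'). w \<in> {1..M} \<and> w' \<in> {1..M} \<and> w \<noteq> w'}"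
    by auto
  also note pot
  finally show ?thesis .
qed

end

section \<open>The block scheme over the noisy network\<close>

text \<open>\<open>h\<close> and \<open>r\<close> describe a run of the noise-free network, while
  \<open>g\<close>, \<open>c\<close>, \<open>dec\<close> are the codes of the nodes. No error bound
  is assumed here; it enters later through \<open>block_err\<close>. \<open>N\<close> may exceed
  \<open>B * L\<close>, and the surplus times carry zeros.\<close>

locale block_scheme = ff_network V E D K Y W beta
  for V E D and K :: "nat \<Rightarrow> 'a ring" and Y :: "nat \<Rightarrow> 'b set" and W beta +
  fixes B L N M :: nat and k :: "nat \<Rightarrow> nat"
    and h :: "nat \<Rightarrow> nat \<Rightarrow> nat \<times> nat \<times> (nat \<Rightarrow> nat \<Rightarrow> 'a) \<Rightarrow> nat \<Rightarrow> 'a"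
    and r :: "nat \<Rightarrow> nat \<Rightarrow> nat \<Rightarrow> nat \<Rightarrow> 'a"
    and g :: "nat \<Rightarrow> nat \<Rightarrow> nat \<Rightarrow> 'a" and c :: "nat \<Rightarrow> nat \<Rightarrow> 'a"
    and dec :: "nat \<Rightarrow> (nat \<Rightarrow> 'b) \<Rightarrow> nat \<Rightarrow> 'a"
  assumes L: "L \<ge> 1" and BL: "B * L \<le> N" and M: "M \<ge> 1"
    and rec: "i \<in> {1..B} \<Longrightarrow> v \<in> V - {1} \<Longrightarrow> w \<in> {1..M} \<Longrightarrow>
        r i v w = vsum k v (\<lambda>u. h i v (u, lab r i u w))"
    and hG: "i \<in> {1..B} \<Longrightarrow> v \<in> V - {1} \<Longrightarrow> w \<in> {1..M} \<Longrightarrow> u \<in> in_nbrs E v \<Longrightarrow>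
        h i v (u, lab r i u w) \<in> G k v"
    and gG: "v \<in> V - {1} \<Longrightarrow> t \<in> {1..L} \<Longrightarrow> g v t \<in> G k v"
    and cK: "v \<in> V - {1} \<Longrightarrow> t \<in> {1..L} \<Longrightarrow> c v t \<in> carrier (K v)"
begin

section \<open>Time indexing, encoders and decoders\<close>

definition "blk t = Suc ((t - 1) div L)"
definition "pos t = Suc ((t - 1) mod L)"

lemma pos_range: "pos t \<in> {1..L}"
  using L by (simp add: pos_def Suc_le_eq)

lemma blk_ge: "blk t \<ge> 1"
  by (simp add: blk_def)

lemma blk_pos_eq:
  assumes "\<tau> \<in> {1..L}"
  shows "blk (b * L + \<tau>) = Suc b" "pos (b * L + \<tau>) = \<tau>"
proof -
  obtain s where s: "\<tau> = Suc s" "s < L" using assms by (cases \<tau>) auto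
  then show "blk (b * L + \<tau>) = Suc b" "pos (b * L + \<tau>) = \<tau>"
    by (auto simp: blk_def pos_def)
qed

text \<open>Earlier blocks are complete by the time they are used, so the mask \<open>past t\<close>
  hides nothing that a relay needs for its estimates.\<close>

lemma blk_before:
  assumes "t \<ge> 1" "1 \<le> i" "i < blk t" "\<tau> \<in> {1..L}"
  shows "(i - 1) * L + \<tau> < t"
proof -
  have "(i - 1) * L + \<tau> \<le> (i - 1) * L + L" using assms by simp
  also have "\<dots> = i * L" using assms by (cases i) auto
  also have "\<dots> \<le> ((t - 1) div L) * L" using assms by (intro mult_right_mono) (auto simp: blk_def)
  also have "\<dots> \<le> t - 1" by (rule div_times_less_eq_dividend)
  finally show ?thesis using assms(1) by linarith
qed

definition est :: "nat \<Rightarrow> nat \<Rightarrow> (nat \<Rightarrow> 'b) \<Rightarrow> nat \<Rightarrow> 'a" where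
  "est i v ys = (if in_nbrs E v = {} then \<lambda>j\<in>{..<k v}. \<zero>\<^bsub>K v\<^esub>
     else dec v (\<lambda>\<tau>\<in>{1..L}. ys ((i - 1) * L + \<tau>)))"

text \<open>The in-neighbour that contributes the shift of the affine code; a node without
  in-neighbours receives only zeros, hence the special case in \<open>est\<close>.\<close>

definition u0 :: "nat \<Rightarrow> nat" where "u0 v = (SOME u. u \<in> in_nbrs E v)"

text \<open>The inverse of \<open>beta u v\<close> cancels the channel coefficient. After a wrong
  estimate \<open>h\<close> may be applied to a label for which nothing is known about its value;
  the fallback to zero keeps the code valid even then.\<close>

definition edge_symbol :: "nat \<Rightarrow> nat \<Rightarrow> nat \<Rightarrow> nat \<times> (nat \<Rightarrow> nat \<Rightarrow> 'a) \<Rightarrow> 'a" where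
  "edge_symbol u v t l = (let x = inv\<^bsub>K v\<^esub> (beta u v) \<otimes>\<^bsub>K v\<^esub>
       aff (K v) (k v) (g v (pos t)) (if u0 v = u then c v (pos t) else \<zero>\<^bsub>K v\<^esub>) (h (blk t) v (u, l))
     in if blk t \<le> B \<and> x \<in> carrier (K v) then x else \<zero>\<^bsub>K v\<^esub>)"

definition "src_enc v t m = edge_symbol 1 v t (m, undefined)"
definition "relay_enc u v t ys = edge_symbol u v t (0, past (blk t) (\<lambda>i. est i u ys))"
definition "decoder d ys = (THE w. w \<in> {1..M} \<and> lab r (Suc B) d w = (0, past (Suc B) (\<lambda>i. est i d ys)))"

lemma edge_symbol_closed:
  assumes "(u, v) \<in> E"
  shows "edge_symbol u v t l \<in> carrier (K v)"
proof -
  interpret field "K v" using field_K[OF edge_head[OF assms]] .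
  show ?thesis by (simp add: edge_symbol_def Let_def)
qed

lemma code: "valid_code K E src_enc relay_enc"
  unfolding valid_code_def src_enc_def relay_enc_def using edge_symbol_closed by auto

text \<open>The input that \<open>v\<close> would see if every estimate were right. It depends on
  the message but on no output, so the law built from it is a product over nodes and times.\<close>

definition det_input :: "nat \<Rightarrow> nat \<Rightarrow> nat \<Rightarrow> 'a" where
  "det_input w v t = (if blk t \<le> B \<and> in_nbrs E v \<noteq> {}
     then aff (K v) (k v) (g v (pos t)) (c v (pos t)) (r (blk t) v w) else \<zero>\<^bsub>K v\<^esub>)"

lemma r_closed:
  assumes "i \<in> {1..B}" "v \<in> V - {1}" "w \<in> {1..M}"
  shows "r i v w \<in> G k v"
  unfolding rec[OF assms] using hG[OF assms] by (intro vsum_closed[OF assms(2)]) auto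

lemma det_input_closed:
  assumes "v \<in> V - {1}" "w \<in> {1..M}"
  shows "det_input w v t \<in> carrier (K v)"
proof -
  interpret field "K v" using field_K[OF assms(1)] .
  show ?thesis
    unfolding det_input_def
    using aff_closed[OF gG[OF assms(1) pos_range] cK[OF assms(1) pos_range] r_closed[OF _ assms, of "blk t"]]
      blk_ge[of t] by auto
qed

text \<open>As long as every node has decoded correctly, each node receives its noise-free block
  sum in encoded form: the affine encodings are superimposed by the channel, and exactly one
  in-neighbour contributes the shift.\<close>

lemma node_input_det:
  assumes w: "w \<in> {1..M}" and v: "v \<in> V - {1}" and t: "t \<ge> 1"
    and good: "\<And>u i. u \<in> V - {1} \<Longrightarrow> i \<in> {1..B} \<Longrightarrow> est i u (y u) = r i u w"
  shows "inp src_enc relay_enc w y v t = det_input w v t"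
proof -
  interpret field "K v" using field_K[OF v] .
  let ?b = "blk t" and ?U = "in_nbrs E v"
  let ?s = "\<lambda>u. beta u v \<otimes>\<^bsub>K v\<^esub> (if u = 1 then src_enc v t w else relay_enc u v t (past t (y u)))"
  show ?thesis
  proof (cases "?b \<le> B \<and> ?U \<noteq> {}")
    case False
    have "?s u = \<zero>\<^bsub>K v\<^esub>" if "u \<in> ?U" for u
      using False that coeff[of u v]
      by (auto simp: src_enc_def relay_enc_def edge_symbol_def in_nbrs_def)
    then have "finsum (K v) ?s ?U = finsum (K v) (\<lambda>u. \<zero>\<^bsub>K v\<^esub>) ?U"
      by (intro finsum_cong') auto
    then show ?thesis using False by (auto simp: node_input_def det_input_def)
  next
    case True
    then have b: "?b \<in> {1..B}" using blk_ge[of t] by auto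
    have lab_eq: "(0, past ?b (\<lambda>i. est i u (past t (y u)))) = lab r ?b u w"
      if u: "u \<in> ?U" "u \<noteq> 1" for u
    proof -
      have uV: "u \<in> V - {1}" using u in_nbrs_sub by auto
      have "est i u (past t (y u)) = r i u w" if i: "1 \<le> i" "i < ?b" for i
      proof -
        have "(\<lambda>\<tau>\<in>{1..L}. past t (y u) ((i - 1) * L + \<tau>)) = (\<lambda>\<tau>\<in>{1..L}. y u ((i - 1) * L + \<tau>))"
          using blk_before[OF t i] by (intro restrict_ext) (auto simp: past_def)
        then have "est i u (past t (y u)) = est i u (y u)" unfolding est_def by simp
        then show ?thesis using good[OF uV, of i] i b by simp
      qed
      then show ?thesis using u by (auto simp: lab_def past_def fun_eq_iff)
    qed
    let ?a = "\<lambda>u. aff (K v) (k v) (g v (pos t)) (if u0 v = u then c v (pos t) else \<zero>\<^bsub>K v\<^esub>)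
        (h ?b v (u, lab r ?b u w))"
    have ac: "?a u \<in> carrier (K v)" if "u \<in> ?U" for u
      using aff_closed[OF gG[OF v pos_range] _ hG[OF b v w that]] cK[OF v pos_range] by simp
    have "?s u = ?a u" if u: "u \<in> ?U" for u
    proof -
      have bu: "beta u v \<in> carrier (K v) - {\<zero>\<^bsub>K v\<^esub>}" using coeff[of u v] u by (simp add: in_nbrs_def)
      then have iu: "inv\<^bsub>K v\<^esub> (beta u v) \<in> carrier (K v)" "beta u v \<otimes>\<^bsub>K v\<^esub> inv\<^bsub>K v\<^esub> (beta u v) = \<one>\<^bsub>K v\<^esub>"
        using field_Units by auto
      have "edge_symbol u v t (lab r ?b u w) = inv\<^bsub>K v\<^esub> (beta u v) \<otimes>\<^bsub>K v\<^esub> ?a u"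
        using True ac[OF u] iu unfolding edge_symbol_def Let_def by auto
      moreover have "(if u = 1 then src_enc v t w else relay_enc u v t (past t (y u))) =
          edge_symbol u v t (lab r ?b u w)"
        using lab_eq[OF u] unfolding src_enc_def relay_enc_def by (auto simp: lab_def)
      ultimately have "?s u = beta u v \<otimes>\<^bsub>K v\<^esub> (inv\<^bsub>K v\<^esub> (beta u v) \<otimes>\<^bsub>K v\<^esub> ?a u)" by simp
      also have "\<dots> = ?a u" using bu iu ac[OF u] by (simp add: m_assoc[symmetric])
      finally show ?thesis .
    qed
    then have "finsum (K v) ?s ?U = finsum (K v) ?a ?U" using ac by (intro finsum_cong') auto
    also have "\<dots> = aff (K v) (k v) (g v (pos t)) (c v (pos t))
        (\<lambda>j\<in>{..<k v}. finsum (K v) (\<lambda>u. h ?b v (u, lab r ?b u w) j) ?U)"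
    proof (rule finsum_aff[OF finite_in_nbrs _ gG[OF v pos_range] cK[OF v pos_range] hG[OF b v w]])
      show "u0 v \<in> ?U" using True unfolding u0_def by (simp add: some_in_eq)
    qed
    finally show ?thesis
      using True unfolding node_input_def det_input_def rec[OF b v w] vsum_def by simp
  qed
qed

section \<open>Error analysis under the law of the noise-free inputs\<close>

definition block_err :: "nat \<Rightarrow> nat \<Rightarrow> nat \<Rightarrow> real" where
  "block_err v i w = (\<Sum>z\<in>PiE {1..L} (\<lambda>_. Y v). if dec v z = r i v w then 0 else
      \<Prod>\<tau>\<in>{1..L}. W v (aff (K v) (k v) (g v \<tau>) (c v \<tau>) (r i v w)) (z \<tau>))"

lemma block_err_nonneg:
  assumes "v \<in> V - {1}" "i \<in> {1..B}" "w \<in> {1..M}"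
  shows "block_err v i w \<ge> 0"
proof -
  interpret field "K v" using field_K[OF assms(1)] .
  have "W v (aff (K v) (k v) (g v \<tau>) (c v \<tau>) (r i v w)) (z \<tau>) \<ge> 0"
    if "z \<in> PiE {1..L} (\<lambda>_. Y v)" "\<tau> \<in> {1..L}" for z \<tau>
    using aff_closed[OF gG[OF assms(1) that(2)] cK[OF assms(1) that(2)] r_closed[OF assms(2,1,3)]]
      that by (intro W_nonneg[OF assms(1)]) auto
  then show ?thesis unfolding block_err_def by (auto intro!: sum_nonneg prod_nonneg)
qed

definition good :: "nat \<Rightarrow> (nat \<Rightarrow> nat \<Rightarrow> 'b) \<Rightarrow> bool" where
  "good w y \<longleftrightarrow> (\<forall>v\<in>V - {1}. \<forall>i\<in>{1..B}. est i v (y v) = r i v w)"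

definition det_prob :: "nat \<Rightarrow> (nat \<Rightarrow> nat \<Rightarrow> 'b) \<Rightarrow> real" where
  "det_prob w y = (\<Prod>v\<in>V - {1}. \<Prod>t\<in>{1..N}. W v (det_input w v t) (y v t))"

lemma det_node_sum:
  assumes "v \<in> V - {1}" "w \<in> {1..M}"
  shows "(\<Sum>z\<in>PiE {1..N} (\<lambda>_. Y v). \<Prod>t\<in>{1..N}. W v (det_input w v t) (z t)) = 1"
  using finite_Y[OF assms(1)] W_sum[OF assms(1) det_input_closed[OF assms]]
  by (subst prod_sum_PiE[symmetric]) auto

lemma det_prob_sum:
  assumes w: "w \<in> {1..M}"
  shows "(\<Sum>y\<in>outputs (V - {1}) N. det_prob w y) = 1"
proof -
  have "(\<Prod>v\<in>V - {1}. \<Sum>z\<in>PiE {1..N} (\<lambda>_. Y v). \<Prod>t\<in>{1..N}. W v (det_input w v t) (z t)) =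
    (\<Sum>y\<in>outputs (V - {1}) N. det_prob w y)"
    unfolding det_prob_def using fin_V finite_Y by (intro prod_sum_PiE) (auto intro: finite_PiE)
  then show ?thesis using det_node_sum[OF _ w] by simp
qed

lemma det_prob_nonneg:
  assumes w: "w \<in> {1..M}" and y: "y \<in> outputs (V - {1}) N"
  shows "det_prob w y \<ge> 0"
  unfolding det_prob_def
proof (intro prod_nonneg ballI)
  fix v t assume v: "v \<in> V - {1}" and t: "t \<in> {1..N}"
  show "W v (det_input w v t) (y v t) \<ge> 0"
    using W_nonneg[OF v det_input_closed[OF v w] outputs_in[OF y v t]] .
qed

text \<open>Under the product law everything outside node \<open>v\<close> and block
  \<open>i\<close> sums out, and the remaining window is one use of the code of \<open>v\<close> on
  the vector \<open>r i v w\<close>. A node without in-neighbours always estimates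
  correctly.\<close>

lemma est_error_prob:
  assumes w: "w \<in> {1..M}" and v: "v \<in> V - {1}" and i: "i \<in> {1..B}"
  shows "(\<Sum>y\<in>outputs (V - {1}) N. det_prob w y * (if est i v (y v) = r i v w then 0 else 1))
    \<le> block_err v i w"
proof (cases "in_nbrs E v = {}")
  case True
  interpret field "K v" using field_K[OF v] .
  have "r i v w = (\<lambda>j\<in>{..<k v}. \<zero>\<^bsub>K v\<^esub>)" unfolding rec[OF i v w] vsum_def True by simp
  then have "est i v ys = r i v w" for ys using True by (simp add: est_def)
  then show ?thesis using block_err_nonneg[OF v i w] by simp
next
  case False
  define a where "a = (i - 1) * L"
  have "i * L \<le> B * L" using i by (intro mult_right_mono) auto
  moreover have "a + L = i * L" using i by (cases i) (auto simp: a_def)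
  ultimately have aN: "a + L \<le> N" using BL by linarith
  let ?f = "\<lambda>z. if dec v z = r i v w then 0 else 1 :: real"
  have "(\<Sum>y\<in>outputs (V - {1}) N. det_prob w y * (if est i v (y v) = r i v w then 0 else 1)) =
    (\<Sum>z\<in>PiE {1..N} (\<lambda>_. Y v). (\<Prod>t\<in>{1..N}. W v (det_input w v t) (z t)) *
      (if est i v z = r i v w then 0 else 1))"
    unfolding det_prob_def
    by (rule sum_PiE_component[where p = "\<lambda>v z. \<Prod>t\<in>{1..N}. W v (det_input w v t) (z t)"
        and f = "\<lambda>z. if est i v z = r i v w then 0 else 1"])
      (use fin_V v finite_Y det_node_sum[OF _ w] in \<open>auto intro: finite_PiE\<close>)
  also have "\<dots> = (\<Sum>z\<in>PiE {1..N} (\<lambda>_. Y v). (\<Prod>t\<in>{1..N}. W v (det_input w v t) (z t)) *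
      ?f (\<lambda>\<tau>\<in>{1..L}. z (a + \<tau>)))"
    using False by (simp add: est_def a_def)
  also have "\<dots> = (\<Sum>z\<in>PiE {1..L} (\<lambda>_. Y v). (\<Prod>\<tau>\<in>{1..L}. W v (det_input w v (a + \<tau>)) (z \<tau>)) * ?f z)"
    by (rule sum_PiE_block[OF finite_Y[OF v] aN W_sum[OF v det_input_closed[OF v w]]])
  also have "\<dots> = block_err v i w"
    unfolding block_err_def
  proof (intro sum.cong refl)
    fix z
    have "det_input w v (a + \<tau>) = aff (K v) (k v) (g v \<tau>) (c v \<tau>) (r i v w)" if "\<tau> \<in> {1..L}" for \<tau>
      using blk_pos_eq[OF that, of "i - 1"] i False by (simp add: det_input_def a_def)
    then have "(\<Prod>\<tau>\<in>{1..L}. W v (det_input w v (a + \<tau>)) (z \<tau>)) =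
        (\<Prod>\<tau>\<in>{1..L}. W v (aff (K v) (k v) (g v \<tau>) (c v \<tau>) (r i v w)) (z \<tau>))"
      by (intro prod.cong) auto
    then show "(\<Prod>\<tau>\<in>{1..L}. W v (det_input w v (a + \<tau>)) (z \<tau>)) * ?f z =
        (if dec v z = r i v w then 0 else
        (\<Prod>\<tau>\<in>{1..L}. W v (aff (K v) (k v) (g v \<tau>) (c v \<tau>) (r i v w)) (z \<tau>)))" by simp
  qed
  finally show ?thesis by simp
qed

lemma bad_prob:
  assumes w: "w \<in> {1..M}"
  shows "(\<Sum>y\<in>outputs (V - {1}) N. det_prob w y * (if good w y then 0 else 1))
    \<le> (\<Sum>v\<in>V - {1}. \<Sum>i\<in>{1..B}. block_err v i w)"
proof -
  let ?bad = "\<lambda>v i y. if est i v (y v) = r i v w then 0 else 1 :: real"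
  have union: "(if good w y then 0 else 1) \<le> (\<Sum>v\<in>V - {1}. \<Sum>i\<in>{1..B}. ?bad v i y)" for y
  proof (cases "good w y")
    case False
    then obtain v i where vi: "v \<in> V - {1}" "i \<in> {1..B}" "est i v (y v) \<noteq> r i v w"
      unfolding good_def by blast
    have "1 = ?bad v i y" using vi by simp
    also have "\<dots> \<le> (\<Sum>i\<in>{1..B}. ?bad v i y)"
      using vi by (intro member_le_sum[of _ _ "\<lambda>i. ?bad v i y"]) auto
    also have "\<dots> \<le> (\<Sum>v\<in>V - {1}. \<Sum>i\<in>{1..B}. ?bad v i y)"
      using vi fin_V by (intro member_le_sum[of _ _ "\<lambda>v. \<Sum>i\<in>{1..B}. ?bad v i y"]) (auto intro!: sum_nonneg)
    finally show ?thesis using False by simp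
  next
    case True
    have "0 \<le> (\<Sum>v\<in>V - {1}. \<Sum>i\<in>{1..B}. ?bad v i y)" by (intro sum_nonneg) simp
    then show ?thesis using True by simp
  qed
  have "(\<Sum>y\<in>outputs (V - {1}) N. det_prob w y * (if good w y then 0 else 1)) \<le>
      (\<Sum>y\<in>outputs (V - {1}) N. det_prob w y * (\<Sum>v\<in>V - {1}. \<Sum>i\<in>{1..B}. ?bad v i y))"
    by (intro sum_mono mult_left_mono union det_prob_nonneg[OF w])
  also have "\<dots> = (\<Sum>v\<in>V - {1}. \<Sum>i\<in>{1..B}. \<Sum>y\<in>outputs (V - {1}) N. det_prob w y * ?bad v i y)"
    unfolding sum_distrib_left
    by (subst sum.swap, rule sum.cong[OF refl], rule sum.swap)
  also have "\<dots> \<le> (\<Sum>v\<in>V - {1}. \<Sum>i\<in>{1..B}. block_err v i w)"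
    by (intro sum_mono est_error_prob[OF w])
  finally show ?thesis .
qed

definition "bad_msgs = {w \<in> {1..M}. \<exists>d\<in>D. \<exists>w'\<in>{1..M}. w' \<noteq> w \<and> lab r (Suc B) d w = lab r (Suc B) d w'}"

lemma decoder_correct:
  assumes w: "w \<in> {1..M}" "w \<notin> bad_msgs" and good: "good w y" and d: "d \<in> D"
  shows "decoder d (y d) = w"
proof -
  have dV: "d \<in> V - {1}" using d D_sub by auto
  have "past (Suc B) (\<lambda>i. est i d (y d)) = past (Suc B) (\<lambda>i. r i d w)"
    using good dV unfolding good_def past_def by (auto simp: fun_eq_iff)
  then have l: "(0, past (Suc B) (\<lambda>i. est i d (y d))) = lab r (Suc B) d w"
    using dV by (simp add: lab_def)
  have "w' = w" if "w' \<in> {1..M}" "lab r (Suc B) d w' = lab r (Suc B) d w" for w'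
    using w d that unfolding bad_msgs_def mem_Collect_eq by metis
  then show ?thesis unfolding decoder_def l using w by (intro the_equality) auto
qed

text \<open>The true law and \<open>det_prob\<close> agree on good outputs and both have total mass
  1, so they give the same mass to the bad ones. For a message that is not confused, errors occur
  only on bad outputs, and their mass can be computed under the product law, where the union bound
  over nodes and blocks is available.\<close>

lemma error_given_msg:
  assumes w: "w \<in> {1..M}"
  defines "e \<equiv> \<Sum>y\<in>outputs (V - {1}) N.
      (\<Prod>v\<in>V - {1}. \<Prod>t\<in>{1..N}. W v (inp src_enc relay_enc w y v t) (y v t)) *
      (if \<exists>d\<in>D. decoder d (y d) \<noteq> w then 1 else 0)"
  shows "e \<le> 1" and "w \<notin> bad_msgs \<Longrightarrow> e \<le> (\<Sum>v\<in>V - {1}. \<Sum>i\<in>{1..B}. block_err v i w)"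
proof -
  let ?O = "outputs (V - {1}) N"
  let ?P = "\<lambda>y. \<Prod>v\<in>V - {1}. \<Prod>t\<in>{1..N}. W v (inp src_enc relay_enc w y v t) (y v t)"
  have nn: "?P y \<ge> 0" if y: "y \<in> ?O" for y
  proof (intro prod_nonneg ballI)
    fix v t assume v: "v \<in> V - {1}" and t: "t \<in> {1..N}"
    show "W v (inp src_enc relay_enc w y v t) (y v t) \<ge> 0"
      using W_nonneg[OF v node_input_closed[OF code v] outputs_in[OF y v t]] .
  qed
  have "e \<le> (\<Sum>y\<in>?O. ?P y)" unfolding e_def
    using nn by (intro sum_mono) auto
  then show "e \<le> 1" using total_prob[OF code, of w N] by simp
  assume wb: "w \<notin> bad_msgs"
  have same: "?P y = det_prob w y" if "good w y" for y
    unfolding det_prob_def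
    using node_input_det[OF w, of _ _ y] that unfolding good_def by (intro prod.cong refl) auto
  have "e \<le> (\<Sum>y\<in>?O. ?P y - det_prob w y * (if good w y then 1 else 0))"
    unfolding e_def
  proof (rule sum_mono)
    fix y assume y: "y \<in> ?O"
    show "?P y * (if \<exists>d\<in>D. decoder d (y d) \<noteq> w then 1 else 0) \<le>
        ?P y - det_prob w y * (if good w y then 1 else 0)"
    proof (cases "good w y")
      case True
      then show ?thesis using decoder_correct[OF w wb True] same[OF True] by simp
    next
      case False
      then show ?thesis using nn[OF y] by simp
    qed
  qed
  also have "\<dots> = 1 - (\<Sum>y\<in>?O. det_prob w y * (if good w y then 1 else 0))"
    using total_prob[OF code, of w N] by (simp only: sum_subtractf)
  also have "\<dots> = (\<Sum>y\<in>?O. det_prob w y - det_prob w y * (if good w y then 1 else 0))"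
    using det_prob_sum[OF w] by (simp only: sum_subtractf)
  also have "\<dots> = (\<Sum>y\<in>?O. det_prob w y * (if good w y then 0 else 1))"
    by (intro sum.cong refl) auto
  also note bad_prob[OF w]
  finally show "e \<le> (\<Sum>v\<in>V - {1}. \<Sum>i\<in>{1..B}. block_err v i w)" .
qed

lemma error_prob_bound:
  "error_prob V E D K Y W beta N M src_enc relay_enc decoder \<le>
    (real (card bad_msgs) + (\<Sum>v\<in>V - {1}. \<Sum>(w, i)\<in>{1..M} \<times> {1..B}. block_err v i w)) / real M"
proof -
  let ?e = "\<lambda>w. \<Sum>y\<in>outputs (V - {1}) N.
      (\<Prod>v\<in>V - {1}. \<Prod>t\<in>{1..N}. W v (inp src_enc relay_enc w y v t) (y v t)) *
      (if \<exists>d\<in>D. decoder d (y d) \<noteq> w then 1 else 0)"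
  let ?s = "\<lambda>w. \<Sum>v\<in>V - {1}. \<Sum>i\<in>{1..B}. block_err v i w"
  have s0: "?s w \<ge> 0" if "w \<in> {1..M}" for w
    using block_err_nonneg[OF _ _ that] by (intro sum_nonneg) auto
  have "(\<Sum>w\<in>{1..M}. ?e w) \<le> (\<Sum>w\<in>{1..M}. (if w \<in> bad_msgs then 1 else 0) + ?s w)"
  proof (rule sum_mono)
    fix w assume w: "w \<in> {1..M}"
    show "?e w \<le> (if w \<in> bad_msgs then 1 else 0) + ?s w"
      using error_given_msg[OF w] s0[OF w] by (cases "w \<in> bad_msgs") auto
  qed
  also have "\<dots> = real (card bad_msgs) + (\<Sum>w\<in>{1..M}. ?s w)"
  proof -
    have "(\<Sum>w\<in>{1..M}. if w \<in> bad_msgs then 1 else 0 :: real) = (\<Sum>w\<in>{1..M} \<inter> bad_msgs. 1)"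
      by (rule sum.inter_restrict[symmetric]) simp
    moreover have "{1..M} \<inter> bad_msgs = bad_msgs" by (auto simp: bad_msgs_def)
    ultimately show ?thesis by (simp add: sum.distrib)
  qed
  also have "(\<Sum>w\<in>{1..M}. ?s w) = (\<Sum>v\<in>V - {1}. \<Sum>w\<in>{1..M}. \<Sum>i\<in>{1..B}. block_err v i w)"
    by (rule sum.swap)
  also have "\<dots> = (\<Sum>v\<in>V - {1}. \<Sum>(w, i)\<in>{1..M} \<times> {1..B}. block_err v i w)"
    by (simp only: sum.cartesian_product)
  finally show ?thesis
    unfolding error_prob_def using M by (simp add: divide_right_mono)
qed

end

section \<open>The capacity\<close>

lemma tendsto_exp_affine:
  fixes a b :: real
  assumes "a > 0"
  shows "(\<lambda>L. 2 powr (b - real L * a)) \<longlonglongrightarrow> 0"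
proof -
  have "(\<lambda>L. 2 powr b * (2 powr (- a)) ^ L) \<longlonglongrightarrow> 2 powr b * 0"
    using assms by (intro tendsto_mult tendsto_const LIMSEQ_power_zero) (auto simp: powr_minus_divide)
  moreover have "2 powr b * (2 powr (- a)) ^ L = 2 powr (b - real L * a)" for L
    by (simp add: powr_realpow[symmetric] powr_powr powr_add[symmetric] mult.commute)
  ultimately show ?thesis by simp
qed

context ff_network
begin

text \<open>The relay functions come first; their block sums, indexed by message and block, are the
  lists for which the codes are then requested. The power of 2 in the bound is the share of confused
  messages, and the other term collects the decoding errors.\<close>

lemma block_scheme_exists:
  assumes R: "R \<ge> 0" and B: "B \<ge> 1" and L: "L \<ge> 1" and N: "B * L \<le> N" "N < B * (L + 1)"
    and R1: "R1 \<ge> 0" and R1_cut: "\<And>S. S \<in> cuts V D \<Longrightarrow> R1 \<le> (\<Sum>v\<in>cut_boundary V E S. C v - \<delta>)"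
    and k: "\<And>v. v \<in> V - {1} \<Longrightarrow> 2 powr (real L * (C v - \<delta>)) \<le> real (card (carrier (K v))) ^ k v"
    and codes: "\<And>v I msg. v \<in> V - {1} \<Longrightarrow> finite (I :: (nat \<times> nat) set) \<Longrightarrow> msg \<in> I \<rightarrow> G k v \<Longrightarrow>
      \<exists>g c dec. (\<forall>t\<in>{1..L}. g t \<in> G k v \<and> c t \<in> carrier (K v)) \<and>
        (\<Sum>i\<in>I. \<Sum>y\<in>PiE {1..L} (\<lambda>_. Y v). if dec y = msg i then 0 else
            \<Prod>t\<in>{1..L}. W v (aff (K v) (k v) (g t) (c t) (msg i)) (y t)) \<le> \<epsilon> * real (card I)"
  shows "\<exists>M fs fr g. real M \<ge> 2 powr (real N * R) \<and> valid_code K E fs fr \<and>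
    error_prob V E D K Y W beta N M fs fr g \<le>
      2 powr (real B * R + real B - real L * (real B * R1 - real B * R - real (card V) * R1)) +
      real (card V) * real B * \<epsilon>"
proof -
  \<comment> \<open>\<open>R1\<close> bits per symbol over a block of length \<open>L\<close>: for
    every cut the groups at its boundary have at least \<open>q\<close> elements jointly, so
    \<open>1 / q\<close> bounds the chance of a simultaneous collision.\<close>
  define q where "q = 2 powr (real L * R1)"
  have q: "q \<ge> 1" using R1 by (simp add: q_def ge_one_powr_ge_zero)
  have "q \<le> real (\<Prod>v\<in>cut_boundary V E S. card (G k v))" if S: "S \<in> cuts V D" for S
  proof -
    let ?B = "cut_boundary V E S"
    have BI: "?B \<subseteq> V - {1}" using S by (auto simp: cut_boundary_def cuts_def)
    have finB: "finite ?B" using fin_V by (simp add: cut_boundary_def)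
    have "real L * R1 \<le> (\<Sum>v\<in>?B. real L * (C v - \<delta>))"
      using R1_cut[OF S] by (simp add: sum_distrib_left[symmetric] mult_left_mono)
    then have "q \<le> 2 powr (\<Sum>v\<in>?B. real L * (C v - \<delta>))" by (simp add: q_def)
    also have "\<dots> = (\<Prod>v\<in>?B. 2 powr (real L * (C v - \<delta>)))"
      by (rule powr_sum) (auto simp: finB)
    also have "\<dots> \<le> (\<Prod>v\<in>?B. real (card (G k v)))"
      using k BI by (intro prod_mono) (auto simp: card_PiE)
    finally show ?thesis by simp
  qed
  then have cuts: "\<forall>S\<in>cuts V D. q \<le> real (\<Prod>v\<in>cut_boundary V E S. card (G k v))" by (rule ballI)
  define M where "M = nat \<lceil>2 powr (real N * R)\<rceil>"
  have M_ge: "real M \<ge> 2 powr (real N * R)" unfolding M_def by linarith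
  have "real M < 2 powr (real N * R) + 1" unfolding M_def
    using powr_ge_zero[of 2 "real N * R"] by linarith
  then have M_le: "real M - 1 \<le> 2 powr (real N * R)" by linarith
  have M1: "M \<ge> 1" using M_ge powr_gt_zero[of 2 "real N * R"] by (cases M) auto
  from noise_free_code[where q = q and k = k and M = M and b = B and B = B, OF q cuts order_refl]
  obtain h r where hr: "\<forall>i\<in>{1..B}. \<forall>v\<in>V - {1}. \<forall>w\<in>{1..M}.
        r i v w = vsum k v (\<lambda>u. h i v (u, lab r i u w)) \<and>
        (\<forall>u\<in>in_nbrs E v. h i v (u, lab r i u w) \<in> G k v)"
      and pot: "(\<Sum>(w, w')\<in>{(w, w'). w \<in> {1..M} \<and> w' \<in> {1..M} \<and> w \<noteq> w'}.
        pot q (B - B) {u \<in> V. lab r (Suc B) u w \<noteq> lab r (Suc B) u w'})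
        \<le> real (M * (M - 1)) * pot q B {1}"
    by (elim exE conjE)
  have rec: "r i v w = vsum k v (\<lambda>u. h i v (u, lab r i u w))"
    and hG: "\<And>u. u \<in> in_nbrs E v \<Longrightarrow> h i v (u, lab r i u w) \<in> G k v"
    if "i \<in> {1..B}" "v \<in> V - {1}" "w \<in> {1..M}" for i v w
    using bspec[OF bspec[OF bspec[OF hr that(1)] that(2)] that(3)] by blast+
  have rG: "r i v w \<in> G k v" if "i \<in> {1..B}" "v \<in> V - {1}" "w \<in> {1..M}" for i v w
    unfolding rec[OF that] using hG[OF that] by (intro vsum_closed[OF that(2)]) auto
  let ?I = "{1..M} \<times> {1..B}"
  have "\<exists>g c dec. (\<forall>t\<in>{1..L}. g t \<in> G k v \<and> c t \<in> carrier (K v)) \<and>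
      (\<Sum>i\<in>?I. \<Sum>y\<in>PiE {1..L} (\<lambda>_. Y v). if dec y = r (snd i) v (fst i) then 0 else
        \<Prod>t\<in>{1..L}. W v (aff (K v) (k v) (g t) (c t) (r (snd i) v (fst i))) (y t)) \<le> \<epsilon> * real (card ?I)"
    if v: "v \<in> V - {1}" for v
  proof (rule codes[OF v])
    show "(\<lambda>i. r (snd i) v (fst i)) \<in> ?I \<rightarrow> G k v"
      using rG[OF _ v] by (intro Pi_I) (simp only: mem_Times_iff)
  qed simp
  then have "\<forall>v\<in>V - {1}. \<exists>x. case x of (g, c, dec) \<Rightarrow>
      (\<forall>t\<in>{1..L}. g t \<in> G k v \<and> c t \<in> carrier (K v)) \<and>
      (\<Sum>i\<in>?I. \<Sum>y\<in>PiE {1..L} (\<lambda>_. Y v). if dec y = r (snd i) v (fst i) then 0 else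
        \<Prod>t\<in>{1..L}. W v (aff (K v) (k v) (g t) (c t) (r (snd i) v (fst i))) (y t)) \<le> \<epsilon> * real (card ?I)"
    by (simp only: split_paired_Ex prod.case) blast
  then obtain x where x: "\<forall>v\<in>V - {1}. case x v of (g, c, dec) \<Rightarrow>
      (\<forall>t\<in>{1..L}. g t \<in> G k v \<and> c t \<in> carrier (K v)) \<and>
      (\<Sum>i\<in>?I. \<Sum>y\<in>PiE {1..L} (\<lambda>_. Y v). if dec y = r (snd i) v (fst i) then 0 else
        \<Prod>t\<in>{1..L}. W v (aff (K v) (k v) (g t) (c t) (r (snd i) v (fst i))) (y t)) \<le> \<epsilon> * real (card ?I)"
    by (rule bchoice[THEN exE])
  define g c dec where "g v = fst (x v)" and "c v = fst (snd (x v))" and "dec v = snd (snd (x v))" for v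
  have gc: "\<And>t. t \<in> {1..L} \<Longrightarrow> g v t \<in> G k v" "\<And>t. t \<in> {1..L} \<Longrightarrow> c v t \<in> carrier (K v)"
    and err: "(\<Sum>i\<in>?I. \<Sum>y\<in>PiE {1..L} (\<lambda>_. Y v). if dec v y = r (snd i) v (fst i) then 0 else
        \<Prod>t\<in>{1..L}. W v (aff (K v) (k v) (g v t) (c v t) (r (snd i) v (fst i))) (y t)) \<le> \<epsilon> * real (card ?I)"
    if "v \<in> V - {1}" for v
    using bspec[OF x that] unfolding g_def c_def dec_def case_prod_unfold by blast+
  interpret block_scheme V E D K Y W beta B L N M k h r g c dec
    by unfold_locales (fact L N(1) M1 rec hG gc)+
  have errs: "(\<Sum>v\<in>V - {1}. \<Sum>(w, i)\<in>?I. block_err v i w) \<le> real (card V) * (\<epsilon> * (real M * real B))"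
  proof -
    have "(\<Sum>(w, i)\<in>?I. block_err v i w) \<le> \<epsilon> * (real M * real B)" if "v \<in> V - {1}" for v
      using err[OF that] unfolding block_err_def case_prod_unfold by simp
    then have "(\<Sum>v\<in>V - {1}. \<Sum>(w, i)\<in>?I. block_err v i w) \<le> (\<Sum>v\<in>V - {1}. \<epsilon> * (real M * real B))"
      by (rule sum_mono)
    also have "\<dots> \<le> real (card V) * (\<epsilon> * (real M * real B))"
    proof -
      \<comment> \<open>The code bound at any node other than the source, here a destination, forces
        the error level to be nonnegative.\<close>
      obtain d where d: "d \<in> V - {1}" using D_ne D_sub by auto
      have "0 \<le> (\<Sum>i\<in>?I. block_err d (snd i) (fst i))"
        using block_err_nonneg[OF d] by (intro sum_nonneg) auto
      also have "\<dots> \<le> \<epsilon> * real (card ?I)" by (rule err[OF d, folded block_err_def])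
      finally have "0 \<le> \<epsilon> * (real M * real B)" by simp
      moreover have "real (card (V - {1})) \<le> real (card V)" using fin_V by (simp add: card_mono)
      ultimately show ?thesis unfolding sum_constant by (rule mult_right_mono[rotated])
    qed
    finally show ?thesis .
  qed
  have bad: "real (card bad_msgs) \<le> real (M * (M - 1)) * pot q B {1}"
    unfolding bad_msgs_def by (rule confused_messages[OF q]) (use pot in simp)
  \<comment> \<open>Dividing the number of ordered pairs by \<open>M\<close> leaves
    \<open>M - 1\<close>, which is at most \<open>2 powr (real N * R)\<close> although
    \<open>M\<close> was rounded up.\<close>
  have "real (card bad_msgs) / real M \<le> (real M - 1) * pot q B {1}"
    using bad M1 by (simp add: field_simps of_nat_diff)
  also have "\<dots> \<le> 2 powr (real N * R) * pot q B {1}"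
    using M_le q by (intro mult_right_mono) (auto simp: pot_def)
  also have "\<dots> \<le> 2 powr (real B * R + real L * real B * R) * pot q B {1}"
  proof -
    \<comment> \<open>Times outside the \<open>B\<close> full blocks cost at most
      \<open>B * R\<close> bits, a constant once \<open>B\<close> is fixed.\<close>
    have "real N \<le> real (B * (L + 1))" using N(2) by linarith
    then have "real N * R \<le> real (B * (L + 1)) * R" using R by (intro mult_right_mono) auto
    then show ?thesis using q by (intro mult_right_mono) (auto simp: pot_def algebra_simps)
  qed
  also have "pot q B {1} \<le> 2 powr real B * 2 powr (real (card V) * real L * R1) / 2 powr (real B * real L * R1)"
  proof -
    have "\<not> D \<subseteq> {1}" using D_sub D_ne by auto
    then have "pot q B {1} = 2 ^ B * q ^ (card V - 1) / q ^ B" by (simp add: pot_def)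
    also have "\<dots> \<le> 2 ^ B * q ^ card V / q ^ B"
      using q by (intro divide_right_mono mult_left_mono power_increasing) auto
    also have "\<dots> = 2 powr real B * 2 powr (real (card V) * real L * R1) / 2 powr (real B * real L * R1)"
      by (simp add: q_def powr_realpow[symmetric] powr_powr ac_simps)
    finally show ?thesis .
  qed
  also have "2 powr (real B * R + real L * real B * R) *
      (2 powr real B * 2 powr (real (card V) * real L * R1) / 2 powr (real B * real L * R1)) =
      2 powr (real B * R + real B - real L * (real B * R1 - real B * R - real (card V) * R1))"
    by (simp add: powr_add[symmetric] powr_diff[symmetric] algebra_simps)
  finally have first: "real (card bad_msgs) / real M \<le>
      2 powr (real B * R + real B - real L * (real B * R1 - real B * R - real (card V) * R1))"
    by simp
  have "error_prob V E D K Y W beta N M src_enc relay_enc decoder \<le>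
      real (card bad_msgs) / real M + (\<Sum>v\<in>V - {1}. \<Sum>(w, i)\<in>?I. block_err v i w) / real M"
    using error_prob_bound by (simp only: add_divide_distrib)
  also have "(\<Sum>v\<in>V - {1}. \<Sum>(w, i)\<in>?I. block_err v i w) / real M \<le> real (card V) * real B * \<epsilon>"
    using errs M1 by (simp add: divide_le_eq ac_simps)
  finally have "error_prob V E D K Y W beta N M src_enc relay_enc decoder \<le>
      real (card bad_msgs) / real M + real (card V) * real B * \<epsilon>" by simp
  with first have "error_prob V E D K Y W beta N M src_enc relay_enc decoder \<le>
      2 powr (real B * R + real B - real L * (real B * R1 - real B * R - real (card V) * R1)) +
      real (card V) * real B * \<epsilon>" by linarith
  with M_ge code show ?thesis by (intro exI conjI)
qed

lemma below_cuts_achievable: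
  assumes cut: "\<And>S. S \<in> cuts V D \<Longrightarrow> R < (\<Sum>v\<in>cut_boundary V E S. C v)"
  shows "achievable V E D K Y W beta R"
proof (cases "R \<ge> 0")
  \<comment> \<open>A single message meets any negative rate. When the smallest cut value is 0,
    these are the only rates below it.\<close>
  case False
  show ?thesis unfolding achievable_def
  proof (intro allI impI exI conjI)
    fix \<epsilon> :: real and N :: nat assume \<epsilon>: "\<epsilon> > 0"
    show "2 powr (real N * R) \<le> real 1" using False powr_mono[of "real N * R" 0 2]
      by (simp add: mult_nonneg_nonpos)
    have "\<zero>\<^bsub>K v\<^esub> \<in> carrier (K v)" if "(u, v) \<in> E" for u v
    proof -
      interpret field "K v" using field_K[OF edge_head[OF that]] .
      show ?thesis by simp
    qed
    then show "valid_code K E (\<lambda>v t m. \<zero>\<^bsub>K v\<^esub>) (\<lambda>u v t ys. \<zero>\<^bsub>K v\<^esub>)"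
      unfolding valid_code_def by blast
    show "error_prob V E D K Y W beta N 1 (\<lambda>v t m. \<zero>\<^bsub>K v\<^esub>) (\<lambda>u v t ys. \<zero>\<^bsub>K v\<^esub>) (\<lambda>d ys. 1) \<le> \<epsilon>"
      using \<epsilon> by (simp add: error_prob_def)
  qed
next
  case R: True
  define C0 where "C0 = Min ((\<lambda>S. \<Sum>v\<in>cut_boundary V E S. C v) ` cuts V D)"
  have "cuts V D \<subseteq> Pow V" by (auto simp: cuts_def)
  then have fc: "finite (cuts V D)" using fin_V finite_subset by blast
  have "{1} \<in> cuts V D" using one_V D_ne D_sub by (auto simp: cuts_def)
  then have ne: "cuts V D \<noteq> {}" by blast
  have C0_le: "C0 \<le> (\<Sum>v\<in>cut_boundary V E S. C v)" if "S \<in> cuts V D" for S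
    unfolding C0_def using fc that by (intro Min_le) auto
  have RC0: "R < C0" unfolding C0_def using fc ne cut by (subst Min_gr_iff) auto
  let ?n = "real (card V)"
  have n: "?n \<ge> 1" using fin_V one_V card_gt_0_iff[of V] by (auto simp: Suc_le_eq)
  \<comment> \<open>\<open>R1\<close> is the midpoint between the rate and the smallest cut value.
    \<open>\<delta>\<close> is chosen so that a loss of \<open>\<delta>\<close> at each of at most
    \<open>card V\<close> boundary nodes still leaves \<open>R1\<close> for every cut.\<close>
  define R1 where "R1 = (C0 + R) / 2"
  define \<delta> where "\<delta> = (C0 - R) / (2 * ?n)"
  have \<delta>: "\<delta> > 0" using RC0 n by (simp add: \<delta>_def)
  have R1: "R1 \<ge> 0" "R1 > R" using R RC0 by (auto simp: R1_def)
  have R1_cut: "R1 \<le> (\<Sum>v\<in>cut_boundary V E S. C v - \<delta>)" if S: "S \<in> cuts V D" for S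
  proof -
    have "card (cut_boundary V E S) \<le> card V" using fin_V by (intro card_mono) (auto simp: cut_boundary_def)
    then have "real (card (cut_boundary V E S)) * \<delta> \<le> ?n * \<delta>" using \<delta> by (intro mult_right_mono) auto
    also have "?n * \<delta> = C0 - R1" using n by (simp add: \<delta>_def R1_def field_simps)
    finally show ?thesis using C0_le[OF S] by (simp add: sum_subtractf)
  qed
  \<comment> \<open>Over \<open>B\<close> blocks the scheme gains \<open>B * (R1 - R)\<close> and
    loses at most \<open>card V * R1\<close> to the blocks in which the distinguishing set grows.
    This \<open>B\<close> makes the balance \<open>\<kappa>\<close> positive; afterwards only
    \<open>L\<close> tends to infinity.\<close>
  obtain B :: nat where B: "real B > ?n * R1 / (R1 - R)" using reals_Archimedean2 by blast
  have B1: "B \<ge> 1"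
  proof -
    have "?n * R1 / (R1 - R) \<ge> 0" using R1 by simp
    then have "real B > 0" using B by linarith
    then show ?thesis by simp
  qed
  define \<kappa> where "\<kappa> = real B * R1 - real B * R - ?n * R1"
  have \<kappa>: "\<kappa> > 0" using B R1 by (simp add: \<kappa>_def divide_less_eq algebra_simps)
  show ?thesis unfolding achievable_def
  proof (intro allI impI)
    fix \<epsilon> :: real assume \<epsilon>: "\<epsilon> > 0"
    define \<epsilon>' where "\<epsilon>' = \<epsilon> / (2 * ?n * real B)"
    have \<epsilon>': "\<epsilon>' > 0" using \<epsilon> n B1 by (simp add: \<epsilon>'_def)
    let ?ok = "\<lambda>L v kv. 2 powr (real L * (C v - \<delta>)) \<le> real (card (carrier (K v))) ^ kv \<and>
      (\<forall>(I :: (nat \<times> nat) set) msg. finite I \<longrightarrow> msg \<in> I \<rightarrow> vecs (K v) kv \<longrightarrow>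
      (\<exists>g c dec. (\<forall>t\<in>{1..L}. g t \<in> vecs (K v) kv \<and> c t \<in> carrier (K v)) \<and>
        (\<Sum>i\<in>I. \<Sum>y\<in>PiE {1..L} (\<lambda>_. Y v). if dec y = msg i then 0 else
            \<Prod>t\<in>{1..L}. W v (aff (K v) kv (g t) (c t) (msg i)) (y t)) \<le> \<epsilon>' * real (card I)))"
    have "\<forall>\<^sub>F L in sequentially. \<exists>kv. ?ok L v kv" if v: "v \<in> V - {1}" for v
      unfolding eventually_sequentially
      by (rule good_affine_code[OF field_K[OF v] finite_K[OF v] sym[OF v] \<delta> \<epsilon>'])
    then have "\<forall>\<^sub>F L in sequentially. \<forall>v\<in>V - {1}. \<exists>kv. ?ok L v kv"
      using fin_V by (intro eventually_ball_finite ballI) simp_all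
    moreover have "\<forall>\<^sub>F L in sequentially. 2 powr (real B * R + real B - real L * \<kappa>) < \<epsilon> / 2"
      using \<epsilon> by (intro order_tendstoD(2)[OF tendsto_exp_affine[OF \<kappa>]]) simp
    ultimately have "\<forall>\<^sub>F L in sequentially. (\<forall>v\<in>V - {1}. \<exists>kv. ?ok L v kv) \<and>
        2 powr (real B * R + real B - real L * \<kappa>) < \<epsilon> / 2"
      by (rule eventually_conj)
    then obtain L0 where L0: "\<And>L. L \<ge> L0 \<Longrightarrow> (\<forall>v\<in>V - {1}. \<exists>kv. ?ok L v kv) \<and>
        2 powr (real B * R + real B - real L * \<kappa>) < \<epsilon> / 2"
      unfolding eventually_sequentially by (elim exE) (rule that, blast)
    show "\<exists>N0. \<forall>N\<ge>N0. \<exists>M fs fr g. real M \<ge> 2 powr (real N * R) \<and> valid_code K E fs fr \<and>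
        error_prob V E D K Y W beta N M fs fr g \<le> \<epsilon>"
    \<comment> \<open>From here on \<open>N div B\<close> is at least \<open>Suc L0\<close>, so the
      block length is both positive and large enough.\<close>
    proof (rule exI[of _ "Suc L0 * B"], intro allI impI)
      fix N assume N: "N \<ge> Suc L0 * B"
      define L where "L = N div B"
      have "Suc L0 * B div B \<le> L" unfolding L_def using N by (rule div_le_mono)
      then have LL: "Suc L0 \<le> L" using B1 by simp
      then have L1: "L \<ge> 1" "L \<ge> L0" by auto
      have NB: "B * L \<le> N" "N < B * (L + 1)"
        using B1 dividend_less_times_div[of B N] by (auto simp: L_def)
      have "\<forall>v\<in>V - {1}. \<exists>kv. ?ok L v kv" using L0[OF L1(2)] by (rule conjunct1)
      then obtain k where k: "\<forall>v\<in>V - {1}. ?ok L v (k v)" by (rule bchoice[THEN exE])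
      have "\<exists>M fs fr g. real M \<ge> 2 powr (real N * R) \<and> valid_code K E fs fr \<and>
        error_prob V E D K Y W beta N M fs fr g \<le>
          2 powr (real B * R + real B - real L * (real B * R1 - real B * R - ?n * R1)) + ?n * real B * \<epsilon>'"
      proof (rule block_scheme_exists[OF R B1 L1(1) NB R1(1) R1_cut])
        fix v assume v: "v \<in> V - {1}"
        show "2 powr (real L * (C v - \<delta>)) \<le> real (card (carrier (K v))) ^ k v"
          using bspec[OF k v] by (rule conjunct1)
        fix I :: "(nat \<times> nat) set" and msg
        assume "finite I" "msg \<in> I \<rightarrow> G k v"
        then show "\<exists>g c dec. (\<forall>t\<in>{1..L}. g t \<in> G k v \<and> c t \<in> carrier (K v)) \<and>
          (\<Sum>i\<in>I. \<Sum>y\<in>PiE {1..L} (\<lambda>_. Y v). if dec y = msg i then 0 else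
            \<Prod>t\<in>{1..L}. W v (aff (K v) (k v) (g t) (c t) (msg i)) (y t)) \<le> \<epsilon>' * real (card I)"
          using bspec[OF k v, THEN conjunct2] by blast
      qed
      then obtain M fs fr g where code: "real M \<ge> 2 powr (real N * R)" "valid_code K E fs fr"
        "error_prob V E D K Y W beta N M fs fr g \<le> 2 powr (real B * R + real B - real L * \<kappa>) + ?n * real B * \<epsilon>'"
        unfolding \<kappa>_def by (elim exE conjE)
      have "?n * real B * \<epsilon>' = \<epsilon> / 2" using n B1 by (simp add: \<epsilon>'_def)
      then have "error_prob V E D K Y W beta N M fs fr g \<le> \<epsilon>"
        using code(3) L0[OF L1(2), THEN conjunct2] by linarith
      then show "\<exists>M fs fr g. real M \<ge> 2 powr (real N * R) \<and> valid_code K E fs fr \<and>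
        error_prob V E D K Y W beta N M fs fr g \<le> \<epsilon>"
        using code by (intro exI conjI)
    qed
  qed
qed

theorem multicast_capacity_eq:
  "multicast_capacity V E D K Y W beta = Min ((\<lambda>S. \<Sum>v\<in>cut_boundary V E S. C v) ` cuts V D)"
proof -
  let ?f = "\<lambda>S. \<Sum>v\<in>cut_boundary V E S. C v"
  let ?A = "{R. achievable V E D K Y W beta R}"
  have "cuts V D \<subseteq> Pow V" by (auto simp: cuts_def)
  then have fc: "finite (cuts V D)" using fin_V finite_subset by blast
  have "{1} \<in> cuts V D" using one_V D_ne D_sub by (auto simp: cuts_def)
  then have ne: "cuts V D \<noteq> {}" by blast
  have up: "R \<le> Min (?f ` cuts V D)" if "R \<in> ?A" for R
    using that fc ne achievable_le_cut by (subst Min_ge_iff) auto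
  have low: "R \<in> ?A" if "R < Min (?f ` cuts V D)" for R
  proof -
    have "R < ?f S" if "S \<in> cuts V D" for S
    proof -
      have "Min (?f ` cuts V D) \<le> ?f S" using fc that by (intro Min_le) auto
      then show ?thesis using \<open>R < Min (?f ` cuts V D)\<close> by linarith
    qed
    then show ?thesis using below_cuts_achievable by blast
  qed
  have "Sup ?A = Min (?f ` cuts V D)"
  proof (rule cSup_eq)
    fix R assume "R \<in> ?A"
    then show "R \<le> Min (?f ` cuts V D)" by (rule up)
  next
    fix y assume y: "\<And>R. R \<in> ?A \<Longrightarrow> R \<le> y"
    \<comment> \<open>Achievability is established strictly below the minimum only; density of the
      reals closes the gap for the supremum.\<close>
    show "Min (?f ` cuts V D) \<le> y"
      by (rule dense_le) (rule y[OF low])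
  qed
  then show ?thesis unfolding multicast_capacity_def .
qed

end

theorem theorem4:
  fixes n :: nat and V :: "nat set" and E :: "(nat \<times> nat) set" and D :: "nat set"
    and K :: "nat \<Rightarrow> 'a ring" and Y :: "nat \<Rightarrow> 'b set" and W :: "nat \<Rightarrow> 'a \<Rightarrow> 'b \<Rightarrow> real"
    and beta :: "nat \<Rightarrow> nat \<Rightarrow> 'a"
  assumes V_def: "V = {1..n}"
    and E_sub: "E \<subseteq> V \<times> V"
    and src_no_in: "\<forall>u. (u, 1) \<notin> E"
    and D_sub: "D \<subseteq> V - {1}"
    and D_ne: "D \<noteq> {}"
    and D_no_out: "\<forall>d\<in>D. \<forall>w. (d, w) \<notin> E"
    and fields: "\<forall>v\<in>V - {1}. field (K v) \<and> finite (carrier (K v))"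
    and channels: "\<forall>v\<in>V - {1}. symmetric_dmc (carrier (K v)) (Y v) (W v)"
    and coeffs: "\<forall>(u, v)\<in>E. beta u v \<in> carrier (K v) - {\<zero>\<^bsub>K v\<^esub>}"
  shows "multicast_capacity V E D K Y W beta =
           Min ((\<lambda>S. \<Sum>v\<in>cut_boundary V E S. dmc_capacity (carrier (K v)) (Y v) (W v))
                ` cuts V D)"
proof -
  interpret ff_network V E D K Y W beta
  proof (rule ff_network.intro)
    show "finite V" using V_def by simp
    \<comment> \<open>A destination in \<open>{1..n}\<close> forces
      \<open>n \<ge> 1\<close>.\<close>
    show "1 \<in> V" using D_sub D_ne V_def by fastforce
    show "(u, 1) \<notin> E" for u using src_no_in by blast
    show "field (K v)" "finite (carrier (K v))" "symmetric_dmc (carrier (K v)) (Y v) (W v)"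
      if "v \<in> V - {1}" for v using fields channels that by blast+
    show "beta u v \<in> carrier (K v) - {\<zero>\<^bsub>K v\<^esub>}" if "(u, v) \<in> E" for u v using coeffs that by blast
  qed (fact E_sub D_sub D_ne)+
  show ?thesis by (rule multicast_capacity_eq)
qed

end
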